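(* The following polynomials have the spectral containment property: 1. The elementary symmetric polynomials $e_1,\dots,e_n\in\mathbb{R}[x_1,\dots,x_n]$. 2. For any $n\ge k\ge d\ge1$, the polynomial $e_d(x_1,\dots,x_n)+\varepsilon\, e_d(x_1,\dots,x_k)\in\mathbb{R}[x_1,\dots,x_n]$ for all real $\varepsilon$ with $|\varepsilon|$ sufficiently small. 3. All stable homogeneous linear polynomials. 4. Any homogeneous multiaffine stable polynomial $p\in\mathbb{R}[x_1,\dots,x_n]$ of degree $n-1$ that is interlaced by $e_{n-2}(x_1,\dots,x_n)$. 5. $e_2(x_1,x_2,x_3,x_4)-\varepsilon(x_1x_2+x_1x_3)\in\mathbb{R}[x_1,x_2,x_3,x_4]$ for all real $\varepsilon$ with $|\varepsilon|$ sufficiently small. Moreover, if a homogeneous multiaffine stable polynomial $p\in\mathbb{R}[x_1,\dots,x_n]$ has the spectral containment property and $x_0$ is a new variable not used in $p$, then $x_0p\in\mathbb{R}[x_0,x_1,\dots,x_n]$ has the spectral containment property.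
   Context: $e_d(x_1,\dots,x_m)=\sum_{J\subseteq\{1,\dots,m\},|J|=d}\prod_{i\in J}x_i$ (with $e_0=1$). A polynomial in $m$ variables is stable if it does not vanish at any point of $\mathbb{C}^m$ all of whose coordinates have positive imaginary part. It is multiaffine if it is a linear combination of square-free monomials. For a multiaffine polynomial $p=\sum_J a_J\prod_{i\in J}x_i$ in variables indexed by a finite set $N$, the minor lift is $P(X)=\sum_{J\subseteq N}a_J\det(X_J)$, where $X$ is a symmetric matrix of indeterminates with rows and columns indexed by $N$ and $X_J$ is its principal submatrix indexed by $J$ (with $\det X_\emptyset=1$). A homogeneous polynomial $f$ on a real vector space $V$ is hyperbolic with respect to $a\in V$ if $f(a)\neq0$ and $f(v-ta)$ has only real roots in $t$ for every $v\in V$; its hyperbolicity cone with respect to $a$ is the set of $v$ such that all roots of $f(v-ta)$ are nonnegative. If $p$ is homogeneous, multiaffine and stable, then $p$ is hyperbolic with respect to the all-ones vector $\mathbf 1$ and its minor lift $P$ is hyperbolic with respect to the identity matrix; $H(p)$ and $H(P)$ are the corresponding hyperbolicity cones. An eigenvalue vector of a real symmetric matrix is a vector listing its eigenvalues with multiplicity, in some order. A homogeneous multiaffine stable polynomial $p$ with minor lift $P$ has the spectral containment property if for every $A\in H(P)$ there is an eigenvalue vector $\lambda$ of $A$ with $\lambda\in H(p)$. (Since the property is defined only for stable polynomials, asserting it includes asserting stability.) For homogeneous $p$ of degree $d$ and $q$ of degree $d-1$, both hyperbolic with respect to $\mathbf 1$, one says $q$ interlaces $p$ (or $p$ is interlaced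 by $q$) if for every $v$ the roots $\alpha_1\le\dots\le\alpha_d$ of $p(v-t\mathbf 1)$ and $\beta_1\le\dots\le\beta_{d-1}$ of $q(v-t\mathbf 1)$ satisfy $\alpha_1\le\beta_1\le\alpha_2\le\dots\le\beta_{d-1}\le\alpha_d$. *)

theory Defs
  imports
    "HOL-Library.Poly_Mapping"
    "HOL-Computational_Algebra.Computational_Algebra"
    "Jordan_Normal_Form.Char_Poly"
    "Jordan_Normal_Form.DL_Submatrix"
begin

text \<open>
  Indices are 0-based, as in the matrix library: \<open>\<real>[x\<^sub>1, \<dots>, x\<^sub>n]\<close> is the set of polynomials whose
  variables have indices in \<open>{..<n}\<close>. An exponent vector is an element of \<open>nat \<Rightarrow>\<^sub>0 nat\<close>.
\<close>

type_synonym monomial = "nat \<Rightarrow>\<^sub>0 nat"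
type_synonym mpoly = "monomial \<Rightarrow>\<^sub>0 real"

definition Var :: "nat \<Rightarrow> mpoly" where
  "Var i = Poly_Mapping.single (Poly_Mapping.single i 1) 1"

definition Const :: "real \<Rightarrow> mpoly" where
  "Const c = Poly_Mapping.single 0 c"

definition poly_ring :: "nat \<Rightarrow> mpoly set" where
  "poly_ring n = {p. \<forall>m\<in>Poly_Mapping.keys p. Poly_Mapping.keys m \<subseteq> {..<n}}"

definition eval :: "mpoly \<Rightarrow> 'a :: {comm_ring_1, real_algebra_1} vec \<Rightarrow> 'a" where
  "eval p x = (\<Sum>m\<in>Poly_Mapping.keys p. of_real (Poly_Mapping.lookup p m) *
     (\<Prod>i\<in>Poly_Mapping.keys m. (x $ i) ^ Poly_Mapping.lookup m i))"

definition homogeneous :: "nat \<Rightarrow> mpoly \<Rightarrow> bool" where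
  "homogeneous d p \<longleftrightarrow>
     (\<forall>m\<in>Poly_Mapping.keys p. (\<Sum>i\<in>Poly_Mapping.keys m. Poly_Mapping.lookup m i) = d)"

definition multiaffine :: "mpoly \<Rightarrow> bool" where
  "multiaffine p \<longleftrightarrow> (\<forall>m\<in>Poly_Mapping.keys p. \<forall>i. Poly_Mapping.lookup m i \<le> 1)"

definition stable_poly :: "nat \<Rightarrow> mpoly \<Rightarrow> bool" where
  "stable_poly n p \<longleftrightarrow>
     (\<forall>z\<in>(carrier_vec n :: complex vec set). (\<forall>i<n. Im (z $ i) > 0) \<longrightarrow> eval p z \<noteq> 0)"

definition elem_sym :: "nat \<Rightarrow> nat \<Rightarrow> mpoly" where
  "elem_sym d m = (\<Sum>J | J \<subseteq> {..<m} \<and> card J = d. \<Prod>i\<in>J. Var i)"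

text \<open>The minor lift, as a function of the symmetric matrix; the coefficient of
  \<open>\<Prod>i\<in>J. x\<^sub>i\<close> is looked up at the indicator exponent vector of \<open>J\<close>.\<close>

definition minor_lift :: "nat \<Rightarrow> mpoly \<Rightarrow> real mat \<Rightarrow> real" where
  "minor_lift n p A = (\<Sum>J\<in>Pow {..<n}.
     Poly_Mapping.lookup p (\<Sum>i\<in>J. Poly_Mapping.single i 1) * det (submatrix A J J))"

definition sym_mats :: "nat \<Rightarrow> real mat set" where
  "sym_mats n = {A \<in> carrier_mat n n. transpose_mat A = A}"

definition ones_vec :: "nat \<Rightarrow> real vec" where
  "ones_vec n = vec n (\<lambda>_. 1)"

text \<open>Vectors and matrices have carrier sets rather than being instances of \<open>real_vector\<close>, so the
  real vector space in the notions of hyperbolicity is given by a carrier \<open>V\<close> and its scalar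
  multiplication \<open>scale\<close>. \<open>line_poly scale f a v\<close> is \<open>f (v - t a)\<close> as a univariate polynomial
  in \<open>t\<close>; it is only meaningful for polynomial functions \<open>f\<close>.\<close>

definition line_poly ::
    "(real \<Rightarrow> 'v \<Rightarrow> 'v) \<Rightarrow> ('v :: minus \<Rightarrow> real) \<Rightarrow> 'v \<Rightarrow> 'v \<Rightarrow> real poly" where
  "line_poly scale f a v = (THE q. \<forall>t. poly q t = f (v - scale t a))"

definition hyperbolic ::
    "'v set \<Rightarrow> (real \<Rightarrow> 'v \<Rightarrow> 'v) \<Rightarrow> ('v :: minus \<Rightarrow> real) \<Rightarrow> 'v \<Rightarrow> bool" where
  "hyperbolic V scale f a \<longleftrightarrow> a \<in> V \<and> f a \<noteq> 0 \<and>
     (\<forall>v\<in>V. \<forall>z :: complex. poly (map_poly of_real (line_poly scale f a v)) z = 0 \<longrightarrow> z \<in> \<real>)"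

text \<open>For hyperbolic \<open>f\<close> the roots of \<open>f (v - t a)\<close> are all real, so only real \<open>t\<close> matter here.\<close>

definition hyperbolicity_cone ::
    "'v set \<Rightarrow> (real \<Rightarrow> 'v \<Rightarrow> 'v) \<Rightarrow> ('v :: minus \<Rightarrow> real) \<Rightarrow> 'v \<Rightarrow> 'v set" where
  "hyperbolicity_cone V scale f a = {v \<in> V. \<forall>t. f (v - scale t a) = 0 \<longrightarrow> t \<ge> 0}"

abbreviation cone_poly :: "nat \<Rightarrow> mpoly \<Rightarrow> real vec set" where
  "cone_poly n p \<equiv> hyperbolicity_cone (carrier_vec n) smult_vec (eval p) (ones_vec n)"

abbreviation cone_lift :: "nat \<Rightarrow> mpoly \<Rightarrow> real mat set" where
  "cone_lift n p \<equiv> hyperbolicity_cone (sym_mats n) smult_mat (minor_lift n p) (1\<^sub>m n)"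

definition eigenvalue_vector :: "real mat \<Rightarrow> real vec \<Rightarrow> bool" where
  "eigenvalue_vector A l \<longleftrightarrow> l \<in> carrier_vec (dim_row A) \<and>
     char_poly A = (\<Prod>i<dim_row A. [:- (l $ i), 1:])"

definition spectral_containment :: "nat \<Rightarrow> mpoly \<Rightarrow> bool" where
  "spectral_containment n p \<longleftrightarrow>
     p \<in> poly_ring n \<and> (\<exists>d. homogeneous d p) \<and> multiaffine p \<and> stable_poly n p \<and>
     (\<forall>A\<in>cone_lift n p. \<exists>l. eigenvalue_vector A l \<and> l \<in> cone_poly n p)"

text \<open>The roots of \<open>p (v - t \<one>)\<close>, with multiplicity and in nondecreasing order.\<close>

definition sorted_roots :: "nat \<Rightarrow> mpoly \<Rightarrow> real vec \<Rightarrow> real list" where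
  "sorted_roots n p v =
     sorted_list_of_multiset (proots (line_poly smult_vec (eval p) (ones_vec n) v))"

definition interlaces :: "nat \<Rightarrow> mpoly \<Rightarrow> mpoly \<Rightarrow> bool" where
  "interlaces n q p \<longleftrightarrow>
     (\<exists>d. homogeneous (Suc d) p \<and> homogeneous d q \<and>
        hyperbolic (carrier_vec n) smult_vec (eval p) (ones_vec n) \<and>
        hyperbolic (carrier_vec n) smult_vec (eval q) (ones_vec n) \<and>
        (\<forall>v\<in>carrier_vec n. \<forall>i<d.
           sorted_roots n p v ! i \<le> sorted_roots n q v ! i \<and>
           sorted_roots n q v ! i \<le> sorted_roots n p v ! Suc i))"

end

theory Submission
  imports Defs "Jordan_Normal_Form.Schur_Decomposition"
begin

text \<open>A multiaffine polynomial is handled through its coefficient function \<open>a\<close> on finite sets of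
  indices: \<open>maff n a x = \<Sum>\<^sub>J a J (\<Prod>i\<in>J. x i)\<close>, with minor lift
  \<open>mlift n a M = \<Sum>\<^sub>J a J det M\<^sub>J\<close>. Both make sense over every commutative ring, so one identity serves
  real arguments, complex arguments, and polynomials in an auxiliary indeterminate. Changing the sign if
  necessary, let \<open>p(\<one>) > 0\<close>. Then \<open>v\<close> lies in the cone of \<open>p\<close> iff \<open>p(v + s\<one>) \<noteq> 0\<close> for all \<open>s > 0\<close>, and
  likewise for the minor lift \<open>P\<close> and the line \<open>A + sI\<close>.

  Let \<open>A\<close> be a symmetric matrix with eigenvalues \<open>l\<close>, and for a permutation \<open>\<sigma>\<close> let
  \<open>f\<^sub>\<sigma>(s) = p(l \<circ> \<sigma> + s\<one>)\<close>. Suppose that no \<open>l \<circ> \<sigma>\<close> lies in the cone of \<open>p\<close>, that is, every \<open>f\<^sub>\<sigma>\<close> has a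
  positive root. For all polynomials in the list two facts then show that \<open>A\<close> is outside the cone of \<open>P\<close>.

  The first fact is a common interlacer. If \<open>q\<close> is a symmetric polynomial that interlaces \<open>p\<close>, then
  \<open>q(l \<circ> \<sigma> + s\<one>)\<close> does not depend on \<open>\<sigma>\<close> and interlaces every \<open>f\<^sub>\<sigma>\<close>. Consequently all \<open>f\<^sub>\<sigma>\<close> are
  nonpositive at \<open>s\<^sub>0 > 0\<close>, the smallest of their largest roots (\<open>common_interlacer_nonpos\<close>,
  \<open>corank_one_interlacing\<close>). The interlacer is \<open>e\<^bsub>d-1\<^esub>\<close>. For \<open>p = e\<^sub>d + \<epsilon> e\<^sub>d(x\<^sub>1, \<dots>, x\<^sub>k)\<close> and for the
  quadratic, interlacing follows from the stability of \<open>p + y e\<^bsub>d-1\<^esub>\<close>, a polynomial of the same shape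
  in one more variable. In degree \<open>n - 1\<close> interlacing is the hypothesis, and in degree one it is trivial.

  The second fact is a mixture bound: \<open>P(A + sI) \<le> max\<^sub>\<sigma> f\<^sub>\<sigma>(s)\<close>. By \<open>pminor_spectral_form\<close>, a
  principal minor of \<open>A\<close> is a combination of the products \<open>\<Prod>k\<in>T. l k\<close> with nonnegative weights
  that depend only on the eigenvectors. Hence the sum of the
  \<open>d\<close>-minors inside \<open>{..<k}\<close> is a convex combination of the values \<open>e\<^sub>d(l\<^sub>T)\<close> with \<open>|T| = k\<close>
  (\<open>principal_minor_sums_mixture\<close>). In degrees one and \<open>n - 1\<close> the weights form a doubly stochastic
  matrix and the rearrangement inequality applies (\<open>doubly_stochastic_le_permutation\<close>). For the quadratic the
  weights are the squared two-by-two minors of two orthonormal vectors (\<open>pair_mixture\<close>).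

  Together the two facts give \<open>P(A + s\<^sub>0I) \<le> 0\<close>. Since \<open>P(A + sI) > 0\<close> for large \<open>s\<close>, there is a root in
  \<open>[s\<^sub>0, \<infinity>)\<close> (\<open>containment_of_family\<close>).

  Stability of the perturbed elementary symmetric polynomials is a two-group version of the
  Grace--Walsh--Szego theorem: it reduces to one univariate polynomial with simple real roots, and
  these persist under small perturbations (\<open>pert_coefs_stable\<close>). The quadratic
  has Lorentzian signature, which gives its stability directly (\<open>quad_coefs_stable\<close>).

  For \<open>x\<^sub>n p\<close> a different argument is used. The minor lift of a stable polynomial does not vanish at symmetric
  matrices with positive definite imaginary part (\<open>mlift_nonzero\<close>). This implies that for \<open>A\<close> in the cone
  of the lift of \<open>x\<^sub>n p\<close> and \<open>s > 0\<close>, the Schur complement \<open>B\<close> of the last diagonal entry of \<open>A + sI\<close> lies in the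
  cone of \<open>P\<close> (\<open>Schur_complement_in_cone\<close>). By assumption \<open>B\<close> has an eigenvalue vector in the cone
  of \<open>p\<close>. Now \<open>A + sI\<close> dominates \<open>B \<oplus> 0\<close>, so by Weyl monotonicity its eigenvalues, in a suitable
  order, dominate those of \<open>B \<oplus> 0\<close>. The cone of \<open>p\<close> is closed under increasing coordinates
  (\<open>cone_mono\<close>), and letting \<open>s\<close> tend to \<open>0\<close> finishes the proof (\<open>border_contains_spectra\<close>).\<close>

section \<open>Principal minors\<close>

text \<open>The principal minor indexed by \<open>J\<close>, as a sum over the permutations of the set \<open>J\<close> itself. This avoids
  renumbering \<open>J\<close>, and matrices can be given as functions over an arbitrary commutative ring.\<close>
definition pminor :: "(nat \<Rightarrow> nat \<Rightarrow> 'a :: comm_ring_1) \<Rightarrow> nat set \<Rightarrow> 'a" where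
  "pminor M J = (\<Sum>p | p permutes J. signof p * (\<Prod>i\<in>J. M i (p i)))"

lemma pminor_cong:
  assumes "\<And>i j. i \<in> J \<Longrightarrow> j \<in> J \<Longrightarrow> M i j = N i j"
  shows "pminor M J = pminor N J"
  unfolding pminor_def
  by (intro sum.cong refl arg_cong2[where f = "(*)"] prod.cong)
    (use assms permutes_in_image in fastforce)

lemma pminor_empty [simp]: "pminor M {} = 1"
  by (simp add: pminor_def sign_def)

lemma pminor_singleton [simp]: "pminor M {i} = M i i"
  by (simp add: pminor_def)

lemma pminor_pair:
  assumes "i \<noteq> j"
  shows "pminor M {i, j} = M i i * M j j - M i j * M j i"
proof -
  have *: "{p. p permutes {i, j}} = {id, Transposition.transpose i j}"
    by (auto simp: permutes_doubleton_iff permutes_swap_id)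
  have "id \<noteq> Transposition.transpose i j"
    using assms by (metis id_apply transpose_apply_first)
  then show ?thesis
    unfolding pminor_def * using assms by (simp add: sign_swap_id sign_id)
qed

lemma (in comm_ring_hom) hom_pminor: "hom (pminor M J) = pminor (\<lambda>i j. hom (M i j)) J"
  unfolding pminor_def by (simp add: hom_distribs)

lemma pminor_lessThan: "pminor M {..<n} = det (mat n n (\<lambda>(i, j). M i j))"
  unfolding pminor_def det_def
  by (auto simp: atLeast0LessThan intro!: sum.cong prod.cong dest: permutes_in_image[of _ "{..<n}"])

text \<open>Expansion of \<open>det (diag y + M)\<close> by the set of rows from which an entry of \<open>M\<close> is
  taken: in the remaining rows only permutations that fix the index contribute.\<close>
lemma pminor_diag_add:
  fixes M :: "nat \<Rightarrow> nat \<Rightarrow> 'a :: comm_ring_1"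
  assumes "finite K"
  shows "pminor (\<lambda>i j. (if i = j then y i else 0) + M i j) K
    = (\<Sum>S\<in>Pow K. (\<Prod>i\<in>K - S. y i) * pminor M S)"
proof -
  let ?\<delta> = "\<lambda>i j. if i = j then y i else (0::'a)"
  have prm: "(\<Sum>p | p permutes K. signof p * ((\<Prod>i\<in>S. M i (p i)) * (\<Prod>i\<in>K - S. ?\<delta> i (p i))))
      = (\<Prod>i\<in>K - S. y i) * pminor M S" if S: "S \<subseteq> K" for S
  proof -
    have "(\<Sum>p | p permutes K. signof p * ((\<Prod>i\<in>S. M i (p i)) * (\<Prod>i\<in>K - S. ?\<delta> i (p i))))
        = (\<Sum>p | p permutes S. signof p * ((\<Prod>i\<in>S. M i (p i)) * (\<Prod>i\<in>K - S. ?\<delta> i (p i))))"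
    proof (rule sum.mono_neutral_right)
      show "finite {p. p permutes K}" using assms by (rule finite_permutations)
      show "{p. p permutes S} \<subseteq> {p. p permutes K}" using S by (auto intro: permutes_subset)
      show "\<forall>p\<in>{p. p permutes K} - {p. p permutes S}.
          signof p * ((\<Prod>i\<in>S. M i (p i)) * (\<Prod>i\<in>K - S. ?\<delta> i (p i))) = 0"
      proof
        fix p assume p: "p \<in> {p. p permutes K} - {p. p permutes S}"
        then have "\<exists>i\<in>K - S. p i \<noteq> i"
          using permutes_superset[of p K S] by auto
        then have "(\<Prod>i\<in>K - S. ?\<delta> i (p i)) = 0"
          using assms by (intro prod_zero) force+
        then show "signof p * ((\<Prod>i\<in>S. M i (p i)) * (\<Prod>i\<in>K - S. ?\<delta> i (p i))) = 0" by simp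
      qed
    qed
    also have "\<dots> = (\<Sum>p | p permutes S. (\<Prod>i\<in>K - S. y i) * (signof p * (\<Prod>i\<in>S. M i (p i))))"
    proof (intro sum.cong refl)
      fix p assume "p \<in> {p. p permutes S}"
      then have "(\<Prod>i\<in>K - S. ?\<delta> i (p i)) = (\<Prod>i\<in>K - S. y i)"
        by (intro prod.cong refl) (auto dest: permutes_not_in)
      then show "signof p * ((\<Prod>i\<in>S. M i (p i)) * (\<Prod>i\<in>K - S. ?\<delta> i (p i)))
          = (\<Prod>i\<in>K - S. y i) * (signof p * (\<Prod>i\<in>S. M i (p i)))" by simp
    qed
    finally show ?thesis by (simp add: pminor_def sum_distrib_left)
  qed
  have "pminor (\<lambda>i j. ?\<delta> i j + M i j) K
      = (\<Sum>p | p permutes K. signof p * (\<Prod>i\<in>K. M i (p i) + ?\<delta> i (p i)))"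
    by (simp add: pminor_def add.commute)
  also have "\<dots> = (\<Sum>p | p permutes K. \<Sum>S\<in>Pow K.
      signof p * ((\<Prod>i\<in>S. M i (p i)) * (\<Prod>i\<in>K - S. ?\<delta> i (p i))))"
    by (simp add: prod_add[OF assms] sum_distrib_left)
  also have "\<dots> = (\<Sum>S\<in>Pow K. \<Sum>p | p permutes K.
      signof p * ((\<Prod>i\<in>S. M i (p i)) * (\<Prod>i\<in>K - S. ?\<delta> i (p i))))"
    by (rule sum.swap)
  also have "\<dots> = (\<Sum>S\<in>Pow K. (\<Prod>i\<in>K - S. y i) * pminor M S)"
    using prm by (intro sum.cong) auto
  finally show ?thesis .
qed

lemma pminor_add_diag_entry:
  fixes M :: "nat \<Rightarrow> nat \<Rightarrow> 'a :: comm_ring_1"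
  assumes "finite J" "n \<notin> J"
  shows "pminor (\<lambda>i j. (if i = j then (if i = n then w else 0) else 0) + M i j) (insert n J)
    = w * pminor M J + pminor M (insert n J)"
proof -
  have "(\<Sum>S\<in>Pow (insert n J). (\<Prod>i\<in>insert n J - S. if i = n then w else 0) * pminor M S)
      = (\<Sum>S\<in>{J, insert n J}. (\<Prod>i\<in>insert n J - S. if i = n then w else 0) * pminor M S)"
  proof (rule sum.mono_neutral_right)
    show "\<forall>S\<in>Pow (insert n J) - {J, insert n J}.
        (\<Prod>i\<in>insert n J - S. if i = n then w else 0) * pminor M S = 0"
    proof
      fix S assume S: "S \<in> Pow (insert n J) - {J, insert n J}"
      then have "\<not> J \<subseteq> S" by auto
      then have "\<exists>i\<in>insert n J - S. i \<noteq> n" using assms by auto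
      then have "(\<Prod>i\<in>insert n J - S. if i = n then w else 0) = 0"
        using assms by (intro prod_zero) auto
      then show "(\<Prod>i\<in>insert n J - S. if i = n then w else 0) * pminor M S = 0" by simp
    qed
  qed (use assms in auto)
  also have "\<dots> = w * pminor M J + pminor M (insert n J)"
  proof -
    have "J \<noteq> insert n J" "insert n J - J = {n}" using assms by auto
    then show ?thesis by simp
  qed
  finally show ?thesis using pminor_diag_add[of "insert n J" "\<lambda>i. if i = n then w else 0" M] assms
    by simp
qed

text \<open>Replacing the rows outside \<open>J\<close> by unit rows turns a principal minor into a determinant of full
  size, to which multiplicativity and the matrix library apply.\<close>
lemma pminor_masked:
  fixes M :: "nat \<Rightarrow> nat \<Rightarrow> 'a :: comm_ring_1"
  assumes "finite K" "J \<subseteq> K"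
  shows "pminor M J = pminor (\<lambda>i j. if i \<in> J then M i j else if i = j then 1 else 0) K"
proof -
  let ?X = "\<lambda>i j. if i \<in> J then M i j else if i = j then 1 else (0::'a)"
  have fin: "finite J" using assms finite_subset by blast
  have "pminor ?X K = (\<Sum>p | p permutes J. signof p * (\<Prod>i\<in>K. ?X i (p i)))"
    unfolding pminor_def
  proof (rule sum.mono_neutral_right)
    show "finite {p. p permutes K}" using assms(1) by (rule finite_permutations)
    show "{p. p permutes J} \<subseteq> {p. p permutes K}" using assms by (auto intro: permutes_subset)
    show "\<forall>p\<in>{p. p permutes K} - {p. p permutes J}. signof p * (\<Prod>i\<in>K. ?X i (p i)) = 0"
    proof
      fix p assume p: "p \<in> {p. p permutes K} - {p. p permutes J}"
      then have "\<exists>i\<in>K - J. p i \<noteq> i"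
        using permutes_superset[of p K J] by auto
      then have "(\<Prod>i\<in>K. ?X i (p i)) = 0"
        using assms by (intro prod_zero) auto
      then show "signof p * (\<Prod>i\<in>K. ?X i (p i)) = 0" by simp
    qed
  qed
  also have "\<dots> = pminor M J"
    unfolding pminor_def
  proof (intro sum.cong refl)
    fix p assume "p \<in> {p. p permutes J}"
    then have "(\<Prod>i\<in>K. ?X i (p i)) = (\<Prod>i\<in>J. M i (p i))"
      using assms by (intro prod.mono_neutral_cong_right) (auto dest: permutes_not_in)
    then show "signof p * (\<Prod>i\<in>K. ?X i (p i)) = signof p * (\<Prod>i\<in>J. M i (p i))" by simp
  qed
  finally show ?thesis by simp
qed

lemma det_submatrix:
  fixes A :: "'a :: comm_ring_1 mat"
  assumes A: "A \<in> carrier_mat n n" and J: "J \<subseteq> {..<n}"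
  shows "det (submatrix A J J) = pminor (\<lambda>i j. A $$ (i, j)) J"
proof -
  define m where "m = card J"
  have fin: "finite J" using J finite_subset by blast
  have set: "{i. i < n \<and> i \<in> J} = J" using J by auto
  have pick: "pick J i \<in> J" "card {a\<in>J. a < pick J i} = i" if "i < m" for i
    using pick_in_set_le card_pick_le that by (auto simp: m_def)
  have inj: "inj_on (pick J) {..<m}"
    by (rule inj_onI) (metis lessThan_iff pick(2))
  have bij: "bij_betw (pick J) {..<m} J"
    unfolding bij_betw_def
  proof
    show "pick J ` {..<m} = J"
      by (rule card_subset_eq[OF fin]) (use pick inj in \<open>auto simp: card_image m_def\<close>)
  qed (rule inj)
  have sub: "submatrix A J J = mat m m (\<lambda>(i, j). A $$ (pick J i, pick J j))"
    unfolding submatrix_def using A set by (simp add: m_def)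
  let ?f = "\<lambda>p x. if x \<in> J then pick J (p (inv_into {..<m} (pick J) x)) else x"
  have f: "?f = map_permutation {..<m} (pick J)"
    using bij by (auto simp: fun_eq_iff map_permutation_def restrict_id_def bij_betw_def)
  have "pminor (\<lambda>i j. A $$ (i, j)) J
      = (\<Sum>p | p permutes {..<m}. signof (?f p) * (\<Prod>i\<in>J. A $$ (i, ?f p i)))"
    unfolding pminor_def
    by (rule sum.reindex_bij_betw[OF bij_betw_permutations[OF bij], symmetric])
  also have "\<dots> = (\<Sum>p | p permutes {..<m}. signof p * (\<Prod>i<m. A $$ (pick J i, pick J (p i))))"
  proof (intro sum.cong refl)
    fix p assume p: "p \<in> {p. p permutes {..<m}}"
    have "sign (?f p) = sign p"
      using f sign_map_permutation[OF inj, of p] p by (simp add: fun_eq_iff)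
    moreover have "(\<Prod>i\<in>J. A $$ (i, ?f p i)) = (\<Prod>i<m. A $$ (pick J i, ?f p (pick J i)))"
      by (rule prod.reindex_bij_betw[OF bij, symmetric])
    moreover have "\<dots> = (\<Prod>i<m. A $$ (pick J i, pick J (p i)))"
      by (intro prod.cong refl) (use inj pick in auto)
    ultimately show "signof (?f p) * (\<Prod>i\<in>J. A $$ (i, ?f p i))
        = signof p * (\<Prod>i<m. A $$ (pick J i, pick J (p i)))" by simp
  qed
  also have "\<dots> = pminor (\<lambda>i j. A $$ (pick J i, pick J j)) {..<m}" by (simp add: pminor_def)
  finally show ?thesis by (simp add: sub pminor_lessThan)
qed

lemma pminor_zero_column:
  assumes "finite K" "n \<in> K" "\<And>i. i \<in> K \<Longrightarrow> M i n = 0"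
  shows "pminor M K = 0"
  unfolding pminor_def
proof (rule sum.neutral, rule ballI)
  fix p assume "p \<in> {p. p permutes K}"
  then have p: "p permutes K" by simp
  have "n \<in> p ` K" unfolding permutes_image[OF p] by (rule assms(2))
  then obtain k where k: "k \<in> K" "n = p k" by (rule imageE)
  have "\<exists>i\<in>K. M i (p i) = 0"
    by (rule bexI[OF _ k(1)]) (simp add: assms(3)[OF k(1)] flip: k(2))
  then have "(\<Prod>i\<in>K. M i (p i)) = 0" using assms(1) by (intro prod_zero)
  then show "signof p * (\<Prod>i\<in>K. M i (p i)) = 0" by simp
qed

lemma pminor_mult:
  fixes M N :: "nat \<Rightarrow> nat \<Rightarrow> 'a :: comm_ring_1"
  shows "pminor (\<lambda>i j. \<Sum>k<n. M i k * N k j) {..<n} = pminor M {..<n} * pminor N {..<n}"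
proof -
  have "mat n n (\<lambda>(i, j). \<Sum>k<n. M i k * N k j)
      = mat n n (\<lambda>(i, j). M i j) * mat n n (\<lambda>(i, j). N i j)"
    by (rule eq_matI) (auto simp: scalar_prod_def atLeast0LessThan)
  then show ?thesis unfolding pminor_lessThan by (simp add: det_mult[where n = n])
qed

text \<open>Subtracting multiples of row \<open>n\<close> from the rows in \<open>J\<close> clears column \<open>n\<close>. The row operations
  form the matrix \<open>L\<close> of determinant one; masking embeds everything into a determinant of full size.\<close>
lemma pminor_Schur_complement:
  fixes M :: "nat \<Rightarrow> nat \<Rightarrow> 'a :: field"
  assumes J: "finite J" "n \<notin> J" and b: "M n n \<noteq> 0"
  shows "pminor M (insert n J) = M n n * pminor (\<lambda>i j. M i j - M i n * M n j / M n n) J"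
proof -
  obtain N where N: "insert n J \<subseteq> {..<N}"
    using J finite_nat_iff_bounded by (metis finite_insert)
  define X where "X = (\<lambda>i j. if i \<in> insert n J then M i j else if i = j then 1 else 0)"
  define L where "L = (\<lambda>i j. (if i = j then 1 else 0) - (if i \<in> J \<and> j = n then M i n / M n n else 0))"
  define Y where "Y = (\<lambda>i j. if i \<in> J then M i j - M i n * M n j / M n n else M i j)"
  have L: "pminor L {..<N} = 1"
  proof -
    have "pminor L {..<N} = (\<Sum>S\<in>Pow {..<N}. (\<Prod>i\<in>{..<N} - S. 1) *
        pminor (\<lambda>i j. - (if i \<in> J \<and> j = n then M i n / M n n else 0)) S)"
      using pminor_diag_add[of "{..<N}" "\<lambda>_. 1"
        "\<lambda>i j. - (if i \<in> J \<and> j = n then M i n / M n n else 0)"] by (simp add: L_def)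
    also have "\<dots> = (\<Sum>S\<in>Pow {..<N}. if S = {} then 1 else 0)"
    proof (rule sum.cong[OF refl])
      fix S assume S: "S \<in> Pow {..<N}"
      let ?E = "\<lambda>i j. - (if i \<in> J \<and> j = n then M i n / M n n else 0)"
      have "pminor ?E S = 0" if "S \<noteq> {}"
      proof -
        have finS: "finite S" using S finite_subset by auto
        show ?thesis
        proof (cases "S = {n}")
          case True
          then show ?thesis using J by simp
        next
          case False
          then obtain k where k: "k \<in> S" "k \<noteq> n" using \<open>S \<noteq> {}\<close> by auto
          then show ?thesis using finS by (intro pminor_zero_column[of S k]) auto
        qed
      qed
      then show "(\<Prod>i\<in>{..<N} - S. 1) * pminor ?E S = (if S = {} then 1 else 0)" by simp
    qed
    finally show ?thesis by simp
  qed
  have LX: "(\<Sum>k<N. L i k * X k j) = (if i \<in> insert n J then Y i j else if i = j then 1 else 0)"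
    if "i < N" for i j
  proof -
    have "(\<Sum>k<N. L i k * X k j) = (\<Sum>k<N. (if i = k then X k j else 0) -
        (if k = n then (if i \<in> J then M i n / M n n else 0) * X k j else 0))"
      by (intro sum.cong) (auto simp: L_def algebra_simps)
    also have "\<dots> = X i j - (if i \<in> J then M i n / M n n else 0) * X n j"
      using that N by (simp add: sum_subtractf)
    finally show ?thesis using J by (auto simp: X_def Y_def)
  qed
  have "pminor X {..<N} = pminor (\<lambda>i j. \<Sum>k<N. L i k * X k j) {..<N}"
    using pminor_mult[of L X N] L by simp
  also have "\<dots> = pminor (\<lambda>i j. if i \<in> insert n J then Y i j else if i = j then 1 else 0) {..<N}"
    using LX by (intro pminor_cong) simp
  finally have "pminor M (insert n J) = pminor Y (insert n J)"
    using pminor_masked[of "{..<N}" "insert n J" M] pminor_masked[of "{..<N}" "insert n J" Y] N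
    by (simp add: X_def)
  also have "\<dots> = pminor (\<lambda>i j. (if i = j then (if i = n then M n n else 0) else 0)
      + (if i = n \<and> j = n then 0 else Y i j)) (insert n J)"
    using J by (intro pminor_cong) (auto simp: Y_def)
  also have "\<dots> = M n n * pminor (\<lambda>i j. if i = n \<and> j = n then 0 else Y i j) J
      + pminor (\<lambda>i j. if i = n \<and> j = n then 0 else Y i j) (insert n J)"
    using J by (rule pminor_add_diag_entry)
  also have "pminor (\<lambda>i j. if i = n \<and> j = n then 0 else Y i j) (insert n J) = 0"
    using J b by (intro pminor_zero_column[of _ n]) (auto simp: Y_def)
  also have "pminor (\<lambda>i j. if i = n \<and> j = n then 0 else Y i j) J
      = pminor (\<lambda>i j. M i j - M i n * M n j / M n n) J"
    using J by (intro pminor_cong) (auto simp: Y_def)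
  finally show ?thesis by simp
qed

section \<open>Multiaffine polynomials and minor lifts given by coefficient functions\<close>

definition maff :: "nat \<Rightarrow> (nat set \<Rightarrow> 'a :: comm_ring_1) \<Rightarrow> (nat \<Rightarrow> 'a) \<Rightarrow> 'a" where
  "maff n a x = (\<Sum>J\<in>Pow {..<n}. a J * (\<Prod>i\<in>J. x i))"

definition mlift :: "nat \<Rightarrow> (nat set \<Rightarrow> 'a :: comm_ring_1) \<Rightarrow> (nat \<Rightarrow> nat \<Rightarrow> 'a) \<Rightarrow> 'a" where
  "mlift n a M = (\<Sum>J\<in>Pow {..<n}. a J * pminor M J)"

lemma maff_cong:
  assumes "\<And>J. J \<subseteq> {..<n} \<Longrightarrow> a J = b J" "\<And>i. i < n \<Longrightarrow> x i = y i"
  shows "maff n a x = maff n b y"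
  unfolding maff_def
  by (intro sum.cong arg_cong2[where f = "(*)"] prod.cong) (use assms in auto)

lemma mlift_cong:
  assumes "\<And>J. J \<subseteq> {..<n} \<Longrightarrow> a J = b J" "\<And>i j. i < n \<Longrightarrow> j < n \<Longrightarrow> M i j = N i j"
  shows "mlift n a M = mlift n b N"
  unfolding mlift_def
proof (rule sum.cong[OF refl])
  fix J assume "J \<in> Pow {..<n}"
  then have J: "J \<subseteq> {..<n}" by simp
  have "pminor M J = pminor N J"
    by (rule pminor_cong) (use assms(2) subsetD[OF J] in blast)
  then show "a J * pminor M J = b J * pminor N J" using assms(1)[OF J] by simp
qed

lemma (in comm_ring_hom) hom_maff: "hom (maff n a x) = maff n (\<lambda>J. hom (a J)) (\<lambda>i. hom (x i))"
  unfolding maff_def by (simp add: hom_distribs)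

lemma (in comm_ring_hom) hom_mlift:
  "hom (mlift n a M) = mlift n (\<lambda>J. hom (a J)) (\<lambda>i j. hom (M i j))"
  unfolding mlift_def by (simp add: hom_distribs hom_pminor)

text \<open>The exponent vector of \<open>\<Prod>i\<in>J. x\<^sub>i\<close>.\<close>
definition sqfree :: "nat set \<Rightarrow> monomial" where
  "sqfree J = (\<Sum>i\<in>J. Poly_Mapping.single i 1)"

definition coef :: "mpoly \<Rightarrow> nat set \<Rightarrow> real" where
  "coef p J = Poly_Mapping.lookup p (sqfree J)"

definition multiaffine_poly :: "nat \<Rightarrow> (nat set \<Rightarrow> real) \<Rightarrow> mpoly" where
  "multiaffine_poly n a = (\<Sum>J\<in>Pow {..<n}. Poly_Mapping.single (sqfree J) (a J))"

lemma lookup_sqfree: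
  assumes "finite J"
  shows "Poly_Mapping.lookup (sqfree J) i = (if i \<in> J then 1 else 0)"
  using assms by (simp add: sqfree_def lookup_sum lookup_single when_def)

lemma keys_sqfree: "finite J \<Longrightarrow> Poly_Mapping.keys (sqfree J) = J"
  by (auto simp: in_keys_iff lookup_sqfree split: if_splits)

lemma sqfree_inject:
  assumes "finite J" "finite K"
  shows "sqfree J = sqfree K \<longleftrightarrow> J = K"
  using assms keys_sqfree by metis

lemma coef_multiaffine_poly:
  assumes "J \<subseteq> {..<n}"
  shows "coef (multiaffine_poly n a) J = a J"
proof -
  have "coef (multiaffine_poly n a) J = (\<Sum>K\<in>Pow {..<n}. if K = J then a K else 0)"
    unfolding coef_def multiaffine_poly_def lookup_sum lookup_single when_def
    using assms by (intro sum.cong refl) (auto simp: sqfree_inject finite_subset)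
  also have "\<dots> = a J" using assms by simp
  finally show ?thesis .
qed

lemma keys_multiaffine_poly:
  "Poly_Mapping.keys (multiaffine_poly n a) \<subseteq> sqfree ` Pow {..<n}"
proof
  fix m assume "m \<in> Poly_Mapping.keys (multiaffine_poly n a)"
  then have "(\<Sum>K\<in>Pow {..<n}. a K when sqfree K = m) \<noteq> 0"
    by (simp add: multiaffine_poly_def in_keys_iff lookup_sum lookup_single)
  then obtain K where "K \<in> Pow {..<n}" "(a K when sqfree K = m) \<noteq> 0"
    using sum.neutral[of "Pow {..<n}" "\<lambda>K. a K when sqfree K = m"] by blast
  then show "m \<in> sqfree ` Pow {..<n}" by (auto simp: when_def split: if_splits)
qed

lemma multiaffine_poly_in_poly_ring: "multiaffine_poly n a \<in> poly_ring n"
  using keys_multiaffine_poly[of n a]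
  by (force simp: poly_ring_def keys_sqfree finite_subset)

lemma multiaffine_multiaffine_poly: "multiaffine (multiaffine_poly n a)"
  unfolding multiaffine_def
proof (intro ballI allI)
  fix m i assume "m \<in> Poly_Mapping.keys (multiaffine_poly n a)"
  then obtain J where J: "J \<subseteq> {..<n}" "m = sqfree J" using keys_multiaffine_poly by blast
  then show "Poly_Mapping.lookup m i \<le> 1" by (simp add: lookup_sqfree finite_subset)
qed

lemma keys_multiaffine:
  assumes "p \<in> poly_ring n" "multiaffine p" "m \<in> Poly_Mapping.keys p"
  obtains J where "J \<subseteq> {..<n}" "m = sqfree J"
proof
  show sub: "Poly_Mapping.keys m \<subseteq> {..<n}" using assms by (auto simp: poly_ring_def)
  show "m = sqfree (Poly_Mapping.keys m)"
  proof (rule poly_mapping_eqI)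
    fix i
    have "Poly_Mapping.lookup m i \<le> 1" using assms by (auto simp: multiaffine_def)
    moreover have "Poly_Mapping.lookup m i = 0 \<longleftrightarrow> i \<notin> Poly_Mapping.keys m"
      by (simp add: in_keys_iff)
    ultimately show "Poly_Mapping.lookup m i = Poly_Mapping.lookup (sqfree (Poly_Mapping.keys m)) i"
      by (cases "i \<in> Poly_Mapping.keys m") (simp_all add: lookup_sqfree)
  qed
qed

lemma multiaffine_poly_coef:
  assumes "p \<in> poly_ring n" "multiaffine p"
  shows "multiaffine_poly n (coef p) = p"
proof (rule poly_mapping_eqI)
  fix m
  show "Poly_Mapping.lookup (multiaffine_poly n (coef p)) m = Poly_Mapping.lookup p m"
  proof (cases "\<exists>J\<subseteq>{..<n}. m = sqfree J")
    case True
    then show ?thesis using coef_multiaffine_poly[of _ n "coef p"] by (auto simp: coef_def)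
  next
    case False
    then have "m \<notin> Poly_Mapping.keys p" "m \<notin> Poly_Mapping.keys (multiaffine_poly n (coef p))"
      using keys_multiaffine[OF assms] keys_multiaffine_poly[of n "coef p"] by blast+
    then show ?thesis by (simp add: in_keys_iff)
  qed
qed

lemma homogeneous_multiaffine_poly_iff:
  "homogeneous d (multiaffine_poly n a) \<longleftrightarrow> (\<forall>J\<subseteq>{..<n}. a J \<noteq> 0 \<longrightarrow> card J = d)"
proof -
  have deg: "(\<Sum>i\<in>Poly_Mapping.keys (sqfree J). Poly_Mapping.lookup (sqfree J) i) = card J"
    if "J \<subseteq> {..<n}" for J
    using finite_subset[OF that] by (simp add: keys_sqfree lookup_sqfree)
  have keys: "sqfree J \<in> Poly_Mapping.keys (multiaffine_poly n a) \<longleftrightarrow> a J \<noteq> 0" if "J \<subseteq> {..<n}" for J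
    using coef_multiaffine_poly[OF that, of a] by (simp add: coef_def in_keys_iff)
  show ?thesis
    unfolding homogeneous_def
    using deg keys keys_multiaffine_poly[of n a] by (smt (verit, best) PowD image_iff subsetD)
qed

lemma eval_multiaffine_poly:
  "eval (multiaffine_poly n a) x = maff n (\<lambda>J. of_real (a J)) (\<lambda>i. x $ i)"
proof -
  let ?p = "multiaffine_poly n a"
  let ?t = "\<lambda>m. of_real (Poly_Mapping.lookup ?p m) *
    (\<Prod>i\<in>Poly_Mapping.keys m. (x $ i) ^ Poly_Mapping.lookup m i)"
  have "eval ?p x = sum ?t (sqfree ` Pow {..<n})"
    unfolding eval_def using keys_multiaffine_poly[of n a]
    by (intro sum.mono_neutral_left) (auto simp: in_keys_iff)
  also have "\<dots> = sum (?t \<circ> sqfree) (Pow {..<n})"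
    by (rule sum.reindex) (auto simp: inj_on_def sqfree_inject finite_subset)
  also have "\<dots> = maff n (\<lambda>J. of_real (a J)) (\<lambda>i. x $ i)"
    unfolding maff_def
  proof (rule sum.cong[OF refl])
    fix J assume J: "J \<in> Pow {..<n}"
    then have fin: "finite J" using finite_subset by auto
    have "(\<Prod>i\<in>J. (x $ i) ^ Poly_Mapping.lookup (sqfree J) i) = (\<Prod>i\<in>J. x $ i)"
      by (intro prod.cong) (auto simp: lookup_sqfree fin)
    then show "(?t \<circ> sqfree) J = of_real (a J) * (\<Prod>i\<in>J. x $ i)"
      using coef_multiaffine_poly[of J n a] J fin by (simp add: keys_sqfree coef_def)
  qed
  finally show ?thesis .
qed

lemma minor_lift_multiaffine_poly:
  assumes "A \<in> carrier_mat n n"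
  shows "minor_lift n (multiaffine_poly n a) A = mlift n a (\<lambda>i j. A $$ (i, j))"
  unfolding minor_lift_def mlift_def
proof (rule sum.cong[OF refl])
  fix J assume "J \<in> Pow {..<n}"
  then have J: "J \<subseteq> {..<n}" by simp
  then show "Poly_Mapping.lookup (multiaffine_poly n a) (\<Sum>i\<in>J. Poly_Mapping.single i 1)
      * det (submatrix A J J) = a J * pminor (\<lambda>i j. A $$ (i, j)) J"
    using coef_multiaffine_poly[OF J, of a] det_submatrix[OF assms J]
    by (simp add: coef_def sqfree_def)
qed

lemma prod_Var: "finite J \<Longrightarrow> (\<Prod>i\<in>J. Var i) = Poly_Mapping.single (sqfree J) 1"
proof (induction J rule: finite_induct)
  case empty
  then show ?case by (simp add: sqfree_def single_one)
next
  case (insert i J)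
  then show ?case by (simp add: sqfree_def Var_def mult_single)
qed

lemma elem_sym_eq_multiaffine_poly:
  assumes "k \<le> n"
  shows "elem_sym d k = multiaffine_poly n (\<lambda>J. if J \<subseteq> {..<k} \<and> card J = d then 1 else 0)"
proof -
  have "elem_sym d k = (\<Sum>J | J \<subseteq> {..<k} \<and> card J = d. Poly_Mapping.single (sqfree J) 1)"
    unfolding elem_sym_def by (intro sum.cong refl prod_Var) (auto intro: finite_subset)
  also have "\<dots> = (\<Sum>J\<in>Pow {..<n}. Poly_Mapping.single (sqfree J)
      (if J \<subseteq> {..<k} \<and> card J = d then 1 else 0))"
    using assms by (intro sum.mono_neutral_cong_left) auto
  finally show ?thesis by (simp add: multiaffine_poly_def)
qed

lemma multiaffine_poly_add:
  "multiaffine_poly n a + multiaffine_poly n b = multiaffine_poly n (\<lambda>J. a J + b J)"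
  by (simp add: multiaffine_poly_def sum.distrib single_add)

lemma Const_times_multiaffine_poly:
  "Const c * multiaffine_poly n a = multiaffine_poly n (\<lambda>J. c * a J)"
  by (simp add: multiaffine_poly_def Const_def sum_distrib_left mult_single)

lemma multiaffine_poly_cong:
  assumes "\<And>J. J \<subseteq> {..<n} \<Longrightarrow> a J = b J"
  shows "multiaffine_poly n a = multiaffine_poly n b"
  unfolding multiaffine_poly_def using assms by (intro sum.cong) auto

lemma sum_Pow_insert:
  fixes f :: "'i set \<Rightarrow> 'a :: comm_monoid_add"
  assumes "finite K" "k \<notin> K"
  shows "(\<Sum>J\<in>Pow (insert k K). f J) = (\<Sum>J\<in>Pow K. f J) + (\<Sum>J\<in>Pow K. f (insert k J))"
proof -
  have "Pow K \<inter> insert k ` Pow K = {}" using assms by auto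
  moreover have "inj_on (insert k) (Pow K)"
  proof (rule inj_onI)
    fix J L assume "J \<in> Pow K" "L \<in> Pow K" and eq: "insert k J = insert k L"
    then have "k \<notin> J" "k \<notin> L" using assms by auto
    then show "J = L" using eq by (simp add: insert_ident)
  qed
  ultimately show ?thesis using assms by (simp add: Pow_insert sum.union_disjoint sum.reindex)
qed

lemma sum_Pow_Suc:
  fixes f :: "nat set \<Rightarrow> 'a :: comm_monoid_add"
  shows "(\<Sum>J\<in>Pow {..<Suc n}. f J) = (\<Sum>J\<in>Pow {..<n}. f J) + (\<Sum>J\<in>Pow {..<n}. f (insert n J))"
  unfolding lessThan_Suc by (rule sum_Pow_insert) auto

lemma Var_times_multiaffine_poly:
  "Var n * multiaffine_poly n a
    = multiaffine_poly (Suc n) (\<lambda>J. if n \<in> J then a (J - {n}) else 0)"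
proof -
  have "multiaffine_poly (Suc n) (\<lambda>J. if n \<in> J then a (J - {n}) else 0)
      = (\<Sum>J\<in>Pow {..<n}. Poly_Mapping.single (sqfree J) (if n \<in> J then a (J - {n}) else 0))
        + (\<Sum>J\<in>Pow {..<n}. Poly_Mapping.single (sqfree (insert n J)) (a (insert n J - {n})))"
    unfolding multiaffine_poly_def sum_Pow_Suc by simp
  also have "\<dots> = (\<Sum>J\<in>Pow {..<n}. Var n * Poly_Mapping.single (sqfree J) (a J))"
  proof -
    have "(\<Sum>J\<in>Pow {..<n}. Poly_Mapping.single (sqfree J) (if n \<in> J then a (J - {n}) else 0)) = 0"
      by (intro sum.neutral) auto
    moreover have "Poly_Mapping.single (sqfree (insert n J)) (a (insert n J - {n}))
        = Var n * Poly_Mapping.single (sqfree J) (a J)" if "J \<in> Pow {..<n}" for J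
    proof -
      have "n \<notin> J" "finite J" using that finite_subset by auto
      then show ?thesis by (simp add: sqfree_def Var_def mult_single)
    qed
    ultimately show ?thesis by simp
  qed
  finally show ?thesis by (simp add: multiaffine_poly_def sum_distrib_left)
qed

text \<open>Splitting off the last variable: the coefficient of \<open>x n\<close> is again multiaffine.\<close>
lemma maff_Suc:
  "maff (Suc n) a x = maff n a x + x n * maff n (\<lambda>J. a (insert n J)) x"
proof -
  have "(\<Prod>i\<in>insert n J. x i) = x n * (\<Prod>i\<in>J. x i)" if "J \<in> Pow {..<n}" for J
  proof -
    have "n \<notin> J" "finite J" using that finite_subset by auto
    then show ?thesis by simp
  qed
  then show ?thesis unfolding maff_def sum_Pow_Suc
    by (simp add: sum_distrib_left mult.left_commute)
qed

lemma maff_scale: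
  assumes "\<And>J. J \<subseteq> {..<n} \<Longrightarrow> a J \<noteq> 0 \<Longrightarrow> card J = d"
  shows "maff n a (\<lambda>i. c * x i) = c ^ d * maff n a x"
proof -
  have "a J * (\<Prod>i\<in>J. c * x i) = c ^ d * (a J * (\<Prod>i\<in>J. x i))" if "J \<in> Pow {..<n}" for J
    using assms[of J] that by (cases "a J = 0") (auto simp: prod.distrib)
  then show ?thesis unfolding maff_def sum_distrib_left by (intro sum.cong) auto
qed

lemma mlift_scale:
  assumes "\<And>J. J \<subseteq> {..<n} \<Longrightarrow> a J \<noteq> 0 \<Longrightarrow> card J = d"
  shows "mlift n a (\<lambda>i j. c * M i j) = c ^ d * mlift n a M"
proof -
  have "pminor (\<lambda>i j. c * M i j) J = c ^ card J * pminor M J" for J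
    by (simp add: pminor_def prod.distrib sum_distrib_left mult.left_commute)
  then have "a J * pminor (\<lambda>i j. c * M i j) J = c ^ d * (a J * pminor M J)" if "J \<in> Pow {..<n}" for J
    using assms[of J] that by (cases "a J = 0") auto
  then show ?thesis unfolding mlift_def sum_distrib_left by (intro sum.cong) auto
qed

lemma maff_permute:
  assumes "\<sigma> permutes {..<n}" "\<And>J. J \<subseteq> {..<n} \<Longrightarrow> a (\<sigma> ` J) = a J"
  shows "maff n a (\<lambda>i. x (\<sigma> i)) = maff n a x"
proof -
  have "bij_betw ((`) \<sigma>) (Pow {..<n}) (Pow {..<n})"
    using assms(1) by (intro bij_betw_Pow permutes_imp_bij)
  then have "maff n a x = (\<Sum>J\<in>Pow {..<n}. a (\<sigma> ` J) * (\<Prod>i\<in>\<sigma> ` J. x i))"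
    unfolding maff_def by (rule sum.reindex_bij_betw[symmetric])
  also have "\<dots> = maff n a (\<lambda>i. x (\<sigma> i))"
    unfolding maff_def
    by (intro sum.cong) (use assms in \<open>auto simp: prod.reindex[OF permutes_inj_on[OF assms(1)]]\<close>)
  finally show ?thesis by simp
qed

lemma pminor_diag:
  "finite J \<Longrightarrow> pminor (\<lambda>i j. if i = j then x i else 0) J = (\<Prod>i\<in>J. x i :: 'a :: comm_ring_1)"
proof -
  assume fin: "finite J"
  have "pminor (\<lambda>i j. (if i = j then x i else 0) + (0::'a)) J
      = (\<Sum>S\<in>Pow J. (\<Prod>i\<in>J - S. x i) * pminor (\<lambda>i j. 0) S)"
    by (rule pminor_diag_add[OF fin])
  also have "\<dots> = (\<Sum>S\<in>{{}}. (\<Prod>i\<in>J - S. x i) * pminor (\<lambda>i j. 0) S)"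
  proof (rule sum.mono_neutral_right)
    show "\<forall>S\<in>Pow J - {{}}. (\<Prod>i\<in>J - S. x i) * pminor (\<lambda>i j. 0) S = 0"
    proof
      fix S assume "S \<in> Pow J - {{}}"
      then obtain k where "k \<in> S" "finite S" using fin finite_subset by blast
      then show "(\<Prod>i\<in>J - S. x i) * pminor (\<lambda>i j. 0) S = 0"
        using pminor_zero_column[of S k "\<lambda>i j. 0 :: 'a"] by simp
    qed
  qed (use fin in auto)
  finally show ?thesis by simp
qed

text \<open>On diagonal matrices the minor lift restricts to the polynomial itself.\<close>
lemma mlift_diag: "mlift n a (\<lambda>i j. if i = j then x i else 0) = maff n a x"
  unfolding mlift_def maff_def
  by (intro sum.cong refl) (auto simp: pminor_diag finite_subset)

lemma zeros_nonneg_iff: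
  fixes F :: "real \<Rightarrow> real"
  shows "(\<forall>t. F t = 0 \<longrightarrow> t \<ge> 0) \<longleftrightarrow> (\<forall>s>0. F (- s) \<noteq> 0)"
proof (intro iffI allI impI)
  fix t assume "\<forall>s>0. F (- s) \<noteq> 0" "F t = 0"
  then show "t \<ge> 0" using minus_minus[of t] not_le neg_0_less_iff_less by metis
qed force

text \<open>The cone is described by the direction \<open>+\<one>\<close>, so that its complement is witnessed by a positive
  root \<open>s\<close> of \<open>p(v + s\<one>)\<close>. This is the form in which cones are used below.\<close>
lemma cone_poly_multiaffine_poly_iff:
  "v \<in> cone_poly n (multiaffine_poly n a) \<longleftrightarrow>
     v \<in> carrier_vec n \<and> (\<forall>s>0. maff n a (\<lambda>i. v $ i + s) \<noteq> 0)"
proof -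
  have "eval (multiaffine_poly n a) (v - t \<cdot>\<^sub>v ones_vec n) = maff n a (\<lambda>i. v $ i + (- t))"
    if "v \<in> carrier_vec n" for t
    unfolding eval_multiaffine_poly
    by (intro maff_cong) (use that in \<open>auto simp: ones_vec_def\<close>)
  then show ?thesis unfolding hyperbolicity_cone_def mem_Collect_eq zeros_nonneg_iff
    by (intro conj_cong refl) (simp only: minus_minus)
qed

lemma cone_lift_multiaffine_poly_iff:
  "A \<in> cone_lift n (multiaffine_poly n a) \<longleftrightarrow> A \<in> sym_mats n \<and>
     (\<forall>s>0. mlift n a (\<lambda>i j. A $$ (i, j) + (if i = j then s else 0)) \<noteq> 0)"
proof -
  have "minor_lift n (multiaffine_poly n a) (A - t \<cdot>\<^sub>m 1\<^sub>m n)
      = mlift n a (\<lambda>i j. A $$ (i, j) + (if i = j then - t else 0))"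
    if "A \<in> sym_mats n" for t
  proof -
    have A: "A \<in> carrier_mat n n" using that by (simp add: sym_mats_def)
    then have "A - t \<cdot>\<^sub>m 1\<^sub>m n \<in> carrier_mat n n" by auto
    then show ?thesis
      by (subst minor_lift_multiaffine_poly) (use A in \<open>auto intro!: mlift_cong\<close>)
  qed
  then show ?thesis unfolding hyperbolicity_cone_def mem_Collect_eq zeros_nonneg_iff
    by (intro conj_cong refl) (simp only: minus_minus)
qed

section \<open>The spectral theorem\<close>

lemma unit_eigenvector_orthogonal_mat:
  fixes A :: "real mat"
  assumes A: "A \<in> carrier_mat n n" and e: "eigenvalue A e"
  obtains W where "W \<in> carrier_mat n n" "transpose_mat W * W = 1\<^sub>m n" "A *\<^sub>v col W 0 = e \<cdot>\<^sub>v col W 0" "n > 0"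
proof -
  obtain v where v: "v \<in> carrier_vec n" "v \<noteq> 0\<^sub>v n" and ev: "A *\<^sub>v v = e \<cdot>\<^sub>v v"
    using e A by (auto simp: eigenvalue_def eigenvector_def)
  have n: "n > 0" using v by (cases n) auto
  interpret cof_vec_space n "TYPE(real)" .
  define b where "b = basis_completion v"
  note bc = basis_completion[OF v, folded b_def]
  define ws where "ws = gram_schmidt n b"
  note gs = gram_schmidt_result[OF bc(2) bc(4) bc(5) ws_def]
  obtain vs where "b = v # vs" using bc(6,7) n by (cases b) auto
  then have "hd ws = v" using gram_schmidt_hd[OF v(1), of vs] by (simp add: ws_def)
  moreover have len: "length ws = n" using gs(4) bc(6) by simp
  ultimately have ws0: "ws ! 0 = v" using n by (simp add: hd_conv_nth flip: length_greater_0_conv)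
  have carr: "ws ! i \<in> carrier_vec n" if "i < n" for i using gs(3) len that by auto
  have ortho: "ws ! i \<bullet> ws ! j = 0 \<longleftrightarrow> i \<noteq> j" if "i < n" "j < n" for i j
    using corthogonalD[OF gs(2), of i j] that len by simp
  define c where "c = (\<lambda>i. 1 / sqrt (ws ! i \<bullet> ws ! i))"
  have c: "c i * c i * (ws ! i \<bullet> ws ! i) = 1" if "i < n" for i
  proof -
    have "ws ! i \<bullet> ws ! i \<ge> 0" by (simp add: scalar_prod_def sum_nonneg)
    moreover have "ws ! i \<bullet> ws ! i \<noteq> 0" using ortho[OF that that] by simp
    ultimately show ?thesis by (simp add: c_def)
  qed
  define W where "W = mat_of_cols n (map (\<lambda>i. c i \<cdot>\<^sub>v ws ! i) [0..<n])"
  have W: "W \<in> carrier_mat n n"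
    unfolding W_def using mat_of_cols_carrier(1)[of n "map (\<lambda>i. c i \<cdot>\<^sub>v ws ! i) [0..<n]"] by simp
  have col: "col W i = c i \<cdot>\<^sub>v ws ! i" if "i < n" for i
    unfolding W_def using that carr[OF that] by (subst col_mat_of_cols) auto
  have "transpose_mat W * W = 1\<^sub>m n"
  proof (rule eq_matI)
    fix i j assume "i < dim_row (1\<^sub>m n :: real mat)" "j < dim_col (1\<^sub>m n :: real mat)"
    then have ij: "i < n" "j < n" by auto
    then have "(transpose_mat W * W) $$ (i, j) = (c i \<cdot>\<^sub>v ws ! i) \<bullet> (c j \<cdot>\<^sub>v ws ! j)"
      using W by (simp add: col)
    also have "\<dots> = c i * c j * (ws ! i \<bullet> ws ! j)"
      using carr[OF ij(1)] carr[OF ij(2)] by simp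
    finally show "(transpose_mat W * W) $$ (i, j) = 1\<^sub>m n $$ (i, j)"
      using ij ortho[OF ij] c[OF ij(1)] by auto
  qed (use W in auto)
  moreover have "A *\<^sub>v col W 0 = e \<cdot>\<^sub>v col W 0"
    unfolding col[OF n] ws0 using A v(1) ev
    by (simp add: mult_mat_vec smult_smult_assoc mult.commute)
  ultimately show thesis using that W n by blast
qed

text \<open>Induction on the list of eigenvalues: an orthogonal matrix whose first column is a unit
  eigenvector splits \<open>A\<close> into a one-by-one block and a smaller symmetric matrix, whose characteristic
  polynomial has the remaining roots. The eigenvalues are taken in the prescribed order, since an
  eigenvalue vector may list them in any order.\<close>
theorem symmetric_diagonalization:
  fixes A :: "real mat"
  assumes "A \<in> carrier_mat n n" "transpose_mat A = A"
    and "char_poly A = (\<Prod>e\<leftarrow>es. [:- e, 1:])"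
  shows "\<exists>W\<in>carrier_mat n n. transpose_mat W * W = 1\<^sub>m n \<and>
    transpose_mat W * A * W = mat n n (\<lambda>(i, j). if i = j then es ! i else 0)"
  using assms
proof (induction es arbitrary: n A)
  case Nil
  then have "n = 0" using degree_monic_char_poly[of A n] by simp
  then show ?case using Nil by (intro bexI[of _ "1\<^sub>m 0"]) auto
next
  case (Cons e es)
  note A = Cons.prems(1) and symm = Cons.prems(2)
  have "poly (char_poly A) e = 0" by (simp add: Cons.prems(3))
  then have "eigenvalue A e" using eigenvalue_root_char_poly[OF A] by simp
  from unit_eigenvector_orthogonal_mat[OF A this] obtain W where
    W: "W \<in> carrier_mat n n" and WW: "transpose_mat W * W = 1\<^sub>m n"
    and ev: "A *\<^sub>v col W 0 = e \<cdot>\<^sub>v col W 0" and n: "n > 0" .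
  have Wt: "transpose_mat W \<in> carrier_mat n n" using W by simp
  have WW': "W * transpose_mat W = 1\<^sub>m n" using mat_mult_left_right_inverse[OF Wt W WW] .
  define A' where "A' = transpose_mat W * A * W"
  have A': "A' \<in> carrier_mat n n" using A W by (simp add: A'_def)
  have symm': "transpose_mat A' = A'"
    unfolding A'_def using A W symm Wt
    by (simp add: transpose_mult[where nr = n and n = n and nc = n] assoc_mult_mat[where n\<^sub>1 = n and n\<^sub>2 = n and n\<^sub>3 = n and n\<^sub>4 = n])
  obtain m where m: "n = Suc m" using n by (cases n) auto
  have col0: "A' $$ (i, 0) = (if i = 0 then e else 0)" if "i < n" for i
  proof -
    have "A' = transpose_mat W * (A * W)" unfolding A'_def using A W Wt by simp
    then have "A' $$ (i, 0) = col W i \<bullet> col (A * W) 0" using that n A W by simp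
    then have "A' $$ (i, 0) = col W i \<bullet> (A *\<^sub>v col W 0)" unfolding col_mult2[OF A W n] .
    also have "\<dots> = e * (col W i \<bullet> col W 0)" unfolding ev using W by simp
    also have "col W i \<bullet> col W 0 = (transpose_mat W * W) $$ (i, 0)" using that n W by simp
    finally show ?thesis using that n by (simp add: WW)
  qed
  have row0: "A' $$ (0, i) = (if i = 0 then e else 0)" if "i < n" for i
    using col0[OF that] symm' that n A' by (metis carrier_matD index_transpose_mat(1))
  define A3 where "A3 = mat m m (\<lambda>(i, j). A' $$ (Suc i, Suc j))"
  have A3: "A3 \<in> carrier_mat m m" by (simp add: A3_def)
  have block: "A' = four_block_mat (mat 1 1 (\<lambda>_. e)) (0\<^sub>m 1 m) (0\<^sub>m m 1) A3"
    by (rule eq_matI) (use A' col0 row0 m in \<open>auto simp: A3_def\<close>)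
  have "similar_mat_wit A' A (transpose_mat W) W"
    by (rule similar_mat_witI[OF WW WW']) (use A A' W in \<open>auto simp: A'_def\<close>)
  then have "char_poly A' = char_poly A"
    by (intro char_poly_similar) (auto simp: similar_mat_def)
  moreover have "char_poly A' = [:- e, 1:] * char_poly A3"
  proof -
    have "char_poly (mat 1 1 (\<lambda>_. e)) = [:- e, 1:]"
      by (simp add: char_poly_defs det_def sign_def)
    then show ?thesis unfolding block
      using char_poly_four_block_zeros_col[OF _ zero_carrier_mat A3, of "mat 1 1 (\<lambda>_. e)"] by simp
  qed
  ultimately have cp3: "char_poly A3 = (\<Prod>e\<leftarrow>es. [:- e, 1:])"
    using Cons.prems(3) by (simp only: list.map prod_list.Cons) (metis mult_cancel_left pCons_eq_0_iff zero_neq_one)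
  have "A3 = transpose_mat A3"
  proof (rule eq_matI)
    fix i j assume "i < dim_row (transpose_mat A3)" "j < dim_col (transpose_mat A3)"
    then have ij: "i < m" "j < m" by (simp_all add: A3_def)
    have "transpose_mat A' $$ (Suc i, Suc j) = A' $$ (Suc j, Suc i)" using ij A' m by simp
    then show "A3 $$ (i, j) = transpose_mat A3 $$ (i, j)" using ij symm' by (simp add: A3_def)
  qed (simp_all add: A3_def)
  from Cons.IH[OF A3 this[symmetric] cp3] obtain V where
    V: "V \<in> carrier_mat m m" and VV: "transpose_mat V * V = 1\<^sub>m m"
    and D: "transpose_mat V * A3 * V = mat m m (\<lambda>(i, j). if i = j then es ! i else 0)" by blast
  define F where "F = four_block_mat (1\<^sub>m 1) (0\<^sub>m 1 m) (0\<^sub>m m 1) V"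
  have F: "F \<in> carrier_mat n n" unfolding F_def m using V by auto
  have Ft: "transpose_mat F = four_block_mat (1\<^sub>m 1) (0\<^sub>m 1 m) (0\<^sub>m m 1) (transpose_mat V)"
    unfolding F_def using V by (subst transpose_four_block_mat) auto
  have FF: "transpose_mat F * F = 1\<^sub>m n"
    unfolding Ft unfolding F_def m using V VV
    by (subst mult_four_block_mat[where ?nr1.0 = 1 and ?n1.0 = 1 and ?nr2.0 = m and ?n2.0 = m and ?nc1.0 = 1 and ?nc2.0 = m]) auto
  have FAF: "transpose_mat F * A' * F = mat n n (\<lambda>(i, j). if i = j then (e # es) ! i else 0)"
  proof -
    note mult = mult_four_block_mat[where ?nr1.0 = 1 and ?n1.0 = 1 and ?nr2.0 = m and ?n2.0 = m
        and ?nc1.0 = 1 and ?nc2.0 = m]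
    have "transpose_mat F * A' = four_block_mat (mat 1 1 (\<lambda>_. e)) (0\<^sub>m 1 m) (0\<^sub>m m 1) (transpose_mat V * A3)"
      unfolding Ft block using V A3 by (subst mult) auto
    moreover have "\<dots> * F = four_block_mat (mat 1 1 (\<lambda>_. e)) (0\<^sub>m 1 m) (0\<^sub>m m 1) (transpose_mat V * A3 * V)"
      unfolding F_def using V A3 by (subst mult) auto
    ultimately have "transpose_mat F * A' * F
        = four_block_mat (mat 1 1 (\<lambda>_. e)) (0\<^sub>m 1 m) (0\<^sub>m m 1) (transpose_mat V * A3 * V)" by simp
    then show ?thesis unfolding D m by (auto intro!: eq_matI simp: nth_Cons')
  qed
  show ?case
  proof (rule bexI[of _ "W * F"], rule conjI)
    have Fc: "transpose_mat F \<in> carrier_mat n n" using F by simp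
    have tr: "transpose_mat (W * F) = transpose_mat F * transpose_mat W"
      using W F by (simp add: transpose_mult)
    note ass = assoc_mult_mat[where n\<^sub>1 = n and n\<^sub>2 = n and n\<^sub>3 = n and n\<^sub>4 = n]
    have "transpose_mat (W * F) * (W * F) = transpose_mat F * ((transpose_mat W * W) * F)"
      unfolding tr using W F Wt Fc by (simp add: ass)
    then show "transpose_mat (W * F) * (W * F) = 1\<^sub>m n" using WW FF F by simp
    have "transpose_mat (W * F) * A * (W * F) = transpose_mat F * A' * F"
      unfolding tr A'_def using W F Wt Fc A by (simp add: ass)
    then show "transpose_mat (W * F) * A * (W * F) = mat n n (\<lambda>(i, j). if i = j then (e # es) ! i else 0)"
      using FAF by simp
    show "W * F \<in> carrier_mat n n" using W F by simp
  qed
qed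

text \<open>The characteristic polynomial splits over the complex numbers, and
  for an eigenvector \<open>v\<close> the number \<open>v\<^sup>* A v\<close> is real because \<open>A\<close> is real symmetric; hence all roots are real.\<close>
lemma eigenvalue_vector_exists:
  assumes "A \<in> sym_mats n"
  shows "\<exists>l. eigenvalue_vector A l"
proof -
  have A: "A \<in> carrier_mat n n" and symm: "transpose_mat A = A" using assms by (auto simp: sym_mats_def)
  define C where "C = map_mat complex_of_real A"
  have C: "C \<in> carrier_mat n n" using A by (simp add: C_def)
  obtain as where as: "char_poly C = (\<Prod>a\<leftarrow>as. [:- a, 1:])" "length as = n"
    using char_poly_factorized[OF C] by blast
  have real: "a \<in> \<real>" if "a \<in> set as" for a
  proof -
    have "poly (char_poly C) a = 0" unfolding as(1) using that
      by (simp add: poly_prod_list prod_list_zero_iff image_iff)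
    then have "eigenvalue C a" using eigenvalue_root_char_poly[OF C] by simp
    then obtain v where v: "v \<in> carrier_vec n" "v \<noteq> 0\<^sub>v n" and ev: "C *\<^sub>v v = a \<cdot>\<^sub>v v"
      using C by (auto simp: eigenvalue_def eigenvector_def)
    define q where "q = (\<Sum>i<n. (cmod (v $ i))\<^sup>2)"
    define S where "S = (\<Sum>i<n. \<Sum>j<n. of_real (A $$ (i, j)) * v $ j * cnj (v $ i))"
    have row: "(\<Sum>j<n. of_real (A $$ (i, j)) * v $ j) = a * v $ i" if "i < n" for i
    proof -
      have "(C *\<^sub>v v) $ i = (\<Sum>j<n. of_real (A $$ (i, j)) * v $ j)"
        using that v(1) A by (simp add: C_def scalar_prod_def atLeast0LessThan)
      then show ?thesis using ev that v(1) by simp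
    qed
    have "S = (\<Sum>i<n. a * v $ i * cnj (v $ i))"
      unfolding S_def by (intro sum.cong) (auto simp flip: row sum_distrib_right)
    also have "\<dots> = (\<Sum>i<n. a * of_real ((cmod (v $ i))\<^sup>2))"
      by (simp only: mult.assoc complex_norm_square)
    also have "\<dots> = a * of_real q"
      by (simp add: q_def sum_distrib_left)
    finally have S: "S = a * of_real q" .
    have "cnj S = (\<Sum>i<n. \<Sum>j<n. of_real (A $$ (i, j)) * cnj (v $ j) * v $ i)"
      by (simp add: S_def)
    also have "\<dots> = (\<Sum>j<n. \<Sum>i<n. of_real (A $$ (i, j)) * cnj (v $ j) * v $ i)"
      by (rule sum.swap)
    also have "\<dots> = S"
      unfolding S_def
    proof (intro sum.cong refl)
      fix i j assume "i \<in> {..<n}" "j \<in> {..<n}"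
      then have "A $$ (j, i) = A $$ (i, j)" using symm A by (metis carrier_matD index_transpose_mat(1) lessThan_iff)
      then show "of_real (A $$ (j, i)) * cnj (v $ i) * v $ j = of_real (A $$ (i, j)) * v $ j * cnj (v $ i)"
        by simp
    qed
    finally have "cnj a * of_real q = a * of_real q" using S by simp
    moreover have "q \<noteq> 0"
    proof
      assume "q = 0"
      then have "\<forall>i\<in>{..<n}. (cmod (v $ i))\<^sup>2 = 0"
        unfolding q_def by (subst (asm) sum_nonneg_eq_0_iff) auto
      then have "v = 0\<^sub>v n" using v(1) by (intro eq_vecI) auto
      then show False using v(2) by simp
    qed
    ultimately show ?thesis by (simp add: Reals_cnj_iff)
  qed
  define l where "l = vec n (\<lambda>i. Re (as ! i))"
  have nth: "as ! i = of_real (l $ i)" if "i < n" for i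
    using real[of "as ! i"] that as(2) by (simp add: l_def)
  interpret oh: map_poly_inj_idom_hom "of_real :: real \<Rightarrow> complex" ..
  have "map_poly of_real (char_poly A) = char_poly C"
    unfolding C_def by (rule of_real_hom.char_poly_hom[OF A, symmetric])
  also have "\<dots> = (\<Prod>i<n. [:- (as ! i), 1:])"
    by (simp add: as prod.list_conv_set_nth atLeast0LessThan)
  also have "\<dots> = (\<Prod>i<n. map_poly of_real [:- (l $ i), 1:])"
    by (intro prod.cong) (auto simp: nth)
  also have "\<dots> = map_poly of_real (\<Prod>i<n. [:- (l $ i), 1:])"
    by (simp only: oh.hom_prod)
  finally have "char_poly A = (\<Prod>i<n. [:- (l $ i), 1:])"
    by (simp only: oh.eq_iff)
  then have "eigenvalue_vector A l" using A by (auto simp: eigenvalue_vector_def l_def)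
  then show ?thesis ..
qed

text \<open>Row \<open>k\<close> of \<open>U\<close> is the eigenvector of the eigenvalue \<open>l k\<close> in later use; both orthogonality relations
  are recorded so that neither has to be derived from the other.\<close>
definition orthogonal_fun :: "nat \<Rightarrow> (nat \<Rightarrow> nat \<Rightarrow> real) \<Rightarrow> bool" where
  "orthogonal_fun n U \<longleftrightarrow>
     (\<forall>i<n. \<forall>j<n. (\<Sum>k<n. U k i * U k j) = (if i = j then 1 else 0)) \<and>
     (\<forall>i<n. \<forall>j<n. (\<Sum>k<n. U i k * U j k) = (if i = j then 1 else 0))"

lemma spectral_decomposition:
  fixes l :: "real vec"
  assumes A: "A \<in> sym_mats n" and l: "eigenvalue_vector A l"
  obtains U where "orthogonal_fun n U"
    "\<And>i j. i < n \<Longrightarrow> j < n \<Longrightarrow> A $$ (i, j) = (\<Sum>k<n. l $ k * U k i * U k j)"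
proof -
  have Ac: "A \<in> carrier_mat n n" and symm: "transpose_mat A = A" using A by (auto simp: sym_mats_def)
  have lc: "l \<in> carrier_vec n" using l Ac by (auto simp: eigenvalue_vector_def)
  have "char_poly A = (\<Prod>e\<leftarrow>list_of_vec l. [:- e, 1:])"
  proof -
    have "(\<Prod>e\<leftarrow>list_of_vec l. [:- e, 1:]) = (\<Prod>i<n. map (\<lambda>e. [:- e, 1:]) (list_of_vec l) ! i)"
      using lc by (simp add: prod.list_conv_set_nth atLeast0LessThan)
    also have "\<dots> = (\<Prod>i<n. [:- (l $ i), 1:])"
      using lc by (intro prod.cong) (auto simp: list_of_vec_index)
    finally show ?thesis using l Ac by (simp add: eigenvalue_vector_def)
  qed
  from symmetric_diagonalization[OF Ac symm this] obtain W where
    W: "W \<in> carrier_mat n n" and WW: "transpose_mat W * W = 1\<^sub>m n"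
    and D: "transpose_mat W * A * W = mat n n (\<lambda>(i, j). if i = j then list_of_vec l ! i else 0)"
    by blast
  have Wt: "transpose_mat W \<in> carrier_mat n n" using W by simp
  have WW': "W * transpose_mat W = 1\<^sub>m n" using mat_mult_left_right_inverse[OF Wt W WW] .
  define E where "E = mat n n (\<lambda>(i, j). if i = j then l $ i else 0)"
  have DE: "transpose_mat W * A * W = E"
    unfolding D E_def using lc by (intro eq_matI) (auto simp: list_of_vec_index)
  note ass = assoc_mult_mat[where n\<^sub>1 = n and n\<^sub>2 = n and n\<^sub>3 = n and n\<^sub>4 = n]
  have "A = (W * transpose_mat W) * A * (W * transpose_mat W)" using Ac WW' by simp
  also have "\<dots> = W * (transpose_mat W * A * W) * transpose_mat W" using Ac W Wt by (simp add: ass)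
  finally have AE: "A = W * E * transpose_mat W" unfolding DE .
  show thesis
  proof
    show "orthogonal_fun n (\<lambda>k i. W $$ (i, k))"
      unfolding orthogonal_fun_def
    proof (intro conjI allI impI)
      fix i j assume ij: "i < n" "j < n"
      have "(W * transpose_mat W) $$ (i, j) = (\<Sum>k<n. W $$ (i, k) * W $$ (j, k))"
        using ij W by (simp add: scalar_prod_def atLeast0LessThan)
      then show "(\<Sum>k<n. W $$ (i, k) * W $$ (j, k)) = (if i = j then 1 else 0)" using WW' ij by simp
      have "(transpose_mat W * W) $$ (i, j) = (\<Sum>k<n. W $$ (k, i) * W $$ (k, j))"
        using ij W by (simp add: scalar_prod_def atLeast0LessThan)
      then show "(\<Sum>k<n. W $$ (k, i) * W $$ (k, j)) = (if i = j then 1 else 0)" using WW ij by simp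
    qed
    fix i j assume ij: "i < n" "j < n"
    have E: "E \<in> carrier_mat n n" by (simp add: E_def)
    have WE: "(W * E) $$ (i, k) = W $$ (i, k) * l $ k" if "k < n" for k
    proof -
      have "(W * E) $$ (i, k) = (\<Sum>h<n. if h = k then W $$ (i, h) * l $ h else 0)"
      proof -
        have "(W * E) $$ (i, k) = (\<Sum>h<n. W $$ (i, h) * E $$ (h, k))"
          using ij that W E by (simp add: scalar_prod_def atLeast0LessThan)
        also have "\<dots> = (\<Sum>h<n. if h = k then W $$ (i, h) * l $ h else 0)"
          by (intro sum.cong) (use that in \<open>auto simp: E_def\<close>)
        finally show ?thesis .
      qed
      then show ?thesis using that by simp
    qed
    have "A $$ (i, j) = (\<Sum>k<n. (W * E) $$ (i, k) * W $$ (j, k))"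
    proof -
      have "(X * transpose_mat W) $$ (i, j) = (\<Sum>k<n. X $$ (i, k) * W $$ (j, k))"
        if "X \<in> carrier_mat n n" for X
        using that ij W by (simp add: scalar_prod_def atLeast0LessThan)
      from this[OF mult_carrier_mat[OF W E]] show ?thesis by (subst AE)
    qed
    then show "A $$ (i, j) = (\<Sum>k<n. l $ k * W $$ (i, k) * W $$ (j, k))"
      using WE by (simp add: mult.commute)
  qed
qed

lemma eigenvalue_vector_permute:
  fixes l :: "real vec"
  assumes "A \<in> carrier_mat n n" "eigenvalue_vector A l" "\<sigma> permutes {..<n}"
  shows "eigenvalue_vector A (vec n (\<lambda>i. l $ \<sigma> i))"
proof -
  have "(\<Prod>i<n. [:- (l $ \<sigma> i), 1:]) = (\<Prod>i<n. [:- (l $ i), 1:])"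
    using prod.permute[OF assms(3), of "\<lambda>i. [:- (l $ i), 1:]"] by (simp add: o_def)
  then show ?thesis using assms by (simp add: eigenvalue_vector_def)
qed

section \<open>The Grace--Walsh--Szego theorem\<close>

text \<open>Laguerre's theorem for the upper half-plane: the inequality says that the point
  \<open>\<zeta> - k \<phi>(\<zeta>) / \<phi>'(\<zeta>)\<close> has nonpositive imaginary part. For a single root it is a direct computation, and
  splitting off one root at a time adds the logarithmic derivatives; the quadratic term is controlled by
  \<open>|u + V|\<^sup>2 \<le> (k + 1) (|u|\<^sup>2 + |V|\<^sup>2 / k)\<close>.\<close>
lemma log_deriv_bound:
  fixes \<phi> :: "complex poly"
  assumes "\<phi> \<noteq> 0" "degree \<phi> \<le> k" "\<And>z. poly \<phi> z = 0 \<Longrightarrow> Im z \<le> 0" "Im \<zeta> > 0"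
  defines "U \<equiv> poly (pderiv \<phi>) \<zeta> / poly \<phi> \<zeta>"
  shows "of_nat k * Im U + Im \<zeta> * (cmod U)\<^sup>2 \<le> 0"
  unfolding U_def using assms(1-3)
proof (induction k arbitrary: \<phi>)
  case 0
  then have "pderiv \<phi> = 0" using pderiv_eq_0_iff[of \<phi>] by simp
  then show ?case by simp
next
  case (Suc k)
  show ?case
  proof (cases "degree \<phi> = 0")
    case True
    then have "pderiv \<phi> = 0" using pderiv_eq_0_iff[of \<phi>] by simp
    then show ?thesis by simp
  next
    case False
    then obtain r where r: "poly \<phi> r = 0"
      using fundamental_theorem_of_algebra[of \<phi>] by (auto simp: constant_degree)
    then obtain \<psi> where \<phi>: "\<phi> = [:- r, 1:] * \<psi>" by (auto simp: poly_eq_0_iff_dvd elim: dvdE)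
    have \<psi>0: "\<psi> \<noteq> 0" using \<phi> Suc.prems(1) by auto
    then have "degree \<phi> = Suc (degree \<psi>)" unfolding \<phi> by (subst degree_mult_eq) auto
    then have deg: "degree \<psi> \<le> k" using Suc.prems(2) by simp
    have roots: "poly \<psi> z = 0 \<Longrightarrow> Im z \<le> 0" for z using Suc.prems(3)[of z] \<phi> by simp
    define u V where "u = 1 / (\<zeta> - r)" and "V = poly (pderiv \<psi>) \<zeta> / poly \<psi> \<zeta>"
    have IH: "of_nat k * Im V + Im \<zeta> * (cmod V)\<^sup>2 \<le> 0"
      unfolding V_def by (rule Suc.IH[OF \<psi>0 deg roots])
    have Imr: "Im r \<le> 0" using Suc.prems(3)[OF r] .
    have nz: "\<zeta> - r \<noteq> 0" using Imr assms(4) by auto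
    have nz': "poly \<psi> \<zeta> \<noteq> 0" using roots[of \<zeta>] assms(4) by auto
    have UuV: "poly (pderiv \<phi>) \<zeta> / poly \<phi> \<zeta> = u + V"
    proof -
      have "pderiv \<phi> = [:- r, 1:] * pderiv \<psi> + \<psi> * pderiv [:- r, 1:]"
        unfolding \<phi> by (rule pderiv_mult)
      then have 1: "poly (pderiv \<phi>) \<zeta> = (\<zeta> - r) * poly (pderiv \<psi>) \<zeta> + poly \<psi> \<zeta>"
        by (simp only:) (simp add: pderiv_pCons algebra_simps)
      have 2: "poly \<phi> \<zeta> = (\<zeta> - r) * poly \<psi> \<zeta>"
        unfolding \<phi> by (simp add: algebra_simps)
      show ?thesis using nz nz' unfolding 1 2
        by (simp add: u_def V_def add_divide_distrib)
    qed
    have u: "Im u + Im \<zeta> * (cmod u)\<^sup>2 \<le> 0"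
    proof -
      have "Im u = - Im (\<zeta> - r) / (cmod (\<zeta> - r))\<^sup>2"
        by (simp add: u_def Im_divide cmod_power2)
      moreover have "(cmod u)\<^sup>2 = 1 / (cmod (\<zeta> - r))\<^sup>2"
        by (simp add: u_def norm_divide power_divide)
      ultimately have "Im u + Im \<zeta> * (cmod u)\<^sup>2 = Im r / (cmod (\<zeta> - r))\<^sup>2"
        by (simp add: field_simps diff_divide_distrib)
      then show ?thesis using Imr by (simp add: divide_nonpos_nonneg)
    qed
    have "of_nat (Suc k) * Im (u + V) + Im \<zeta> * (cmod (u + V))\<^sup>2 \<le> 0"
    proof (cases "k = 0")
      case True
      then have "V = 0" using IH assms(4) by (simp add: mult_le_0_iff)
      then show ?thesis using u True by simp
    next
      case False
      have "(cmod (u + V))\<^sup>2 \<le> (cmod u + cmod V)\<^sup>2" by (simp add: norm_triangle_ineq power_mono)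
      then have "of_nat k * (cmod (u + V))\<^sup>2 \<le> of_nat k * (cmod u + cmod V)\<^sup>2"
        by (simp add: mult_left_mono)
      also have "\<dots> \<le> of_nat (Suc k) * (of_nat k * (cmod u)\<^sup>2 + (cmod V)\<^sup>2)"
      proof -
        have "0 \<le> (of_nat k * cmod u - cmod V)\<^sup>2" by simp
        then show ?thesis by (simp add: power2_eq_square algebra_simps)
      qed
      finally have "Im \<zeta> * (of_nat k * (cmod (u + V))\<^sup>2)
          \<le> Im \<zeta> * (of_nat (Suc k) * (of_nat k * (cmod u)\<^sup>2 + (cmod V)\<^sup>2))"
        using assms(4) by (intro mult_left_mono) auto
      also have "\<dots> = of_nat (Suc k) * (of_nat k * (Im \<zeta> * (cmod u)\<^sup>2) + Im \<zeta> * (cmod V)\<^sup>2)"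
        by (simp add: algebra_simps)
      also have "\<dots> \<le> of_nat (Suc k) * (of_nat k * (- Im u) + of_nat k * (- Im V))"
        using u IH by (intro mult_left_mono add_mono) auto
      finally have "of_nat k * (of_nat (Suc k) * Im (u + V) + Im \<zeta> * (cmod (u + V))\<^sup>2) \<le> 0"
        by (simp add: algebra_simps)
      then show ?thesis using False by (simp add: mult_le_0_iff)
    qed
    then show ?thesis unfolding UuV .
  qed
qed

text \<open>The polar form of \<open>\<Sum>\<^sub>j (card K choose j) c j \<zeta>\<^sup>j\<close>: the symmetric multiaffine polynomial with this
  restriction to the diagonal.\<close>
definition blossom :: "'i set \<Rightarrow> (nat \<Rightarrow> 'a :: comm_ring_1) \<Rightarrow> ('i \<Rightarrow> 'a) \<Rightarrow> 'a" where
  "blossom K c y = (\<Sum>J\<in>Pow K. c (card J) * (\<Prod>i\<in>J. y i))"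

lemma blossom_insert:
  assumes "finite K" "k \<notin> K"
  shows "blossom (insert k K) c y = blossom K (\<lambda>j. c j + c (Suc j) * y k) y"
proof -
  have "c (card (insert k J)) * (\<Prod>i\<in>insert k J. y i) = c (Suc (card J)) * y k * (\<Prod>i\<in>J. y i)"
    if "J \<in> Pow K" for J
  proof -
    have "finite J" "k \<notin> J" using that assms finite_subset by auto
    then show ?thesis by (simp add: mult.assoc)
  qed
  then show ?thesis unfolding blossom_def
    by (simp add: sum_Pow_insert[OF assms] distrib_right sum.distrib)
qed

text \<open>Variables are split off one at a time. Fixing one argument \<open>y k\<close> of the polar form of \<open>\<phi>\<close> leaves the
  polar form of the polar derivative of \<open>\<phi>\<close> at \<open>y k\<close>. A zero \<open>\<zeta>\<close> of the polar derivative would make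
  \<open>y k\<close> the point in Laguerre's theorem, although \<open>y k\<close> is in the upper half-plane.\<close>
theorem Grace_Walsh_Szego:
  fixes c :: "nat \<Rightarrow> complex"
  assumes "finite K"
    and "\<And>\<zeta>. Im \<zeta> > 0 \<Longrightarrow> (\<Sum>j\<le>card K. of_nat (card K choose j) * c j * \<zeta> ^ j) \<noteq> 0"
    and "\<And>i. i \<in> K \<Longrightarrow> Im (y i) > 0"
  shows "blossom K c y \<noteq> 0"
  using assms
proof (induction K arbitrary: c rule: finite_induct)
  case empty
  from empty.prems(1)[of \<i>] show ?case by (simp add: blossom_def)
next
  case (insert k K)
  define n where "n = card K"
  define \<alpha> \<beta> where "\<alpha> = (\<lambda>\<zeta>::complex. \<Sum>j\<le>n. of_nat (n choose j) * c j * \<zeta> ^ j)"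
    and "\<beta> = (\<lambda>\<zeta>. \<Sum>j\<le>n. of_nat (n choose j) * c (Suc j) * \<zeta> ^ j)"
  have w: "Im (y k) > 0" using insert.prems(2) by simp
  define \<phi> where "\<phi> = (\<Sum>j\<le>Suc n. monom (of_nat (Suc n choose j) * c j) j)"
  have poly_\<phi>: "poly \<phi> \<zeta> = (\<Sum>j\<le>Suc n. of_nat (Suc n choose j) * c j * \<zeta> ^ j)" for \<zeta>
    by (simp add: \<phi>_def poly_sum poly_monom del: sum.atMost_Suc)
  have deg: "degree \<phi> \<le> Suc n"
    unfolding \<phi>_def by (intro degree_sum_le) (auto intro: order.trans[OF degree_monom_le])
  have split: "poly \<phi> \<zeta> = \<alpha> \<zeta> + \<zeta> * \<beta> \<zeta>" for \<zeta>
  proof -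
    have "poly \<phi> \<zeta> = c 0 + (\<Sum>j\<le>n. of_nat (Suc n choose Suc j) * c (Suc j) * \<zeta> ^ Suc j)"
      unfolding poly_\<phi> by (subst sum.atMost_Suc_shift) simp
    also have "\<dots> = c 0 + (\<Sum>j\<le>n. of_nat (n choose Suc j) * c (Suc j) * \<zeta> ^ Suc j) + \<zeta> * \<beta> \<zeta>"
    proof -
      have "of_nat (Suc n choose Suc j) * c (Suc j) * \<zeta> ^ Suc j
          = of_nat (n choose Suc j) * c (Suc j) * \<zeta> ^ Suc j
            + \<zeta> * (of_nat (n choose j) * c (Suc j) * \<zeta> ^ j)" for j
        by (simp only: binomial_Suc_Suc of_nat_add power_Suc) (simp add: algebra_simps)
      then show ?thesis by (simp only: \<beta>_def sum_distrib_left sum.distrib add.assoc)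
    qed
    also have "c 0 + (\<Sum>j\<le>n. of_nat (n choose Suc j) * c (Suc j) * \<zeta> ^ Suc j)
        = (\<Sum>j\<le>Suc n. of_nat (n choose j) * c j * \<zeta> ^ j)"
      by (subst sum.atMost_Suc_shift) simp
    also have "\<dots> = \<alpha> \<zeta>" by (simp add: \<alpha>_def)
    finally show ?thesis .
  qed
  have deriv: "poly (pderiv \<phi>) \<zeta> = of_nat (Suc n) * \<beta> \<zeta>" for \<zeta>
  proof -
    have "poly (pderiv \<phi>) \<zeta> = (\<Sum>j\<le>Suc n. of_nat j * (of_nat (Suc n choose j) * c j) * \<zeta> ^ (j - 1))"
      by (simp only: \<phi>_def pderiv_sum pderiv_monom poly_sum poly_monom)
    also have "\<dots> = (\<Sum>j\<le>n. of_nat (Suc j) * (of_nat (Suc n choose Suc j) * c (Suc j)) * \<zeta> ^ j)"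
      by (subst sum.atMost_Suc_shift) simp
    also have "\<dots> = (\<Sum>j\<le>n. of_nat (Suc n) * (of_nat (n choose j) * c (Suc j) * \<zeta> ^ j))"
    proof (intro sum.cong refl)
      fix j
      have "(of_nat (Suc j) :: complex) * of_nat (Suc n choose Suc j) = of_nat (Suc n) * of_nat (n choose j)"
        by (simp only: of_nat_mult[symmetric] Suc_times_binomial)
      then show "of_nat (Suc j) * (of_nat (Suc n choose Suc j) * c (Suc j)) * \<zeta> ^ j
          = of_nat (Suc n) * (of_nat (n choose j) * c (Suc j) * \<zeta> ^ j)"
        by (simp only: mult.assoc[symmetric])
    qed
    finally show ?thesis by (simp add: \<beta>_def sum_distrib_left)
  qed
  have nz: "poly \<phi> \<zeta> \<noteq> 0" if "Im \<zeta> > 0" for \<zeta>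
    using insert.prems(1)[OF that] insert.hyps unfolding poly_\<phi> by (simp add: n_def)
  have \<phi>0: "\<phi> \<noteq> 0" using nz[of \<i>] by auto
  have "\<alpha> \<zeta> + y k * \<beta> \<zeta> \<noteq> 0" if \<zeta>: "Im \<zeta> > 0" for \<zeta>
  proof
    assume eq: "\<alpha> \<zeta> + y k * \<beta> \<zeta> = 0"
    have \<phi>eq: "poly \<phi> \<zeta> = (\<zeta> - y k) * \<beta> \<zeta>"
      using eq split[of \<zeta>] by (simp add: algebra_simps add_eq_0_iff2)
    then have nz0: "\<zeta> - y k \<noteq> 0" "\<beta> \<zeta> \<noteq> 0" using nz[OF \<zeta>] by auto
    define u where "u = 1 / (\<zeta> - y k)"
    have U: "poly (pderiv \<phi>) \<zeta> / poly \<phi> \<zeta> = of_nat (Suc n) * u"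
      using nz0 unfolding deriv \<phi>eq u_def by (simp del: of_nat_Suc)
    have "of_nat (Suc n) * Im (of_nat (Suc n) * u) + Im \<zeta> * (cmod (of_nat (Suc n) * u))\<^sup>2 \<le> 0"
      using log_deriv_bound[OF \<phi>0 deg _ \<zeta>] nz unfolding U by (meson not_le)
    then have "(of_nat (Suc n))\<^sup>2 * (Im u + Im \<zeta> * (cmod u)\<^sup>2) \<le> 0"
      by (simp add: norm_mult power_mult_distrib power2_eq_square algebra_simps del: of_nat_Suc)
    then have le: "Im u + Im \<zeta> * (cmod u)\<^sup>2 \<le> 0"
      by (simp add: mult_le_0_iff del: of_nat_Suc)
    have "Im u = - Im (\<zeta> - y k) / (cmod (\<zeta> - y k))\<^sup>2"
      by (simp add: u_def Im_divide cmod_power2)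
    moreover have "(cmod u)\<^sup>2 = 1 / (cmod (\<zeta> - y k))\<^sup>2"
      by (simp add: u_def norm_divide power_divide)
    ultimately have "Im u + Im \<zeta> * (cmod u)\<^sup>2 = Im (y k) / (cmod (\<zeta> - y k))\<^sup>2"
      by (simp add: field_simps diff_divide_distrib)
    moreover have "\<dots> > 0" using w nz0 by simp
    ultimately show False using le by simp
  qed
  moreover have "(\<Sum>j\<le>card K. of_nat (card K choose j) * (c j + c (Suc j) * y k) * \<zeta> ^ j)
      = \<alpha> \<zeta> + y k * \<beta> \<zeta>" for \<zeta>
  proof -
    have "of_nat (n choose j) * (c j + c (Suc j) * y k) * \<zeta> ^ j
        = of_nat (n choose j) * c j * \<zeta> ^ j + y k * (of_nat (n choose j) * c (Suc j) * \<zeta> ^ j)" for j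
      by (simp add: algebra_simps)
    then show ?thesis by (simp only: \<alpha>_def \<beta>_def sum_distrib_left sum.distrib n_def[symmetric])
  qed
  ultimately show ?case
    unfolding blossom_insert[OF insert.hyps]
    using insert.prems(2) by (intro insert.IH) auto
qed

section \<open>Stable pencils and common interlacers\<close>

text \<open>Evaluation of a real polynomial at a complex point.\<close>
definition rpoly :: "real poly \<Rightarrow> complex \<Rightarrow> complex" where
  "rpoly f z = poly (map_poly of_real f) z"

lemma rpoly_of_real [simp]: "rpoly f (of_real x) = of_real (poly f x)"
  by (simp add: rpoly_def)

lemma rpoly_hom: "comm_ring_hom (\<lambda>f. rpoly f z)"
proof -
  interpret oh: map_poly_inj_idom_hom "of_real :: real \<Rightarrow> complex" ..
  show ?thesis by unfold_locales (auto simp: rpoly_def oh.hom_add oh.hom_mult)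
qed

text \<open>The stability of \<open>f + y g\<close> in two variables. For real-rooted polynomials this expresses that \<open>g\<close>
  interlaces \<open>f\<close> (Hermite--Biehler), without any reference to lists of roots.\<close>
definition stable_pencil :: "real poly \<Rightarrow> real poly \<Rightarrow> bool" where
  "stable_pencil f g \<longleftrightarrow> (\<forall>s y. Im s > 0 \<longrightarrow> Im y > 0 \<longrightarrow> rpoly f s + y * rpoly g s \<noteq> 0)"

text \<open>Stability says that \<open>- f/g\<close> avoids the upper half-plane on the upper half-plane, so
  \<open>Im (f (cnj g))\<close> is nonnegative on the vertical ray above \<open>x\<close>. It vanishes at \<open>x\<close>, and its derivative
  there is the Wronskian.\<close>
lemma stable_pencil_Wronskian:
  assumes "stable_pencil f g"
  shows "poly (pderiv f) x * poly g x - poly f x * poly (pderiv g) x \<ge> 0"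
proof (rule ccontr)
  define D where "D = poly (pderiv f) x * poly g x - poly f x * poly (pderiv g) x"
  assume "\<not> poly (pderiv f) x * poly g x - poly f x * poly (pderiv g) x \<ge> 0"
  then have D: "D < 0" by (simp add: D_def)
  define z where "z = (\<lambda>\<eta>::real. of_real x + \<i> * of_real \<eta>)"
  define h where "h = (\<lambda>\<eta>. Im (rpoly f (z \<eta>) * cnj (rpoly g (z \<eta>))))"
  have nonneg: "h \<eta> \<ge> 0" if "\<eta> > 0" for \<eta>
  proof (rule ccontr)
    assume neg: "\<not> h \<eta> \<ge> 0"
    define F G where "F = rpoly f (z \<eta>)" and "G = rpoly g (z \<eta>)"
    have FG: "Im (F * cnj G) < 0" using neg by (simp add: h_def F_def G_def)
    then have "G \<noteq> 0" by auto
    define y where "y = - F / G"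
    have "Im (F / G) = Im (F * cnj G) / (cmod G)\<^sup>2"
      by (subst complex_div_cnj) (simp only: Im_divide_of_real)
    then have "Im y > 0" using FG \<open>G \<noteq> 0\<close> by (simp add: y_def divide_neg_pos)
    moreover have "F + y * G = 0" using \<open>G \<noteq> 0\<close> by (simp add: y_def)
    moreover have "Im (z \<eta>) > 0" using that by (simp add: z_def)
    ultimately show False using assms unfolding stable_pencil_def F_def G_def by blast
  qed
  have zd: "(z has_vector_derivative \<i>) (at \<eta>)" for \<eta>
    unfolding z_def by (auto intro!: derivative_eq_intros simp: has_vector_derivative_def)
      (auto intro!: derivative_eq_intros simp: scaleR_conv_of_real mult.commute)
  have pd: "((\<lambda>\<eta>. rpoly q (z \<eta>)) has_vector_derivative (\<i> * rpoly (pderiv q) (z \<eta>))) (at \<eta>)" for q \<eta>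
  proof -
    have "(rpoly q has_field_derivative rpoly (pderiv q) (z \<eta>)) (at (z \<eta>))"
      unfolding rpoly_def of_real_hom.map_poly_pderiv by (rule poly_DERIV)
    then show ?thesis
      unfolding has_vector_derivative_def has_field_derivative_def
      by (auto intro: has_derivative_eq_rhs[OF has_derivative_compose[OF zd[unfolded has_vector_derivative_def]]]
          simp: fun_eq_iff mult_ac)
  qed
  have "((\<lambda>\<eta>. rpoly f (z \<eta>) * cnj (rpoly g (z \<eta>))) has_vector_derivative
      (rpoly f (z 0) * cnj (\<i> * rpoly (pderiv g) (z 0)) + \<i> * rpoly (pderiv f) (z 0) * cnj (rpoly g (z 0)))) (at 0)"
    by (intro has_vector_derivative_mult has_vector_derivative_cnj pd)
  from bounded_linear.has_vector_derivative[OF bounded_linear_Im this]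
  have "(h has_vector_derivative D) (at 0)"
    by (simp add: h_def z_def D_def mult.commute)
  then have "DERIV h 0 :> D" by (simp add: has_real_derivative_iff_has_vector_derivative)
  from DERIV_neg_dec_right[OF this D] obtain d where d: "d > 0" "\<forall>k>0. k < d \<longrightarrow> h (0 + k) < h 0"
    by blast
  then have "h (0 + d / 2) < h 0" by simp
  moreover have "h 0 = 0" by (simp add: h_def z_def)
  ultimately show False using nonneg[of "d / 2"] d(1) by simp
qed

lemma stable_pencil_ratio_decreasing:
  assumes stab: "stable_pencil f g"
    and pos: "\<And>x. x > a \<Longrightarrow> poly f x > 0"
    and lim: "((\<lambda>x. poly g x / poly f x) \<longlongrightarrow> 0) at_top"
    and xy: "a < x" "x \<le> y"
  shows "poly g y / poly f y \<le> poly g x / poly f x" "poly g x \<ge> 0"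
proof -
  have mono: "poly g v / poly f v \<le> poly g u / poly f u" if "a < u" "u \<le> v" for u v
  proof (rule DERIV_nonpos_imp_nonincreasing[OF that(2)])
    fix t assume t: "u \<le> t" "t \<le> v"
    have pt: "poly f t > 0" using pos[of t] t that by simp
    have "((\<lambda>x. poly g x / poly f x) has_real_derivative
        (poly (pderiv g) t * poly f t - poly g t * poly (pderiv f) t) / (poly f t * poly f t)) (at t)"
      using pt by (intro derivative_eq_intros poly_DERIV) auto
    moreover have "(poly (pderiv g) t * poly f t - poly g t * poly (pderiv f) t) / (poly f t * poly f t) \<le> 0"
      using stable_pencil_Wronskian[OF stab, of t] pt
      by (intro divide_nonpos_pos) (auto simp: algebra_simps)
    ultimately show "\<exists>y. ((\<lambda>x. poly g x / poly f x) has_real_derivative y) (at t) \<and> y \<le> 0" by blast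
  qed
  show "poly g y / poly f y \<le> poly g x / poly f x" by (rule mono[OF xy])
  have "poly g x / poly f x \<ge> 0"
  proof (rule tendsto_upperbound[OF lim])
    show "eventually (\<lambda>u. poly g u / poly f u \<le> poly g x / poly f x) at_top"
      using eventually_ge_at_top[of x] by eventually_elim (rule mono[OF xy(1)])
  qed simp
  then show "poly g x \<ge> 0" using pos[OF xy(1)] by (simp add: zero_le_divide_iff)
qed

lemma largest_root:
  fixes f :: "real poly"
  assumes "poly f x0 = 0" and ev: "eventually (\<lambda>x. poly f x > 0) at_top"
  obtains r where "poly f r = 0" "x0 \<le> r" "\<And>x. x > r \<Longrightarrow> poly f x > 0"
proof -
  obtain N where N: "\<And>x. x \<ge> N \<Longrightarrow> poly f x > 0" using ev by (auto simp: eventually_at_top_linorder)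
  have "f \<noteq> 0" using N[of N] by auto
  then have fin: "finite {x. poly f x = 0}" by (rule poly_roots_finite)
  define r where "r = Max {x. poly f x = 0}"
  have mem: "x0 \<in> {x. poly f x = 0}" using assms(1) by simp
  have r: "poly f r = 0" using Max_in[OF fin] mem unfolding r_def by blast
  have ub: "x \<le> r" if "poly f x = 0" for x unfolding r_def using fin that by (intro Max_ge) auto
  show thesis
  proof (rule that[OF r ub[OF assms(1)]])
    fix x assume x: "x > r"
    show "poly f x > 0"
    proof (rule ccontr)
      assume "\<not> poly f x > 0"
      moreover have "poly f x \<noteq> 0" using ub[of x] x by auto
      ultimately have "poly f x < 0" by simp
      moreover have "poly f (max N x + 1) > 0" by (rule N) simp
      ultimately obtain c where "x < c" "poly f c = 0"
        using poly_IVT_pos[of x "max N x + 1" f] by force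
      then show False using ub[of c] x by simp
    qed
  qed
qed

text \<open>Let \<open>s\<close> be the smallest of the largest roots \<open>r i\<close>, attained by \<open>f \<tau>\<close>. Right of \<open>s\<close> the quotient
  \<open>g / f \<tau>\<close> decreases to \<open>0\<close>, which forces \<open>g > 0\<close> there. By the Wronskian inequality \<open>f i / g\<close>
  increases on \<open>(s, r i)\<close> up to the value \<open>0\<close> at \<open>r i\<close>, hence \<open>f i\<close> cannot be positive at \<open>s\<close>.\<close>
lemma common_interlacer_nonpos:
  fixes f :: "'i \<Rightarrow> real poly"
  assumes S: "finite S" "S \<noteq> {}" and g: "g \<noteq> 0"
    and stab: "\<And>i. i \<in> S \<Longrightarrow> stable_pencil (f i) g"
    and ev: "\<And>i. i \<in> S \<Longrightarrow> eventually (\<lambda>x. poly (f i) x > 0) at_top"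
    and lim: "\<And>i. i \<in> S \<Longrightarrow> ((\<lambda>x. poly g x / poly (f i) x) \<longlongrightarrow> 0) at_top"
    and root: "\<And>i. i \<in> S \<Longrightarrow> \<exists>x>0. poly (f i) x = 0"
  shows "\<exists>s>0. \<forall>i\<in>S. poly (f i) s \<le> 0"
proof -
  have "\<forall>i\<in>S. \<exists>r>0. poly (f i) r = 0 \<and> (\<forall>x>r. poly (f i) x > 0)"
  proof
    fix i assume i: "i \<in> S"
    obtain x where x: "x > 0" "poly (f i) x = 0" using root[OF i] by blast
    from largest_root[OF x(2) ev[OF i]] show "\<exists>r>0. poly (f i) r = 0 \<and> (\<forall>x>r. poly (f i) x > 0)"
      using x(1) by (metis less_le_trans)
  qed
  then obtain r where r: "\<And>i. i \<in> S \<Longrightarrow> r i > 0" "\<And>i. i \<in> S \<Longrightarrow> poly (f i) (r i) = 0"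
    "\<And>i x. i \<in> S \<Longrightarrow> x > r i \<Longrightarrow> poly (f i) x > 0" by metis
  define s where "s = Min (r ` S)"
  obtain \<tau> where \<tau>: "\<tau> \<in> S" "s = r \<tau>" using Min_in[of "r ` S"] S unfolding s_def by blast
  have sr: "s \<le> r i" if "i \<in> S" for i using S that by (simp add: s_def)
  have gpos: "poly g x > 0" if x: "x > s" for x
  proof (rule ccontr)
    have f\<tau>: "poly (f \<tau>) x > 0" if "x > s" for x using r(3)[OF \<tau>(1)] that \<tau>(2) by simp
    have dec: "poly g v / poly (f \<tau>) v \<le> poly g u / poly (f \<tau>) u" "poly g u \<ge> 0"
      if "s < u" "u \<le> v" for u v
      using stable_pencil_ratio_decreasing[where a = s, OF stab[OF \<tau>(1)] _ lim[OF \<tau>(1)] that] f\<tau>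
      by blast+
    assume "\<not> poly g x > 0"
    then have gx: "poly g x = 0" using dec(2)[OF x order_refl] by simp
    have "poly g y = 0" if y: "y \<ge> x" for y
    proof -
      have "poly g y / poly (f \<tau>) y \<le> 0" using dec(1)[OF x y] gx by simp
      moreover have "poly (f \<tau>) y > 0" using r(3)[OF \<tau>(1)] y x \<tau>(2) by simp
      ultimately have "poly g y \<le> 0" by (simp add: divide_le_0_iff)
      moreover have "poly g y \<ge> 0" using dec(2)[of y y] x y by simp
      ultimately show ?thesis by simp
    qed
    then have "{x..} \<subseteq> {y. poly g y = 0}" by auto
    moreover have "infinite {x..}" by (rule infinite_Ici)
    ultimately show False using poly_roots_finite[OF g] finite_subset by blast
  qed
  have "poly (f i) s \<le> 0" if i: "i \<in> S" for i
  proof (rule ccontr)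
    assume pos: "\<not> poly (f i) s \<le> 0"
    then have "s \<noteq> r i" using r(2)[OF i] by auto
    then have sri: "s < r i" using sr[OF i] by simp
    have "isCont (poly (f i)) s" by simp
    then have "(poly (f i) \<longlongrightarrow> poly (f i) s) (at_right s)"
      by (simp add: isCont_def filterlim_at_split)
    then have "eventually (\<lambda>x. poly (f i) x > 0) (at_right s)"
      using pos by (intro order_tendstoD(1)) auto
    then obtain b where b: "b > s" "\<And>x. s < x \<Longrightarrow> x < b \<Longrightarrow> poly (f i) x > 0"
      using eventually_at_right_field by (metis gt_ex)
    define s1 where "s1 = (s + min b (r i)) / 2"
    have s1: "s < s1" "s1 < r i" "poly (f i) s1 > 0"
      using b sri b(2)[of s1] by (auto simp: s1_def min_def)
    have "poly (f i) s1 / poly g s1 \<le> poly (f i) (r i) / poly g (r i)"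
    proof (rule DERIV_nonneg_imp_nondecreasing[where f = "\<lambda>x. poly (f i) x / poly g x"])
      show "s1 \<le> r i" using s1 by simp
      fix t assume t: "s1 \<le> t" "t \<le> r i"
      have gt: "poly g t > 0" using gpos[of t] t s1 by simp
      have "((\<lambda>x. poly (f i) x / poly g x) has_real_derivative
          (poly (pderiv (f i)) t * poly g t - poly (f i) t * poly (pderiv g) t) / (poly g t * poly g t)) (at t)"
        using gt by (intro derivative_eq_intros poly_DERIV) auto
      moreover have "(poly (pderiv (f i)) t * poly g t - poly (f i) t * poly (pderiv g) t) / (poly g t * poly g t) \<ge> 0"
        using stable_pencil_Wronskian[OF stab[OF i], of t] gt by simp
      ultimately show "\<exists>y. ((\<lambda>x. poly (f i) x / poly g x) has_real_derivative y) (at t) \<and> 0 \<le> y" by blast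
    qed
    then have "poly (f i) s1 / poly g s1 \<le> 0" using r(2)[OF i] by simp
    then show False using s1(3) gpos[OF s1(1)] by (simp add: divide_le_0_iff)
  qed
  moreover have "s > 0" using r(1)[OF \<tau>(1)] \<tau>(2) by simp
  ultimately show ?thesis by blast
qed

section \<open>Stability of minor lifts\<close>

text \<open>The operation that replaces \<open>x w\<close> and \<open>1\<close> by \<open>0\<close>, and \<open>x\<close> and \<open>w\<close> by \<open>1\<close>. If \<open>C = - B\<close>, the form depends on \<open>x - w\<close> and
  \<open>x w\<close> only, and a zero in the region can be written down. The margin \<open>\<delta>\<close>
  leaves room for \<open>x\<close> to be strictly above \<open>w\<close>.\<close>
lemma bilinear_contraction_nonzero:
  fixes A B C D :: complex
  assumes nz: "\<And>x w. Im x > 0 \<Longrightarrow> Im w \<ge> - \<delta> \<Longrightarrow> A + B * x + C * w + D * x * w \<noteq> 0"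
    and \<delta>: "\<delta> > 0" and CD: "C \<noteq> 0 \<or> D \<noteq> 0"
  shows "B + C \<noteq> 0"
proof
  assume "B + C = 0"
  then have C: "C = - B" by (simp add: add_eq_0_iff)
  show False
  proof (cases "D = 0")
    case True
    then have B: "B \<noteq> 0" using CD C by simp
    \<comment> \<open>The form is \<open>A + B (x - w)\<close>, with a zero at \<open>x = w - A / B\<close>; \<open>w\<close> is high enough to keep \<open>x\<close> in the half-plane.\<close>
    define w where "w = \<i> * of_real (max 0 (Im (A / B)) + 1)"
    have "Im w \<ge> - \<delta>" "Im (w - A / B) > 0" using \<delta> by (auto simp: w_def)
    then have "A + B * (w - A / B) + C * w + D * (w - A / B) * w \<noteq> 0" by (intro nz)
    then show False using True B C by (simp add: algebra_simps)
  next
    case False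
    \<comment> \<open>Along \<open>x = q + h\<close>, \<open>w = q - h\<close> the form is a polynomial in \<open>q\<^sup>2\<close>; take the square root in the closed upper half-plane.\<close>
    define h where "h = \<i> * of_real (\<delta> / 4)"
    obtain q where q: "q\<^sup>2 = h\<^sup>2 - (A + 2 * h * B) / D" "Im q \<ge> 0"
    proof -
      define q0 where "q0 = csqrt (h\<^sup>2 - (A + 2 * h * B) / D)"
      have "q0\<^sup>2 = h\<^sup>2 - (A + 2 * h * B) / D" by (simp add: q0_def)
      then show thesis using that[of q0] that[of "- q0"] by (cases "Im q0 \<ge> 0") auto
    qed
    define x where "x = h + q"
    have "Im x > 0" "Im (x - 2 * h) \<ge> - \<delta>" using q(2) \<delta> by (auto simp: x_def h_def)
    then have "A + B * x + C * (x - 2 * h) + D * x * (x - 2 * h) \<noteq> 0" by (intro nz)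
    moreover have "A + B * x + C * (x - 2 * h) + D * x * (x - 2 * h) = A + 2 * h * B + D * (q\<^sup>2 - h\<^sup>2)"
      unfolding C x_def by (simp add: power2_eq_square algebra_simps)
    moreover have "\<dots> = 0" unfolding q(1) using False by simp
    ultimately show False by simp
  qed
qed

text \<open>The imaginary part of the quadratic form of \<open>M\<close> is at least \<open>\<delta>\<close> times the squared norm. For a
  complex symmetric \<open>M\<close> this is \<open>Im M \<ge> \<delta> I\<close>.\<close>
definition im_pos_def :: "nat \<Rightarrow> real \<Rightarrow> (nat \<Rightarrow> nat \<Rightarrow> complex) \<Rightarrow> bool" where
  "im_pos_def n \<delta> M \<longleftrightarrow> (\<forall>v. Im (\<Sum>i<n. \<Sum>j<n. cnj (v i) * M i j * v j) \<ge> \<delta> * (\<Sum>i<n. (cmod (v i))\<^sup>2))"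

lemma im_pos_def_pminor_nonzero:
  assumes pd: "im_pos_def n \<delta> M" and \<delta>: "\<delta> > 0" and R: "R \<subseteq> {..<n}"
  shows "pminor M R \<noteq> 0"
proof
  define X where "X = mat n n (\<lambda>(i, j). if i \<in> R then M i j else if i = j then 1 else 0)"
  assume "pminor M R = 0"
  then have "det X = 0" using pminor_masked[OF _ R, of M] by (simp add: pminor_lessThan X_def)
  then obtain v where v: "v \<in> carrier_vec n" "v \<noteq> 0\<^sub>v n" "X *\<^sub>v v = 0\<^sub>v n"
    using det_0_iff_vec_prod_zero[of X n] by (auto simp: X_def)
  have row: "(\<Sum>j<n. X $$ (i, j) * vec_index v j) = 0" if "i < n" for i
  proof -
    have "vec_index (X *\<^sub>v v) i = (\<Sum>j<n. X $$ (i, j) * vec_index v j)"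
      using that v(1) by (simp add: X_def scalar_prod_def atLeast0LessThan)
    then show ?thesis using v(3) that by simp
  qed
  have "(\<Sum>j<n. cnj (vec_index v i) * M i j * vec_index v j) = 0" if i: "i < n" for i
  proof (cases "i \<in> R")
    case True
    have "(\<Sum>j<n. cnj (vec_index v i) * M i j * vec_index v j)
        = cnj (vec_index v i) * (\<Sum>j<n. X $$ (i, j) * vec_index v j)"
      unfolding sum_distrib_left by (intro sum.cong) (use i True in \<open>auto simp: X_def\<close>)
    then show ?thesis using row[OF i] by simp
  next
    case False
    have "(\<Sum>j<n. X $$ (i, j) * vec_index v j) = (\<Sum>j<n. if i = j then vec_index v j else 0)"
      by (intro sum.cong) (use i False in \<open>auto simp: X_def\<close>)
    then have "vec_index v i = 0" using row[OF i] i by simp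
    then show ?thesis by simp
  qed
  then have "\<delta> * (\<Sum>i<n. (cmod (vec_index v i))\<^sup>2) \<le> 0"
    using pd[unfolded im_pos_def_def, rule_format, of "vec_index v"] by simp
  then have "(\<Sum>i<n. (cmod (vec_index v i))\<^sup>2) \<le> 0" using \<delta> by (simp add: mult_le_0_iff)
  then have "(\<Sum>i<n. (cmod (vec_index v i))\<^sup>2) = 0" by (intro antisym sum_nonneg) auto
  then have "\<forall>i\<in>{..<n}. (cmod (vec_index v i))\<^sup>2 = 0"
    by (subst (asm) sum_nonneg_eq_0_iff) auto
  then have "v = 0\<^sub>v n" using v(1) by (intro eq_vecI) auto
  then show False using v(2) by simp
qed

lemma im_pos_def_add_diag_entry:
  assumes pd: "im_pos_def n \<delta> M" and \<delta>: "\<delta> > 0" and k: "k < n" and w: "Im w \<ge> - (\<delta> / 2)"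
  shows "im_pos_def n (\<delta> / 2) (\<lambda>i j. (if i = j then (if i = k then w else 0) else 0) + M i j)"
  unfolding im_pos_def_def
proof
  fix v :: "nat \<Rightarrow> complex"
  have *: "(\<Sum>j<n. cnj (v i) * ((if i = j then if i = k then w else 0 else 0) + M i j) * v j)
      = (if i = k then w * of_real ((cmod (v k))\<^sup>2) else 0) + (\<Sum>j<n. cnj (v i) * M i j * v j)"
    if "i < n" for i
  proof -
    have "(\<Sum>j<n. cnj (v i) * ((if i = j then if i = k then w else 0 else 0) + M i j) * v j)
        = (\<Sum>j<n. (if i = j then (if i = k then w * (v i * cnj (v i)) else 0) else 0) + cnj (v i) * M i j * v j)"
      by (intro sum.cong) (auto simp: algebra_simps)
    also have "\<dots> = (if i = k then w * (v i * cnj (v i)) else 0) + (\<Sum>j<n. cnj (v i) * M i j * v j)"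
      using that by (simp add: sum.distrib)
    finally show ?thesis by (simp only: complex_norm_square) (cases "i = k"; simp)
  qed
  have "(\<Sum>i<n. \<Sum>j<n. cnj (v i) * ((if i = j then if i = k then w else 0 else 0) + M i j) * v j)
      = w * of_real ((cmod (v k))\<^sup>2) + (\<Sum>i<n. \<Sum>j<n. cnj (v i) * M i j * v j)"
    using * k by (simp add: sum.distrib)
  then have eq: "Im (\<Sum>i<n. \<Sum>j<n. cnj (v i) * ((if i = j then if i = k then w else 0 else 0) + M i j) * v j)
      = Im w * (cmod (v k))\<^sup>2 + Im (\<Sum>i<n. \<Sum>j<n. cnj (v i) * M i j * v j)"
    by (simp only:) simp
  have "(cmod (v k))\<^sup>2 \<le> (\<Sum>i<n. (cmod (v i))\<^sup>2)" using k by (intro member_le_sum) auto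
  then have "(\<delta> / 2) * (cmod (v k))\<^sup>2 \<le> (\<delta> / 2) * (\<Sum>i<n. (cmod (v i))\<^sup>2)"
    using \<delta> by (intro mult_left_mono) auto
  moreover have "- (\<delta> / 2) * (cmod (v k))\<^sup>2 \<le> Im w * (cmod (v k))\<^sup>2"
    using w by (intro mult_right_mono) auto
  moreover have "\<delta> * (\<Sum>i<n. (cmod (v i))\<^sup>2) \<le> Im (\<Sum>i<n. \<Sum>j<n. cnj (v i) * M i j * v j)"
    using pd by (simp add: im_pos_def_def)
  ultimately show "\<delta> / 2 * (\<Sum>i<n. (cmod (v i))\<^sup>2)
      \<le> Im (\<Sum>i<n. \<Sum>j<n. cnj (v i) * ((if i = j then if i = k then w else 0 else 0) + M i j) * v j)"
    unfolding eq by simp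
qed

text \<open>An interpolation between \<open>p\<close> and its minor lift: the variables in \<open>K\<close> have already been replaced by rows and
  columns of \<open>M\<close>, and the rows and columns in \<open>R\<close> border every minor. For \<open>K = {}\<close> this is
  \<open>p(x) det M\<^sub>R\<close>, and for \<open>K = {..<n}\<close>, \<open>R = {}\<close> it is the minor lift.\<close>
definition partial_lift ::
    "nat \<Rightarrow> (nat set \<Rightarrow> 'a :: comm_ring_1) \<Rightarrow> nat set \<Rightarrow> nat set \<Rightarrow> (nat \<Rightarrow> 'a) \<Rightarrow> (nat \<Rightarrow> nat \<Rightarrow> 'a) \<Rightarrow> 'a" where
  "partial_lift n a K R x M
    = (\<Sum>J\<in>Pow {..<n}. a J * (\<Prod>i\<in>J - K. x i) * pminor M ((J \<inter> K) \<union> R))"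

text \<open>One more index \<open>k\<close> moves into \<open>K\<close> as follows. With \<open>k\<close> adjoined to \<open>R\<close>, the partial lift is a
  bilinear form \<open>A + B X + C w + D X w\<close> in the variable \<open>X = x k\<close> and an increment \<open>w\<close> of the diagonal
  entry \<open>M k k\<close>, nonvanishing by induction. Its contraction \<open>B + C\<close> is the partial lift for \<open>insert k K\<close>.\<close>
lemma partial_lift_nonzero:
  assumes stab: "\<And>x. (\<And>i. i < n \<Longrightarrow> Im (x i) > 0) \<Longrightarrow> maff n a x \<noteq> 0"
    and "finite K" "K \<subseteq> {..<n}" "R \<subseteq> {..<n}" "R \<inter> K = {}"
    and "\<And>i. i < n \<Longrightarrow> Im (x i) > 0" "im_pos_def n \<delta> M" "\<delta> > 0"
  shows "partial_lift n a K R x M \<noteq> 0"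
  using assms(2-)
proof (induction K arbitrary: R x M \<delta> rule: finite_induct)
  case empty
  have "partial_lift n a {} R x M = maff n a x * pminor M R"
    by (simp add: partial_lift_def maff_def sum_distrib_right)
  then show ?case using stab[of x] im_pos_def_pminor_nonzero[of n \<delta> M R] empty.prems by auto
next
  case (insert k K)
  have k: "k < n" "k \<notin> R" "k \<notin> K" using insert.prems insert.hyps by auto
  define t where "t = (\<lambda>J. a J * (\<Prod>i\<in>J - insert k K. x i))"
  define S where "S = (\<lambda>J. (J \<inter> K) \<union> R)"
  define A where "A = (\<Sum>J\<in>Pow {..<n}. if k \<in> J then 0 else t J * pminor M (insert k (S J)))"
  define B where "B = (\<Sum>J\<in>Pow {..<n}. if k \<in> J then t J * pminor M (insert k (S J)) else 0)"
  define C where "C = (\<Sum>J\<in>Pow {..<n}. if k \<in> J then 0 else t J * pminor M (S J))"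
  define D where "D = (\<Sum>J\<in>Pow {..<n}. if k \<in> J then t J * pminor M (S J) else 0)"
  have finR: "finite R" using insert.prems(2) finite_subset by blast
  have S: "finite (S J)" "k \<notin> S J" for J
    using finR insert.hyps(1) k by (simp_all add: S_def)
  have prodX: "a J * (\<Prod>i\<in>J - K. (x(k := X)) i) = (if k \<in> J then X * t J else t J)"
    if "J \<in> Pow {..<n}" for J X
  proof (cases "k \<in> J")
    case True
    have "J - K = insert k (J - insert k K)" using True k by auto
    then have "(\<Prod>i\<in>J - K. (x(k := X)) i) = (\<Prod>i\<in>insert k (J - insert k K). (x(k := X)) i)"
      by (rule arg_cong)
    also have "\<dots> = X * (\<Prod>i\<in>J - insert k K. (x(k := X)) i)"
      using that finite_subset[of J "{..<n}"] by (subst prod.insert) auto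
    also have "(\<Prod>i\<in>J - insert k K. (x(k := X)) i) = (\<Prod>i\<in>J - insert k K. x i)"
      by (intro prod.cong) auto
    finally show ?thesis using True by (simp only: t_def if_True mult.left_commute)
  next
    case False
    then have "J - K = J - insert k K" by auto
    moreover have "(\<Prod>i\<in>J - insert k K. (x(k := X)) i) = (\<Prod>i\<in>J - insert k K. x i)"
      by (intro prod.cong) auto
    ultimately show ?thesis using False by (simp add: t_def)
  qed
  have expand: "partial_lift n a K (insert k R) (x(k := X))
      (\<lambda>i j. (if i = j then (if i = k then w else 0) else 0) + M i j)
      = A + B * X + C * w + D * X * w" for X w
  proof -
    have "partial_lift n a K (insert k R) (x(k := X))
        (\<lambda>i j. (if i = j then (if i = k then w else 0) else 0) + M i j)
        = (\<Sum>J\<in>Pow {..<n}. (if k \<in> J then X * t J else t J) * (w * pminor M (S J) + pminor M (insert k (S J))))"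
      unfolding partial_lift_def
    proof (intro sum.cong refl)
      fix J assume J: "J \<in> Pow {..<n}"
      have "(J \<inter> K) \<union> insert k R = insert k (S J)" by (auto simp: S_def)
      then show "a J * (\<Prod>i\<in>J - K. (x(k := X)) i) * pminor (\<lambda>i j. (if i = j then (if i = k then w else 0) else 0) + M i j) ((J \<inter> K) \<union> insert k R)
          = (if k \<in> J then X * t J else t J) * (w * pminor M (S J) + pminor M (insert k (S J)))"
        by (simp only: prodX[OF J] pminor_add_diag_entry[OF S])
    qed
    also have "\<dots> = (\<Sum>J\<in>Pow {..<n}. (if k \<in> J then 0 else t J * pminor M (insert k (S J)))
        + (if k \<in> J then t J * pminor M (insert k (S J)) else 0) * X
        + (if k \<in> J then 0 else t J * pminor M (S J)) * w
        + (if k \<in> J then t J * pminor M (S J) else 0) * X * w)"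
      by (intro sum.cong) (auto simp: algebra_simps)
    finally show ?thesis
      by (simp only: A_def B_def C_def D_def sum.distrib sum_distrib_right)
  qed
  have "B + C \<noteq> 0"
  proof (rule bilinear_contraction_nonzero)
    show "\<delta> / 2 > 0" using insert.prems by simp
    fix X w assume X: "Im X > 0" and w: "Im w \<ge> - (\<delta> / 2)"
    show "A + B * X + C * w + D * X * w \<noteq> 0"
      unfolding expand[symmetric]
    proof (rule insert.IH)
      show "im_pos_def n (\<delta> / 2) (\<lambda>i j. (if i = j then (if i = k then w else 0) else 0) + M i j)"
        using insert.prems k w by (intro im_pos_def_add_diag_entry)
    qed (use insert.prems k X insert.hyps in auto)
  next
    have "C + D * x k = partial_lift n a K R x M"
    proof -
      have "partial_lift n a K R x M = (\<Sum>J\<in>Pow {..<n}. (if k \<in> J then x k * t J else t J) * pminor M (S J))"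
        unfolding partial_lift_def
      proof (intro sum.cong refl)
        fix J assume J: "J \<in> Pow {..<n}"
        show "a J * (\<Prod>i\<in>J - K. x i) * pminor M ((J \<inter> K) \<union> R)
            = (if k \<in> J then x k * t J else t J) * pminor M (S J)"
          using prodX[OF J, of "x k"] by (simp add: S_def)
      qed
      also have "\<dots> = (\<Sum>J\<in>Pow {..<n}. (if k \<in> J then 0 else t J * pminor M (S J))
          + (if k \<in> J then t J * pminor M (S J) else 0) * x k)"
        by (intro sum.cong) (auto simp: algebra_simps)
      finally show ?thesis by (simp only: C_def D_def sum.distrib sum_distrib_right)
    qed
    moreover have "partial_lift n a K R x M \<noteq> 0"
      by (rule insert.IH[where \<delta> = \<delta>]) (use insert.prems in auto)
    ultimately show "C \<noteq> 0 \<or> D \<noteq> 0" by auto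
  qed
  moreover have "partial_lift n a (insert k K) R x M = B + C"
  proof -
    have "partial_lift n a (insert k K) R x M
        = (\<Sum>J\<in>Pow {..<n}. (if k \<in> J then t J * pminor M (insert k (S J)) else 0)
          + (if k \<in> J then 0 else t J * pminor M (S J)))"
      unfolding partial_lift_def
    proof (intro sum.cong refl)
      fix J
      have "(J \<inter> insert k K) \<union> R = (if k \<in> J then insert k (S J) else S J)" by (auto simp: S_def)
      then show "a J * (\<Prod>i\<in>J - insert k K. x i) * pminor M ((J \<inter> insert k K) \<union> R)
          = (if k \<in> J then t J * pminor M (insert k (S J)) else 0)
            + (if k \<in> J then 0 else t J * pminor M (S J))"
        by (simp add: t_def)
    qed
    then show ?thesis by (simp only: B_def C_def sum.distrib)
  qed
  ultimately show ?case by simp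
qed

theorem mlift_nonzero:
  assumes "\<And>x. (\<And>i. i < n \<Longrightarrow> Im (x i) > 0) \<Longrightarrow> maff n a x \<noteq> 0"
    and "im_pos_def n \<delta> M" "\<delta> > 0"
  shows "mlift n a M \<noteq> 0"
proof -
  have "partial_lift n a {..<n} {} (\<lambda>_. \<i>) M \<noteq> 0"
    by (rule partial_lift_nonzero[OF assms(1)]) (use assms in auto)
  moreover have "partial_lift n a {..<n} {} (\<lambda>_. \<i>) M = mlift n a M"
    unfolding partial_lift_def mlift_def
  proof (intro sum.cong refl)
    fix J assume "J \<in> Pow {..<n}"
    then have "J - {..<n} = {}" "J \<inter> {..<n} \<union> {} = J" by auto
    then show "a J * (\<Prod>i\<in>J - {..<n}. \<i>) * pminor M ((J \<inter> {..<n}) \<union> {}) = a J * pminor M J"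
      by (simp only: prod.empty mult_1_right)
  qed
  ultimately show ?thesis by simp
qed

section \<open>From permuted spectra to spectral containment\<close>

definition homog_coefs :: "nat \<Rightarrow> nat \<Rightarrow> (nat set \<Rightarrow> real) \<Rightarrow> bool" where
  "homog_coefs n d a \<longleftrightarrow> (\<forall>J\<subseteq>{..<n}. a J \<noteq> 0 \<longrightarrow> card J = d)"

definition stable_coefs :: "nat \<Rightarrow> (nat set \<Rightarrow> real) \<Rightarrow> bool" where
  "stable_coefs n a \<longleftrightarrow>
     (\<forall>x. (\<forall>i<n. Im (x i) > 0) \<longrightarrow> maff n (\<lambda>J. complex_of_real (a J)) x \<noteq> 0)"

text \<open>The univariate polynomial \<open>p(v + s\<one>)\<close> in \<open>s\<close>, obtained by evaluating \<open>p\<close> in the ring of polynomials; similarly for the minor lift below.\<close>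
definition line_maff :: "nat \<Rightarrow> (nat set \<Rightarrow> real) \<Rightarrow> (nat \<Rightarrow> real) \<Rightarrow> real poly" where
  "line_maff n a v = maff n (\<lambda>J. [:a J:]) (\<lambda>i. [:v i, 1:])"

definition line_mlift :: "nat \<Rightarrow> (nat set \<Rightarrow> real) \<Rightarrow> (nat \<Rightarrow> nat \<Rightarrow> real) \<Rightarrow> real poly" where
  "line_mlift n a M = mlift n (\<lambda>J. [:a J:]) (\<lambda>i j. [:M i j, if i = j then 1 else 0:])"

definition shift_diag :: "(nat \<Rightarrow> nat \<Rightarrow> 'a :: comm_ring_1) \<Rightarrow> 'a \<Rightarrow> nat \<Rightarrow> nat \<Rightarrow> 'a" where
  "shift_diag M s = (\<lambda>i j. M i j + (if i = j then s else 0))"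

lemma rpoly_linear: "rpoly [:b:] z = of_real b" "rpoly [:b, c:] z = of_real b + z * of_real c"
  by (simp_all add: rpoly_def of_real_hom.map_poly_pCons_hom)

lemma poly_line_maff: "poly (line_maff n a v) s = maff n a (\<lambda>i. v i + s)"
  by (simp add: line_maff_def poly_hom.hom_maff)

lemma rpoly_line_maff:
  "rpoly (line_maff n a v) z = maff n (\<lambda>J. of_real (a J)) (\<lambda>i. of_real (v i) + z)"
proof -
  interpret comm_ring_hom "\<lambda>f. rpoly f z" by (rule rpoly_hom)
  show ?thesis by (simp add: line_maff_def hom_maff rpoly_linear)
qed

lemma poly_line_mlift: "poly (line_mlift n a M) s = mlift n a (shift_diag M s)"
  unfolding line_mlift_def poly_hom.hom_mlift shift_diag_def
  by (intro mlift_cong) auto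

lemma rpoly_line_mlift:
  "rpoly (line_mlift n a M) z
    = mlift n (\<lambda>J. of_real (a J)) (shift_diag (\<lambda>i j. of_real (M i j)) z)"
proof -
  interpret comm_ring_hom "\<lambda>f. rpoly f z" by (rule rpoly_hom)
  show ?thesis unfolding line_mlift_def hom_mlift shift_diag_def
    by (intro mlift_cong) (auto simp: rpoly_linear)
qed

lemma tendsto_divide_plus: "((\<lambda>s::real. c / s + b) \<longlongrightarrow> b) at_top"
proof -
  have "((\<lambda>s::real. c / s) \<longlongrightarrow> 0) at_top"
    by (rule tendsto_divide_0[OF tendsto_const filterlim_at_top_imp_at_infinity[OF filterlim_ident]])
  from tendsto_add[OF this tendsto_const[of b]] show ?thesis by simp
qed

lemma maff_asymptotics:
  assumes "homog_coefs n d a"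
  shows "((\<lambda>s. maff n a (\<lambda>i. v i + s) / s ^ d) \<longlongrightarrow> maff n a (\<lambda>_. 1)) at_top"
proof -
  have vs: "((\<lambda>s. v i / s + 1) \<longlongrightarrow> 1) at_top" for i
    by (rule tendsto_divide_plus)
  have "((\<lambda>s. maff n a (\<lambda>i. v i / s + 1)) \<longlongrightarrow> maff n a (\<lambda>_. 1)) at_top"
    unfolding maff_def
    by (intro tendsto_sum tendsto_mult tendsto_const tendsto_prod vs)
  moreover have "eventually (\<lambda>s. maff n a (\<lambda>i. v i / s + 1) = maff n a (\<lambda>i. v i + s) / s ^ d) at_top"
    using eventually_gt_at_top[of "0::real"]
  proof eventually_elim
    case (elim s)
    have "maff n a (\<lambda>i. v i + s) = maff n a (\<lambda>i. s * (v i / s + 1))"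
      by (intro maff_cong) (use elim in \<open>auto simp: field_simps\<close>)
    also have "\<dots> = s ^ d * maff n a (\<lambda>i. v i / s + 1)"
      using assms by (intro maff_scale) (auto simp: homog_coefs_def)
    finally show ?case using elim by simp
  qed
  ultimately show ?thesis by (rule Lim_transform_eventually)
qed

lemma mlift_asymptotics:
  assumes "homog_coefs n d a"
  shows "((\<lambda>s. mlift n a (shift_diag M s) / s ^ d) \<longlongrightarrow> maff n a (\<lambda>_. 1)) at_top"
proof -
  define E where "E = (\<lambda>s i j. M i j / s + (if i = j then 1 else 0))"
  have vs: "((\<lambda>s. E s i j) \<longlongrightarrow> (if i = j then 1 else 0)) at_top" for i j
    unfolding E_def by (rule tendsto_divide_plus)
  have "((\<lambda>s. mlift n a (E s)) \<longlongrightarrow> mlift n a (\<lambda>i j. if i = j then 1 else 0)) at_top"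
    unfolding mlift_def pminor_def
    by (intro tendsto_sum tendsto_mult tendsto_const tendsto_prod vs)
  moreover have "eventually (\<lambda>s. mlift n a (E s) = mlift n a (shift_diag M s) / s ^ d) at_top"
    using eventually_gt_at_top[of "0::real"]
  proof eventually_elim
    case (elim s)
    have "mlift n a (shift_diag M s) = mlift n a (\<lambda>i j. s * E s i j)"
      by (intro mlift_cong) (use elim in \<open>auto simp: E_def shift_diag_def field_simps\<close>)
    also have "\<dots> = s ^ d * mlift n a (E s)"
      using assms by (intro mlift_scale) (auto simp: homog_coefs_def)
    finally show ?case using elim by simp
  qed
  ultimately have "((\<lambda>s. mlift n a (shift_diag M s) / s ^ d) \<longlongrightarrow> mlift n a (\<lambda>i j. if i = j then 1 else 0)) at_top"
    by (rule Lim_transform_eventually)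
  then show ?thesis using mlift_diag[of n a "\<lambda>_. 1"] by simp
qed

lemma eventually_pos_of_ratio:
  fixes F :: "real \<Rightarrow> real"
  assumes "((\<lambda>s. F s / s ^ d) \<longlongrightarrow> c) at_top" "c > 0"
  shows "eventually (\<lambda>s. F s > 0) at_top"
  using order_tendstoD(1)[OF assms] eventually_gt_at_top[of 0]
  by eventually_elim (simp add: zero_less_divide_iff)

text \<open>The common skeleton of the proofs by interlacing and mixtures. If no member of the family were in the
  cone of \<open>p\<close>, then \<open>interlace\<close> provides \<open>s > 0\<close> where all members are nonpositive. By \<open>mix\<close> the lift
  is nonpositive there as well, but it is positive for large arguments, so it has a root at or beyond \<open>s\<close>.\<close>
lemma containment_of_family:
  assumes homog: "homog_coefs n d a" and one: "maff n a (\<lambda>_. 1) > 0"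
    and A: "\<And>s. s > 0 \<Longrightarrow> mlift n a (shift_diag A s) \<noteq> 0"
    and interlace: "(\<And>\<sigma>. \<sigma> \<in> S \<Longrightarrow> \<exists>s>0. maff n a (\<lambda>i. l (\<sigma> i) + s) = 0) \<Longrightarrow>
      \<exists>s>0. \<forall>\<sigma>\<in>S. maff n a (\<lambda>i. l (\<sigma> i) + s) \<le> 0"
    and mix: "\<And>s. s > 0 \<Longrightarrow> \<exists>\<sigma>\<in>S. mlift n a (shift_diag A s) \<le> maff n a (\<lambda>i. l (\<sigma> i) + s)"
  shows "\<exists>\<sigma>\<in>S. \<forall>s>0. maff n a (\<lambda>i. l (\<sigma> i) + s) \<noteq> 0"
proof (rule ccontr)
  assume "\<not> ?thesis"
  then have "\<And>\<sigma>. \<sigma> \<in> S \<Longrightarrow> \<exists>s>0. maff n a (\<lambda>i. l (\<sigma> i) + s) = 0" by blast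
  from interlace[OF this] obtain s where s: "s > 0" "\<And>\<sigma>. \<sigma> \<in> S \<Longrightarrow> maff n a (\<lambda>i. l (\<sigma> i) + s) \<le> 0"
    by blast
  from mix[OF s(1)] s(2) have le: "mlift n a (shift_diag A s) \<le> 0" by force
  define P where "P = line_mlift n a A"
  have P: "poly P t = mlift n a (shift_diag A t)" for t by (simp add: P_def poly_line_mlift)
  have "eventually (\<lambda>t. poly P t > 0) at_top"
    unfolding P using mlift_asymptotics[OF homog] one by (rule eventually_pos_of_ratio)
  then have "eventually (\<lambda>t. poly P t > 0 \<and> t > s) at_top"
    using eventually_gt_at_top[of s] by (rule eventually_conj)
  then obtain t where t: "poly P t > 0" "t > s"
    using eventually_happens'[OF trivial_limit_at_top_linorder] by blast
  have "poly P s < 0" using le A[OF s(1)] P[of s] by simp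
  from poly_IVT_pos[OF t(2) this t(1)] obtain u where "s < u" "poly P u = 0" by blast
  then show False using A[of u] s(1) P[of u] by simp
qed

lemma stable_poly_multiaffine_poly: "stable_poly n (multiaffine_poly n a) \<longleftrightarrow> stable_coefs n a"
proof
  assume L: "stable_poly n (multiaffine_poly n a)"
  show "stable_coefs n a"
    unfolding stable_coefs_def
  proof (intro allI impI)
    fix x :: "nat \<Rightarrow> complex" assume "\<forall>i<n. Im (x i) > 0"
    then have "eval (multiaffine_poly n a) (vec n x) \<noteq> 0"
      using L unfolding stable_poly_def by (metis index_vec vec_carrier)
    moreover have "eval (multiaffine_poly n a) (vec n x) = maff n (\<lambda>J. of_real (a J)) x"
      unfolding eval_multiaffine_poly by (intro maff_cong) auto
    ultimately show "maff n (\<lambda>J. complex_of_real (a J)) x \<noteq> 0" by simp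
  qed
qed (auto simp: stable_poly_def stable_coefs_def eval_multiaffine_poly)

text \<open>The symmetric matrix with eigenvalues \<open>l\<close> whose eigenvectors are the rows of \<open>U\<close>.\<close>
definition spectral_form :: "nat \<Rightarrow> (nat \<Rightarrow> real) \<Rightarrow> (nat \<Rightarrow> nat \<Rightarrow> real) \<Rightarrow> nat \<Rightarrow> nat \<Rightarrow> real" where
  "spectral_form n l U = (\<lambda>i j. \<Sum>k<n. l k * U k i * U k j)"

text \<open>By the spectral theorem only matrices of the form \<open>spectral_form n l U\<close> have to be considered, and every
  permutation of \<open>l\<close> is again an eigenvalue vector.\<close>
lemma spectral_containmentI:
  assumes homog: "homog_coefs n d a" and stab: "stable_coefs n a"
    and main: "\<And>l U. orthogonal_fun n U \<Longrightarrow>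
      (\<And>s. s > 0 \<Longrightarrow> mlift n a (shift_diag (spectral_form n l U) s) \<noteq> 0) \<Longrightarrow>
      \<exists>\<sigma>. \<sigma> permutes {..<n} \<and> (\<forall>s>0. maff n a (\<lambda>i. l (\<sigma> i) + s) \<noteq> 0)"
  shows "spectral_containment n (multiaffine_poly n a)"
  unfolding spectral_containment_def
proof (intro conjI ballI)
  show "\<exists>d. homogeneous d (multiaffine_poly n a)"
    using homog by (auto simp: homogeneous_multiaffine_poly_iff homog_coefs_def)
  show "stable_poly n (multiaffine_poly n a)" using stab by (simp add: stable_poly_multiaffine_poly)
  fix A assume "A \<in> cone_lift n (multiaffine_poly n a)"
  then have A: "A \<in> sym_mats n"
    and nz: "\<And>s. s > 0 \<Longrightarrow> mlift n a (\<lambda>i j. A $$ (i, j) + (if i = j then s else 0)) \<noteq> 0"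
    by (auto simp: cone_lift_multiaffine_poly_iff)
  have Ac: "A \<in> carrier_mat n n" using A by (simp add: sym_mats_def)
  obtain l where l: "eigenvalue_vector A l" using eigenvalue_vector_exists[OF A] by blast
  obtain U where U: "orthogonal_fun n U"
    "\<And>i j. i < n \<Longrightarrow> j < n \<Longrightarrow> A $$ (i, j) = (\<Sum>k<n. vec_index l k * U k i * U k j)"
    using spectral_decomposition[OF A l] by blast
  have "mlift n a (shift_diag (spectral_form n (vec_index l) U) s) \<noteq> 0" if "s > 0" for s
  proof -
    have "mlift n a (shift_diag (spectral_form n (vec_index l) U) s)
        = mlift n a (\<lambda>i j. A $$ (i, j) + (if i = j then s else 0))"
      by (intro mlift_cong) (auto simp: U(2) shift_diag_def spectral_form_def)
    then show ?thesis using nz[OF that] by simp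
  qed
  from main[OF U(1) this] obtain \<sigma> where \<sigma>: "\<sigma> permutes {..<n}"
    "\<And>s. s > 0 \<Longrightarrow> maff n a (\<lambda>i. vec_index l (\<sigma> i) + s) \<noteq> 0" by blast
  have "vec n (\<lambda>i. vec_index l (\<sigma> i)) \<in> cone_poly n (multiaffine_poly n a)"
    unfolding cone_poly_multiaffine_poly_iff
  proof (intro conjI allI impI)
    fix s :: real assume "s > 0"
    have "maff n a (\<lambda>i. vec_index (vec n (\<lambda>i. vec_index l (\<sigma> i))) i + s) = maff n a (\<lambda>i. vec_index l (\<sigma> i) + s)"
      by (intro maff_cong) auto
    then show "maff n a (\<lambda>i. vec_index (vec n (\<lambda>i. vec_index l (\<sigma> i))) i + s) \<noteq> 0"
      using \<sigma>(2)[OF \<open>s > 0\<close>] by simp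
  qed simp
  then show "\<exists>l. eigenvalue_vector A l \<and> l \<in> cone_poly n (multiaffine_poly n a)"
    using eigenvalue_vector_permute[OF Ac l \<sigma>(1)] by blast
qed (simp_all add: multiaffine_poly_in_poly_ring multiaffine_multiaffine_poly)

lemma shift_diag_spectral_form:
  assumes "orthogonal_fun n U" "i < n" "j < n"
  shows "shift_diag (spectral_form n l U) s i j = spectral_form n (\<lambda>k. l k + s) U i j"
proof -
  have "(\<Sum>k<n. (l k + s) * U k i * U k j) = (\<Sum>k<n. l k * U k i * U k j) + s * (\<Sum>k<n. U k i * U k j)"
    by (simp add: sum_distrib_left sum.distrib algebra_simps)
  then show ?thesis using assms by (simp add: shift_diag_def spectral_form_def orthogonal_fun_def)
qed

lemma mlift_shift_diag_spectral_form:
  assumes "orthogonal_fun n U"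
  shows "mlift n a (shift_diag (spectral_form n l U) s) = mlift n a (spectral_form n (\<lambda>k. l k + s) U)"
  by (intro mlift_cong) (auto simp: shift_diag_spectral_form[OF assms])

section \<open>Mixtures of principal minors\<close>

text \<open>The matrix \<open>U D U\<^sup>T\<close>, where \<open>D\<close> is the diagonal projection onto the coordinates in \<open>H\<close>; it is
  positive semidefinite as a Gram matrix.\<close>
definition outer_gram :: "nat set \<Rightarrow> (nat \<Rightarrow> nat \<Rightarrow> real) \<Rightarrow> nat \<Rightarrow> nat \<Rightarrow> real" where
  "outer_gram H U = (\<lambda>k m. \<Sum>h\<in>H. U k h * U m h)"

lemma pminor_orthogonal_conj:
  fixes Q :: "nat \<Rightarrow> nat \<Rightarrow> real poly"
  assumes U: "orthogonal_fun n U"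
  shows "pminor (\<lambda>i j. \<Sum>k<n. \<Sum>m<n. [:U k i:] * Q k m * [:U m j:]) {..<n} = pminor Q {..<n}"
proof -
  let ?U = "\<lambda>i j. [:U i j:]" and ?V = "\<lambda>i j. [:U j i:]"
  have "pminor (\<lambda>i j. \<Sum>k<n. ?V i k * ?U k j) {..<n} = pminor (\<lambda>i j. if i = j then 1 else 0) {..<n}"
  proof (rule pminor_cong)
    fix i j assume "i \<in> {..<n}" "j \<in> {..<n}"
    moreover have "(\<Sum>k<n. ?V i k * ?U k j) = [:\<Sum>k<n. U k i * U k j:]"
      by (simp add: mult.commute flip: sum_to_poly)
    ultimately show "(\<Sum>k<n. ?V i k * ?U k j) = (if i = j then 1 else 0)"
      using U by (simp add: orthogonal_fun_def flip: one_pCons)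
  qed
  also have "\<dots> = 1" using pminor_diag[of "{..<n}" "\<lambda>_. 1 :: real poly"] by simp
  finally have 1: "pminor ?V {..<n} * pminor ?U {..<n} = 1" by (simp only: pminor_mult)
  have "pminor (\<lambda>i j. \<Sum>k<n. \<Sum>m<n. ?U k i * Q k m * ?U m j) {..<n}
      = pminor (\<lambda>i j. \<Sum>m<n. (\<Sum>k<n. ?V i k * Q k m) * ?U m j) {..<n}"
    by (intro pminor_cong) (simp only: sum_distrib_right, rule sum.swap)
  also have "\<dots> = pminor ?V {..<n} * pminor Q {..<n} * pminor ?U {..<n}"
    by (simp only: pminor_mult)
  also have "\<dots> = (pminor ?V {..<n} * pminor ?U {..<n}) * pminor Q {..<n}" by (simp only: mult_ac)
  finally show ?thesis by (simp only: 1 mult_1)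
qed

lemma pminor_const: "pminor (\<lambda>i j. [:M i j:]) S = [:pminor M S:]"
proof -
  interpret comm_ring_hom "\<lambda>c :: 'a. [:c:]" by unfold_locales auto
  show ?thesis by (simp add: hom_pminor)
qed

lemma pminor_scale: "finite S \<Longrightarrow> pminor (\<lambda>i j. c * M i j) S = c ^ card S * pminor M S"
  by (simp add: pminor_def prod.distrib sum_distrib_left mult.left_commute)

text \<open>Let \<open>D\<close> be the diagonal projection onto the complement of \<open>J\<close>. Conjugation by \<open>U\<close> gives
  \<open>det (A + y D) = det (diag l + y W)\<close> with \<open>W = U D U\<^sup>T\<close>. The assertion compares the coefficients of
  \<open>y\<close> to the power \<open>n - card J\<close>, each computed by \<open>pminor_diag_add\<close>.\<close>
theorem pminor_spectral_form:
  assumes U: "orthogonal_fun n U" and J: "J \<subseteq> {..<n}"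
  shows "pminor (spectral_form n l U) J
    = (\<Sum>T | T \<subseteq> {..<n} \<and> card T = card J.
        pminor (outer_gram ({..<n} - J) U) ({..<n} - T) * (\<Prod>k\<in>T. l k))"
proof -
  let ?N = "{..<n}" and ?y = "[:0, 1 :: real:]" and ?A = "spectral_form n l U"
  define W where "W = outer_gram (?N - J) U"
  define r where "r = card (?N - J)"
  define P where "P = (\<lambda>i j. (if i = j then (if i \<in> J then 0 else ?y) else 0) + [:?A i j:])"
  define Q where "Q = (\<lambda>k m. (if k = m then [:l k:] else 0) + ?y * [:W k m:])"
  have conj: "(\<Sum>k<n. \<Sum>m<n. [:U k i:] * Q k m * [:U m j:]) = P i j" if ij: "i < n" "j < n" for i j
  proof -
    have "(\<Sum>k<n. \<Sum>m<n. [:U k i:] * Q k m * [:U m j:])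
        = (\<Sum>k<n. \<Sum>m<n. (if k = m then [:U k i * l k * U m j:] else 0) + ?y * [:U k i * W k m * U m j:])"
      by (intro sum.cong refl) (simp add: Q_def algebra_simps)
    also have "\<dots> = (\<Sum>k<n. [:l k * U k i * U k j:]) + ?y * (\<Sum>k<n. \<Sum>m<n. [:U k i * W k m * U m j:])"
      by (simp only: sum.distrib sum.delta' finite_lessThan sum_distrib_left)
        (simp add: mult.commute mult.left_commute)
    also have "(\<Sum>k<n. [:l k * U k i * U k j:]) = [:?A i j:]"
      by (simp add: spectral_form_def flip: sum_to_poly)
    also have "(\<Sum>k<n. \<Sum>m<n. [:U k i * W k m * U m j:]) = [:\<Sum>k<n. \<Sum>m<n. U k i * W k m * U m j:]"
      by (simp flip: sum_to_poly)
    also have "(\<Sum>k<n. \<Sum>m<n. U k i * W k m * U m j) = (if i = j \<and> i \<notin> J then 1 else 0)"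
    proof -
      have "(\<Sum>k<n. \<Sum>m<n. U k i * W k m * U m j)
          = (\<Sum>k<n. \<Sum>m<n. \<Sum>h\<in>?N - J. (U k i * U k h) * (U m h * U m j))"
        by (simp add: W_def outer_gram_def sum_distrib_left sum_distrib_right mult_ac)
      also have "\<dots> = (\<Sum>k<n. \<Sum>h\<in>?N - J. \<Sum>m<n. (U k i * U k h) * (U m h * U m j))"
        by (intro sum.cong refl sum.swap)
      also have "\<dots> = (\<Sum>h\<in>?N - J. \<Sum>k<n. \<Sum>m<n. (U k i * U k h) * (U m h * U m j))"
        by (rule sum.swap)
      also have "\<dots> = (\<Sum>h\<in>?N - J. (\<Sum>k<n. U k i * U k h) * (\<Sum>m<n. U m h * U m j))"
        by (simp only: sum_product)
      also have "\<dots> = (\<Sum>h\<in>?N - J. if h = i then (if i = j then 1 else 0) else 0)"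
        using U ij by (intro sum.cong) (auto simp: orthogonal_fun_def)
      also have "\<dots> = (if i = j \<and> i \<notin> J then 1 else 0)"
        using ij by simp
      finally show ?thesis .
    qed
    finally show ?thesis by (simp add: P_def)
  qed
  have eq: "pminor P ?N = pminor Q ?N"
    unfolding pminor_orthogonal_conj[OF U, of Q, symmetric]
    by (rule pminor_cong) (simp only: conj lessThan_iff)
  have finS: "finite S" if "S \<in> Pow ?N" for S using that finite_subset by auto
  have "coeff (pminor P ?N) r = (\<Sum>S\<in>Pow ?N. if S = J then pminor ?A S else 0)"
  proof -
    have "pminor P ?N = (\<Sum>S\<in>Pow ?N. (\<Prod>i\<in>?N - S. if i \<in> J then 0 else ?y) * [:pminor ?A S:])"
      unfolding P_def by (subst pminor_diag_add) (simp_all add: pminor_const)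
    moreover have "coeff ((\<Prod>i\<in>?N - S. if i \<in> J then 0 else ?y) * [:pminor ?A S:]) r
        = (if S = J then pminor ?A S else 0)" if S: "S \<in> Pow ?N" for S
    proof (cases "J \<subseteq> S")
      case True
      then have "(\<Prod>i\<in>?N - S. if i \<in> J then 0 else ?y) = (\<Prod>i\<in>?N - S. ?y)"
        by (intro prod.cong) auto
      also have "\<dots> = monom 1 (card (?N - S))" by (simp add: monom_altdef)
      finally have "coeff ((\<Prod>i\<in>?N - S. if i \<in> J then 0 else ?y) * [:pminor ?A S:]) r
          = (if card (?N - S) = r then pminor ?A S else 0)" by simp
      moreover have "card (?N - S) = r \<longleftrightarrow> S = J"
      proof
        assume c: "card (?N - S) = r"
        have "?N - S = ?N - J" using True c by (intro card_subset_eq) (auto simp: r_def)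
        then show "S = J" using S J by blast
      qed (simp add: r_def)
      ultimately show ?thesis by simp
    next
      case False
      then have "\<exists>i\<in>?N - S. (if i \<in> J then 0 else ?y) = 0" using J by auto
      then have p0: "(\<Prod>i\<in>?N - S. if i \<in> J then 0 else ?y) = 0"
        by (intro prod_zero) simp_all
      have "S \<noteq> J" using False by auto
      then show ?thesis by (simp only: p0 mult_zero_left coeff_0 if_False)
    qed
    ultimately show ?thesis by (simp add: coeff_sum)
  qed
  also have "\<dots> = pminor ?A J" using J by simp
  finally have L: "coeff (pminor P ?N) r = pminor ?A J" .
  have "coeff (pminor Q ?N) r = (\<Sum>S\<in>Pow ?N. if card S = r then pminor W S * (\<Prod>k\<in>?N - S. l k) else 0)"
  proof -
    have "pminor Q ?N = (\<Sum>S\<in>Pow ?N. (\<Prod>k\<in>?N - S. [:l k:]) * pminor (\<lambda>k m. ?y * [:W k m:]) S)"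
      unfolding Q_def by (rule pminor_diag_add) simp
    moreover have "coeff ((\<Prod>k\<in>?N - S. [:l k:]) * pminor (\<lambda>k m. ?y * [:W k m:]) S) r
        = (if card S = r then pminor W S * (\<Prod>k\<in>?N - S. l k) else 0)" if S: "S \<in> Pow ?N" for S
    proof -
      have "(\<Prod>k\<in>?N - S. [:l k:]) * pminor (\<lambda>k m. ?y * [:W k m:]) S
          = monom (pminor W S * (\<Prod>k\<in>?N - S. l k)) (card S)"
        by (simp only: pminor_scale[OF finS[OF S]] pminor_const prod_to_poly monom_altdef
            flip: smult_conv_map_poly) (simp add: mult_ac)
      then show ?thesis by simp
    qed
    ultimately show ?thesis by (simp add: coeff_sum)
  qed
  also have "\<dots> = (\<Sum>T\<in>Pow ?N. if card (?N - T) = r then pminor W (?N - T) * (\<Prod>k\<in>T. l k) else 0)"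
    by (rule sum.reindex_bij_witness[of _ "\<lambda>T. ?N - T" "\<lambda>S. ?N - S"]) (auto simp: double_diff)
  also have "\<dots> = (\<Sum>T | T \<subseteq> ?N \<and> card T = card J. pminor W (?N - T) * (\<Prod>k\<in>T. l k))"
  proof -
    have "card (?N - T) = r \<longleftrightarrow> card T = card J" if "T \<in> Pow ?N" for T
      using that J card_mono[of ?N T] card_mono[of ?N J] finite_subset[of _ ?N]
      by (auto simp: r_def card_Diff_subset)
    then show ?thesis by (intro sum.mono_neutral_cong_right) auto
  qed
  finally show ?thesis using L eq by (simp add: W_def)
qed

lemma pminor_spectral_form_full:
  assumes U: "orthogonal_fun n U"
  shows "pminor (spectral_form n l U) {..<n} = (\<Prod>k<n. l k)"
proof -
  have "{T. T \<subseteq> {..<n} \<and> card T = card {..<n}} = {{..<n}}"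
    using card_subset_eq[of "{..<n}"] by auto
  then show ?thesis by (subst pminor_spectral_form[OF U order_refl]) (simp only:, simp)
qed

lemma outer_gram_masked_form_nonneg:
  assumes "finite H"
  shows "(\<Sum>i<n. \<Sum>j<n. v i * (if i \<in> S \<and> j \<in> S then outer_gram H U i j else if i = j then 1 else 0) * v j) \<ge> (0::real)"
proof -
  define u where "u = (\<lambda>i. if i \<in> S then v i else 0)"
  have "(\<Sum>i<n. \<Sum>j<n. v i * (if i \<in> S \<and> j \<in> S then outer_gram H U i j else if i = j then 1 else 0) * v j)
      = (\<Sum>i<n. \<Sum>j<n. (\<Sum>h\<in>H. (u i * U i h) * (u j * U j h)) + (if i = j then (if i \<in> S then 0 else v i * v i) else 0))"
    by (intro sum.cong refl)
      (auto simp: u_def outer_gram_def sum_distrib_left sum_distrib_right mult_ac)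
  also have "\<dots> = (\<Sum>i<n. \<Sum>j<n. \<Sum>h\<in>H. (u i * U i h) * (u j * U j h)) + (\<Sum>i<n. if i \<in> S then 0 else v i * v i)"
    by (simp only: sum.distrib sum.delta' finite_lessThan) simp
  also have "(\<Sum>i<n. \<Sum>j<n. \<Sum>h\<in>H. (u i * U i h) * (u j * U j h))
      = (\<Sum>i<n. \<Sum>h\<in>H. \<Sum>j<n. (u i * U i h) * (u j * U j h))"
    by (intro sum.cong refl sum.swap)
  also have "\<dots> = (\<Sum>h\<in>H. \<Sum>i<n. \<Sum>j<n. (u i * U i h) * (u j * U j h))" by (rule sum.swap)
  also have "\<dots> = (\<Sum>h\<in>H. (\<Sum>i<n. u i * U i h) * (\<Sum>i<n. u i * U i h))" by (simp only: sum_product)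
  also have "\<dots> + (\<Sum>i<n. if i \<in> S then 0 else v i * v i) \<ge> 0"
    by (intro add_nonneg_nonneg sum_nonneg) auto
  finally show ?thesis .
qed

text \<open>A principal minor of a positive semidefinite matrix is the product of nonnegative eigenvalues.\<close>
lemma outer_gram_pminor_nonneg:
  assumes H: "finite H" and S: "S \<subseteq> {..<n}"
  shows "pminor (outer_gram H U) S \<ge> 0"
proof -
  define X where "X = mat n n (\<lambda>(i, j). if i \<in> S \<and> j \<in> S then outer_gram H U i j else if i = j then 1 else 0)"
  have "transpose_mat X = X"
    by (rule eq_matI) (auto simp: X_def outer_gram_def mult.commute)
  then have X: "X \<in> sym_mats n" by (simp add: sym_mats_def X_def)
  obtain l where l: "eigenvalue_vector X l" using eigenvalue_vector_exists[OF X] by blast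
  obtain V where V: "orthogonal_fun n V"
    "\<And>i j. i < n \<Longrightarrow> j < n \<Longrightarrow> X $$ (i, j) = (\<Sum>k<n. vec_index l k * V k i * V k j)"
    using spectral_decomposition[OF X l] by blast
  have "pminor (outer_gram H U) S = pminor (\<lambda>i j. if j \<in> S then outer_gram H U i j else 0) S"
    by (intro pminor_cong) auto
  also have "\<dots> = pminor (\<lambda>i j. if i \<in> S then (if j \<in> S then outer_gram H U i j else 0) else if i = j then 1 else 0) {..<n}"
    using S by (intro pminor_masked) auto
  also have "\<dots> = pminor (spectral_form n (vec_index l) V) {..<n}"
    by (intro pminor_cong) (auto simp: spectral_form_def V(2)[symmetric] X_def)
  also have "\<dots> = (\<Prod>k<n. vec_index l k)" by (rule pminor_spectral_form_full[OF V(1)])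
  also have "\<dots> \<ge> 0"
  proof (rule prod_nonneg)
    fix k assume "k \<in> {..<n}"
    then have k: "k < n" by simp
    have "(\<Sum>i<n. \<Sum>j<n. V k i * X $$ (i, j) * V k j)
        = (\<Sum>i<n. \<Sum>j<n. \<Sum>m<n. vec_index l m * ((V k i * V m i) * (V k j * V m j)))"
      by (intro sum.cong refl) (simp add: V(2) sum_distrib_left sum_distrib_right mult_ac)
    also have "\<dots> = (\<Sum>i<n. \<Sum>m<n. \<Sum>j<n. vec_index l m * ((V k i * V m i) * (V k j * V m j)))"
      by (intro sum.cong refl sum.swap)
    also have "\<dots> = (\<Sum>m<n. \<Sum>i<n. \<Sum>j<n. vec_index l m * ((V k i * V m i) * (V k j * V m j)))"
      by (rule sum.swap)
    also have "\<dots> = (\<Sum>m<n. vec_index l m * ((\<Sum>i<n. V k i * V m i) * (\<Sum>j<n. V k j * V m j)))"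
      by (intro sum.cong refl) (simp only: sum_product, simp only: sum_distrib_left)
    also have "\<dots> = (\<Sum>m<n. if m = k then vec_index l m else 0)"
      using V(1) k by (intro sum.cong) (auto simp: orthogonal_fun_def)
    also have "\<dots> = vec_index l k" using k by simp
    finally have "vec_index l k = (\<Sum>i<n. \<Sum>j<n. V k i * X $$ (i, j) * V k j)" by simp
    also have "\<dots> = (\<Sum>i<n. \<Sum>j<n. V k i * (if i \<in> S \<and> j \<in> S then outer_gram H U i j else if i = j then 1 else 0) * V k j)"
      by (intro sum.cong) (auto simp: X_def)
    also have "\<dots> \<ge> 0" by (rule outer_gram_masked_form_nonneg[OF H])
    finally show "vec_index l k \<ge> 0" .
  qed
  finally show ?thesis .
qed

definition elem_sum :: "nat \<Rightarrow> nat set \<Rightarrow> (nat \<Rightarrow> real) \<Rightarrow> real" where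
  "elem_sum d K x = (\<Sum>L | L \<subseteq> K \<and> card L = d. \<Prod>i\<in>L. x i)"

lemma coeff_sum_Pow_monom:
  assumes "finite K" "d \<le> card K"
  shows "coeff (\<Sum>J\<in>Pow K. monom (f J) (card K - card J)) (card K - d)
    = (\<Sum>J | J \<subseteq> K \<and> card J = d. f J)"
proof -
  have "coeff (\<Sum>J\<in>Pow K. monom (f J) (card K - card J)) (card K - d)
      = (\<Sum>J\<in>Pow K. if card J = d then f J else 0)"
    unfolding coeff_sum
  proof (intro sum.cong refl)
    fix J assume "J \<in> Pow K"
    then have "card J \<le> card K" using assms(1) by (simp add: card_mono)
    then show "coeff (monom (f J) (card K - card J)) (card K - d) = (if card J = d then f J else 0)"
      using assms(2) by auto
  qed
  also have "\<dots> = (\<Sum>J | J \<subseteq> K \<and> card J = d. f J)"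
    using assms(1) by (intro sum.mono_neutral_cong_right) auto
  finally show ?thesis .
qed

text \<open>The case \<open>J = K\<close> of \<open>pminor_spectral_form\<close>, applied to \<open>A + sI\<close> for all \<open>s\<close>: comparing coefficients of \<open>s\<close> turns the full minor
  on \<open>K\<close> into the sum of its principal \<open>d\<close>-minors, and \<open>\<Prod>k\<in>T. l k + s\<close> into \<open>e\<^sub>d(l\<^sub>T)\<close>. The weights
  sum to one by taking \<open>A = I\<close>.\<close>
theorem principal_minor_sums_mixture:
  assumes U: "orthogonal_fun n U" and K: "K \<subseteq> {..<n}" and d: "d \<le> card K"
  defines "w \<equiv> \<lambda>T. pminor (outer_gram ({..<n} - K) U) ({..<n} - T)"
  shows "(\<Sum>J | J \<subseteq> K \<and> card J = d. pminor (spectral_form n l U) J)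
      = (\<Sum>T | T \<subseteq> {..<n} \<and> card T = card K. w T * elem_sum d T l)" (is ?mix)
    and "(\<Sum>T | T \<subseteq> {..<n} \<and> card T = card K. w T) = 1" (is ?one)
    and "\<And>T. w T \<ge> 0"
proof -
  let ?Ts = "{T. T \<subseteq> {..<n} \<and> card T = card K}"
  have finK: "finite K" using K finite_subset by blast
  have finTs: "finite ?Ts" by (rule finite_subset[of _ "Pow {..<n}"]) auto
  define PL where "PL = (\<Sum>J\<in>Pow K. monom (pminor (spectral_form n l U) J) (card K - card J))"
  define PR where "PR = (\<Sum>T\<in>?Ts. Polynomial.smult (w T) (\<Sum>L\<in>Pow T. monom (\<Prod>i\<in>L. l i) (card T - card L)))"
  have "poly PL s = poly PR s" for s
  proof -
    have "poly PL s = (\<Sum>J\<in>Pow K. (\<Prod>i\<in>K - J. s) * pminor (spectral_form n l U) J)"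
      unfolding PL_def poly_sum
      by (intro sum.cong refl) (use finK in \<open>auto simp: poly_monom card_Diff_subset[OF finite_subset]\<close>)
    also have "\<dots> = pminor (\<lambda>i j. (if i = j then s else 0) + spectral_form n l U i j) K"
      by (rule pminor_diag_add[OF finK, symmetric])
    also have "\<dots> = pminor (spectral_form n (\<lambda>k. l k + s) U) K"
    proof (rule pminor_cong)
      fix i j assume "i \<in> K" "j \<in> K"
      then have "i < n" "j < n" using K by auto
      from shift_diag_spectral_form[OF U this, of l s]
      show "(if i = j then s else 0) + spectral_form n l U i j = spectral_form n (\<lambda>k. l k + s) U i j"
        by (simp add: shift_diag_def add.commute)
    qed
    also have "\<dots> = (\<Sum>T\<in>?Ts. w T * (\<Prod>k\<in>T. l k + s))"
      unfolding w_def by (rule pminor_spectral_form[OF U K])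
    also have "\<dots> = poly PR s"
      unfolding PR_def poly_sum Polynomial.poly_smult
    proof (intro sum.cong refl arg_cong2[where f = "(*)"])
      fix T assume "T \<in> ?Ts"
      then have finT: "finite T" using finite_subset by blast
      have "(\<Prod>k\<in>T. l k + s) = (\<Sum>L\<in>Pow T. (\<Prod>k\<in>L. l k) * (\<Prod>k\<in>T - L. s))"
        by (rule prod_add[OF finT])
      also have "\<dots> = (\<Sum>L\<in>Pow T. poly (monom (\<Prod>i\<in>L. l i) (card T - card L)) s)"
        by (intro sum.cong refl) (use finT in \<open>auto simp: poly_monom card_Diff_subset[OF finite_subset]\<close>)
      finally show "(\<Prod>k\<in>T. l k + s) = (\<Sum>L\<in>Pow T. poly (monom (\<Prod>i\<in>L. l i) (card T - card L)) s)" .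
    qed
    finally show ?thesis .
  qed
  then have "PL = PR" by (simp add: poly_eq_poly_eq_iff[symmetric] fun_eq_iff)
  moreover have "coeff PL (card K - d) = (\<Sum>J | J \<subseteq> K \<and> card J = d. pminor (spectral_form n l U) J)"
    unfolding PL_def by (rule coeff_sum_Pow_monom[OF finK d])
  moreover have "coeff PR (card K - d) = (\<Sum>T\<in>?Ts. w T * elem_sum d T l)"
    unfolding PR_def coeff_sum[of _ ?Ts] Polynomial.coeff_smult
  proof (intro sum.cong refl arg_cong2[where f = "(*)"])
    fix T assume T: "T \<in> ?Ts"
    then have "finite T" "d \<le> card T" using finite_subset d by auto
    from coeff_sum_Pow_monom[OF this, of "\<lambda>L. \<Prod>i\<in>L. l i"]
    show "coeff (\<Sum>L\<in>Pow T. monom (\<Prod>i\<in>L. l i) (card T - card L)) (card K - d) = elem_sum d T l"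
      using T by (simp add: elem_sum_def)
  qed
  ultimately show ?mix by simp
  have "1 = pminor (\<lambda>i j. if i = j then 1 else 0 :: real) K"
    using pminor_diag[OF finK, of "\<lambda>_. 1 :: real"] by simp
  also have "\<dots> = pminor (spectral_form n (\<lambda>_. 1) U) K"
  proof (rule pminor_cong)
    fix i j assume "i \<in> K" "j \<in> K"
    then have "i < n" "j < n" using K by auto
    then show "(if i = j then 1 else 0) = spectral_form n (\<lambda>_. 1) U i j"
      using U by (simp add: spectral_form_def orthogonal_fun_def)
  qed
  also have "\<dots> = (\<Sum>T\<in>?Ts. w T)"
    using pminor_spectral_form[OF U K, of "\<lambda>_. 1"] by (simp add: w_def)
  finally show ?one by simp
  show "w T \<ge> 0" for T unfolding w_def by (rule outer_gram_pminor_nonneg[of _ _ n]) auto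
qed

lemma convex_combination_le_some:
  fixes f w :: "'a \<Rightarrow> real"
  assumes "finite S" "\<And>i. i \<in> S \<Longrightarrow> w i \<ge> 0" "sum w S = 1"
  shows "\<exists>i\<in>S. (\<Sum>i\<in>S. w i * f i) \<le> f i"
proof (rule ccontr)
  assume "\<not> ?thesis"
  then have less: "\<And>i. i \<in> S \<Longrightarrow> f i < (\<Sum>i\<in>S. w i * f i)" by force
  have "\<exists>i\<in>S. w i > 0"
  proof (rule ccontr)
    assume "\<not> (\<exists>i\<in>S. w i > 0)"
    then have "sum w S \<le> 0" by (intro sum_nonpos) force
    then show False using assms(3) by simp
  qed
  then have "\<exists>i\<in>S. w i * f i < w i * (\<Sum>i\<in>S. w i * f i)"
    using less by (auto intro: mult_strict_left_mono)
  then have "(\<Sum>i\<in>S. w i * f i) < (\<Sum>i\<in>S. w i * (\<Sum>i\<in>S. w i * f i))"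
    using assms(1,2) less
    by (intro sum_strict_mono_ex1 ballI mult_left_mono) (simp_all add: less_imp_le)
  also have "\<dots> = (\<Sum>i\<in>S. w i * f i)" by (simp only: sum_distrib_right[symmetric] assms(3) mult_1)
  finally show False by simp
qed

section \<open>Rearrangement\<close>

lemma sorting_permutation:
  fixes f :: "nat \<Rightarrow> real"
  obtains \<pi> where "\<pi> permutes {..<n}" "\<And>i j. i \<le> j \<Longrightarrow> j < n \<Longrightarrow> f (\<pi> i) \<le> f (\<pi> j)"
proof -
  define xs where "xs = map f [0..<n]"
  have "mset (sort xs) = mset xs" by simp
  from mset_eq_permutation[OF this] obtain p where
    p: "p permutes {..<length xs}" "permute_list p xs = sort xs" .
  show thesis
  proof (rule that[of p])
    show "p permutes {..<n}" using p(1) by (simp add: xs_def)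
    fix i j assume ij: "i \<le> j" "j < n"
    have nth: "sort xs ! i = f (p i)" if "i < n" for i
      using permute_list_nth[OF p(1), of i] p(2) that permutes_in_image[OF p(1), of i]
      by (simp add: xs_def)
    have "sort xs ! i \<le> sort xs ! j" by (rule sorted_nth_mono) (use ij in \<open>auto simp: xs_def\<close>)
    then show "f (p i) \<le> f (p j)" using nth ij by simp
  qed
qed

lemma Abel_summation_nonneg:
  fixes a d :: "nat \<Rightarrow> real"
  assumes mono: "\<And>i j. i \<le> j \<Longrightarrow> j < n \<Longrightarrow> a i \<le> a j"
    and tails: "\<And>r. r < n \<Longrightarrow> (\<Sum>i=r..<n. d i) \<ge> 0" and total: "(\<Sum>i<n. d i) = 0"
  shows "(\<Sum>i<n. a i * d i) \<ge> 0"
proof (cases "n = 0")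
  case False
  have "(\<Sum>i=r..<n. a i * d i) \<ge> a r * (\<Sum>i=r..<n. d i)" if "r < n" for r
    using that
  proof (induction "n - r" arbitrary: r)
    case (Suc m)
    have split: "(\<Sum>i=r..<n. f i) = f r + (\<Sum>i=Suc r..<n. f i)" for f :: "nat \<Rightarrow> real"
      using Suc.prems by (simp add: sum.atLeast_Suc_lessThan)
    show ?case
    proof (cases "Suc r < n")
      case True
      have "a r * (\<Sum>i=Suc r..<n. d i) \<le> a (Suc r) * (\<Sum>i=Suc r..<n. d i)"
        using mono[of r "Suc r"] tails[OF True] True by (intro mult_right_mono) auto
      also have "\<dots> \<le> (\<Sum>i=Suc r..<n. a i * d i)"
        using Suc.hyps(1)[of "Suc r"] Suc.hyps(2) True by simp
      finally show ?thesis by (simp add: split distrib_left)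
    next
      case False
      then have "n = Suc r" using Suc.prems by simp
      then show ?thesis by simp
    qed
  qed simp
  from this[of 0] show ?thesis using False total by (simp add: atLeast0LessThan)
qed simp

lemma permuted_sum:
  assumes "\<pi> permutes {..<n::nat}"
  shows "(\<Sum>i<n. f (\<pi> i)) = (\<Sum>i<n. f i :: 'a :: comm_monoid_add)"
  by (rule sum.reindex_bij_betw[OF permutes_imp_bij[OF assms]])

text \<open>After sorting \<open>a\<close> and \<open>c\<close>, averaging \<open>c\<close> with a doubly stochastic matrix decreases every tail
  sum, because the weights with which a tail uses the entries of \<open>c\<close> are at most one. Abel summation against the
  increasing sequence \<open>a\<close> shows that pairing both sequences in sorted order is best.\<close>
theorem doubly_stochastic_le_permutation:
  fixes D :: "nat \<Rightarrow> nat \<Rightarrow> real" and a c :: "nat \<Rightarrow> real"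
  assumes D: "\<And>i k. D i k \<ge> 0"
    and row: "\<And>i. i < n \<Longrightarrow> (\<Sum>k<n. D i k) = 1"
    and col: "\<And>k. k < n \<Longrightarrow> (\<Sum>i<n. D i k) = 1"
  shows "\<exists>\<sigma>. \<sigma> permutes {..<n} \<and> (\<Sum>i<n. \<Sum>k<n. a i * D i k * c k) \<le> (\<Sum>i<n. a i * c (\<sigma> i))"
proof -
  obtain \<pi> where \<pi>: "\<pi> permutes {..<n}" "\<And>i j. i \<le> j \<Longrightarrow> j < n \<Longrightarrow> a (\<pi> i) \<le> a (\<pi> j)"
    using sorting_permutation[of n a] by blast
  obtain \<rho> where \<rho>: "\<rho> permutes {..<n}" "\<And>i j. i \<le> j \<Longrightarrow> j < n \<Longrightarrow> c (\<rho> i) \<le> c (\<rho> j)"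
    using sorting_permutation[of n c] by blast
  define E where "E = (\<lambda>i k. D (\<pi> i) (\<rho> k))"
  have Erow: "(\<Sum>k<n. E i k) = 1" if "i < n" for i
    using permuted_sum[OF \<rho>(1), of "D (\<pi> i)"] row[of "\<pi> i"] permutes_in_image[OF \<pi>(1), of i] that
    by (simp add: E_def)
  have Ecol: "(\<Sum>i<n. E i k) = 1" if "k < n" for k
    using permuted_sum[OF \<pi>(1), of "\<lambda>i. D i (\<rho> k)"] col[of "\<rho> k"] permutes_in_image[OF \<rho>(1), of k] that
    by (simp add: E_def)
  define b where "b = (\<lambda>i. \<Sum>k<n. E i k * c (\<rho> k))"
  have tail: "(\<Sum>i=r..<n. c (\<rho> i) - b i) \<ge> 0" if r: "r < n" for r
  proof -
    define w where "w = (\<lambda>k. \<Sum>i=r..<n. E i k)"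
    have w: "0 \<le> w k" "k < n \<Longrightarrow> w k \<le> 1" for k
    proof -
      show "0 \<le> w k" using D by (auto simp: w_def E_def intro: sum_nonneg)
      assume "k < n"
      have "w k \<le> (\<Sum>i<n. E i k)" unfolding w_def
        using D by (intro sum_mono2) (auto simp: E_def)
      then show "w k \<le> 1" using Ecol[OF \<open>k < n\<close>] by simp
    qed
    have sumw: "(\<Sum>k<n. w k) = of_nat (n - r)"
    proof -
      have "(\<Sum>k<n. w k) = (\<Sum>i=r..<n. \<Sum>k<n. E i k)" unfolding w_def by (rule sum.swap)
      also have "\<dots> = (\<Sum>i=r..<n. 1)" by (intro sum.cong) (auto simp: Erow)
      finally show ?thesis by simp
    qed
    define ind where "ind = (\<lambda>k. if r \<le> k then 1 else 0 :: real)"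
    have sumind: "(\<Sum>k<n. ind k * f k) = (\<Sum>k=r..<n. f k)" for f :: "nat \<Rightarrow> real"
      unfolding ind_def by (intro sum.mono_neutral_cong_right) auto
    have "(\<Sum>i=r..<n. b i) = (\<Sum>k<n. \<Sum>i=r..<n. E i k * c (\<rho> k))"
      unfolding b_def by (rule sum.swap)
    then have "(\<Sum>i=r..<n. c (\<rho> i) - b i) = (\<Sum>k<n. (ind k - w k) * c (\<rho> k))"
      by (simp add: sum_subtractf sumind w_def sum_distrib_right left_diff_distrib)
    also have "\<dots> = (\<Sum>k<n. (ind k - w k) * (c (\<rho> k) - c (\<rho> r))) + (\<Sum>k<n. ind k - w k) * c (\<rho> r)"
      by (simp only: sum_distrib_right sum.distrib[symmetric] right_diff_distrib) simp
    also have "(\<Sum>k<n. ind k - w k) = 0"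
      using sumind[of "\<lambda>_. 1"] sumw r by (simp add: sum_subtractf)
    also have "(\<Sum>k<n. (ind k - w k) * (c (\<rho> k) - c (\<rho> r))) + 0 * c (\<rho> r) \<ge> 0"
    proof -
      have "(ind k - w k) * (c (\<rho> k) - c (\<rho> r)) \<ge> 0" if "k < n" for k
      proof (cases "r \<le> k")
        case True
        then show ?thesis using w(2)[OF that] \<rho>(2)[OF True that] by (simp add: ind_def)
      next
        case False
        then show ?thesis using w(1)[of k] \<rho>(2)[of k r] r
          by (simp add: ind_def mult_nonpos_nonpos mult_nonneg_nonpos)
      qed
      then have "(\<Sum>k<n. (ind k - w k) * (c (\<rho> k) - c (\<rho> r))) \<ge> 0"
        by (intro sum_nonneg) simp
      then show ?thesis by simp
    qed
    finally show ?thesis .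
  qed
  have total: "(\<Sum>i<n. c (\<rho> i) - b i) = 0"
  proof -
    have "(\<Sum>i<n. b i) = (\<Sum>k<n. \<Sum>i<n. E i k * c (\<rho> k))" unfolding b_def by (rule sum.swap)
    also have "\<dots> = (\<Sum>k<n. c (\<rho> k))" by (intro sum.cong) (auto simp: Ecol simp flip: sum_distrib_right)
    finally show ?thesis by (simp add: sum_subtractf)
  qed
  have "(\<Sum>i<n. a (\<pi> i) * (c (\<rho> i) - b i)) \<ge> 0"
    by (rule Abel_summation_nonneg[OF \<pi>(2) tail total])
  then have le: "(\<Sum>i<n. a (\<pi> i) * b i) \<le> (\<Sum>i<n. a (\<pi> i) * c (\<rho> i))"
    by (simp add: right_diff_distrib sum_subtractf)
  define \<sigma> where "\<sigma> = \<rho> \<circ> inv_into UNIV \<pi>"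
  have inv: "inv_into UNIV \<pi> permutes {..<n}" by (rule permutes_inv[OF \<pi>(1)])
  have "(\<Sum>i<n. \<Sum>k<n. a i * D i k * c k) = (\<Sum>i<n. \<Sum>k<n. a (\<pi> i) * D (\<pi> i) k * c k)"
    by (rule permuted_sum[OF \<pi>(1), symmetric])
  also have "\<dots> = (\<Sum>i<n. \<Sum>k<n. a (\<pi> i) * D (\<pi> i) (\<rho> k) * c (\<rho> k))"
    by (intro sum.cong refl permuted_sum[OF \<rho>(1), symmetric])
  also have "\<dots> = (\<Sum>i<n. a (\<pi> i) * b i)" by (simp add: b_def E_def sum_distrib_left mult.assoc)
  also have "\<dots> \<le> (\<Sum>i<n. a (\<pi> i) * c (\<rho> i))" by (rule le)
  also have "\<dots> = (\<Sum>i<n. a (\<pi> i) * c (\<sigma> (\<pi> i)))"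
    using permutes_inverses(2)[OF \<pi>(1)] by (simp add: \<sigma>_def)
  also have "\<dots> = (\<Sum>i<n. a i * c (\<sigma> i))" by (rule permuted_sum[OF \<pi>(1)])
  finally show ?thesis using permutes_compose[OF inv \<rho>(1)] unfolding \<sigma>_def by blast
qed

lemma spectral_mixture_le_permutation:
  assumes U: "orthogonal_fun n U"
  shows "\<exists>\<sigma>. \<sigma> permutes {..<n} \<and>
    (\<Sum>i<n. a i * (\<Sum>k<n. c k * (U k i * U k i))) \<le> (\<Sum>i<n. a i * c (\<sigma> i))"
proof -
  have "\<exists>\<sigma>. \<sigma> permutes {..<n} \<and>
      (\<Sum>i<n. \<Sum>k<n. a i * (U k i * U k i) * c k) \<le> (\<Sum>i<n. a i * c (\<sigma> i))"
    using U by (intro doubly_stochastic_le_permutation) (auto simp: orthogonal_fun_def)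
  then show ?thesis by (simp add: sum_distrib_left mult_ac)
qed

section \<open>Polynomials of degree one and of degree \<open>n - 1\<close>\<close>

text \<open>Spectral containment with the symmetric matrices already diagonalized. The condition is
  insensitive to the sign of \<open>a\<close>, which allows the normalization \<open>p(\<one>) > 0\<close>.\<close>
definition contains_spectra :: "nat \<Rightarrow> (nat set \<Rightarrow> real) \<Rightarrow> bool" where
  "contains_spectra n a \<longleftrightarrow> (\<forall>l U. orthogonal_fun n U \<longrightarrow>
     (\<forall>s>0. mlift n a (shift_diag (spectral_form n l U) s) \<noteq> 0) \<longrightarrow>
     (\<exists>\<sigma>. \<sigma> permutes {..<n} \<and> (\<forall>s>0. maff n a (\<lambda>i. l (\<sigma> i) + s) \<noteq> 0)))"

lemma maff_uminus: "maff n (\<lambda>J. - a J) x = - maff n a x"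
  by (simp add: maff_def sum_negf)

lemma mlift_uminus: "mlift n (\<lambda>J. - a J) M = - mlift n a M"
  by (simp add: mlift_def sum_negf)

text \<open>By homogeneity the value at \<open>\<one>\<close> differs from the value at \<open>(\<i>, \<dots>, \<i>)\<close> by the factor \<open>\<i>\<^sup>d\<close>.\<close>
lemma stable_homog_at_ones:
  assumes "stable_coefs n a" "homog_coefs n d a"
  shows "maff n a (\<lambda>_. 1) \<noteq> 0"
proof
  assume 0: "maff n a (\<lambda>_. 1) = 0"
  have "maff n (\<lambda>J. complex_of_real (a J)) (\<lambda>_. \<i> * 1) = \<i> ^ d * maff n (\<lambda>J. complex_of_real (a J)) (\<lambda>_. 1)"
    using assms(2) by (intro maff_scale) (auto simp: homog_coefs_def)
  also have "maff n (\<lambda>J. complex_of_real (a J)) (\<lambda>_. 1) = of_real (maff n a (\<lambda>_. 1))"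
    by (simp add: of_real_hom.hom_maff)
  finally show False using assms(1) 0 by (simp add: stable_coefs_def)
qed

lemma spectral_containment_normalized:
  assumes "homog_coefs n d a" "stable_coefs n a"
    and "\<And>b. b = a \<or> b = (\<lambda>J. - a J) \<Longrightarrow> homog_coefs n d b \<Longrightarrow> maff n b (\<lambda>_. 1) > 0 \<Longrightarrow> contains_spectra n b"
  shows "spectral_containment n (multiaffine_poly n a)"
proof (rule spectral_containmentI[OF assms(1,2)])
  have "contains_spectra n a"
  proof (cases "maff n a (\<lambda>_. 1) > 0")
    case True
    then show ?thesis using assms by blast
  next
    case False
    then have "maff n (\<lambda>J. - a J) (\<lambda>_. 1) > 0"
      using stable_homog_at_ones[OF assms(2,1)] by (simp add: maff_uminus)
    moreover have "homog_coefs n d (\<lambda>J. - a J)" using assms(1) by (simp add: homog_coefs_def)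
    ultimately have "contains_spectra n (\<lambda>J. - a J)" using assms(3) by blast
    then show ?thesis by (simp add: contains_spectra_def maff_uminus mlift_uminus)
  qed
  then show "\<exists>\<sigma>. \<sigma> permutes {..<n} \<and> (\<forall>s>0. maff n a (\<lambda>i. l (\<sigma> i) + s) \<noteq> 0)"
    if "orthogonal_fun n U" "\<And>s. s > 0 \<Longrightarrow> mlift n a (shift_diag (spectral_form n l U) s) \<noteq> 0" for l U
    using that unfolding contains_spectra_def by blast
qed

lemma sum_homog_one:
  fixes f :: "nat set \<Rightarrow> real"
  assumes "homog_coefs n 1 a"
  shows "(\<Sum>J\<in>Pow {..<n}. a J * f J) = (\<Sum>i<n. a {i} * f {i})"
proof -
  have "(\<Sum>J\<in>Pow {..<n}. a J * f J) = (\<Sum>J\<in>(\<lambda>i. {i}) ` {..<n}. a J * f J)"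
  proof (rule sum.mono_neutral_right)
    show "\<forall>J\<in>Pow {..<n} - (\<lambda>i. {i}) ` {..<n}. a J * f J = 0"
    proof
      fix J assume J: "J \<in> Pow {..<n} - (\<lambda>i. {i}) ` {..<n}"
      then have "card J \<noteq> 1" by (auto simp: card_1_singleton_iff)
      then show "a J * f J = 0" using assms J by (auto simp: homog_coefs_def)
    qed
  qed auto
  then show ?thesis by (simp add: sum.reindex)
qed

text \<open>All \<open>f\<^sub>\<sigma>\<close> are affine with the same positive slope, so they are nonpositive at the smallest of their roots.
  The diagonal entries of \<open>A\<close> are averages of the eigenvalues with the doubly stochastic weights \<open>(U k i)\<^sup>2\<close>.\<close>
lemma linear_contains_spectra:
  assumes homog: "homog_coefs n 1 a" and pos: "maff n a (\<lambda>_. 1) > 0"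
  shows "contains_spectra n a"
  unfolding contains_spectra_def
proof (intro allI impI)
  fix l U assume U: "orthogonal_fun n U"
    and nz: "\<forall>s>0. mlift n a (shift_diag (spectral_form n l U) s) \<noteq> 0"
  have maff: "maff n a x = (\<Sum>i<n. a {i} * x i)" for x
    unfolding maff_def using sum_homog_one[OF homog, of "\<lambda>J. \<Prod>i\<in>J. x i"] by simp
  have mlift: "mlift n a M = (\<Sum>i<n. a {i} * M i i)" for M
    unfolding mlift_def using sum_homog_one[OF homog, of "pminor M"] by simp
  let ?S = "{\<sigma>. \<sigma> permutes {..<n}}"
  have "\<exists>\<sigma>\<in>?S. \<forall>s>0. maff n a (\<lambda>i. l (\<sigma> i) + s) \<noteq> 0"
  proof (rule containment_of_family[OF homog pos])
    show "mlift n a (shift_diag (spectral_form n l U) s) \<noteq> 0" if "s > 0" for s using nz that by blast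
    show "\<exists>\<sigma>\<in>?S. mlift n a (shift_diag (spectral_form n l U) s) \<le> maff n a (\<lambda>i. l (\<sigma> i) + s)" if "s > 0" for s
      using spectral_mixture_le_permutation[OF U, of "\<lambda>i. a {i}" "\<lambda>k. l k + s"]
      unfolding mlift_shift_diag_spectral_form[OF U] mlift maff
      by (auto simp: spectral_form_def mult.assoc)
  next
    assume roots: "\<And>\<sigma>. \<sigma> \<in> ?S \<Longrightarrow> \<exists>s>0. maff n a (\<lambda>i. l (\<sigma> i) + s) = 0"
    then obtain r where r: "\<And>\<sigma>. \<sigma> \<in> ?S \<Longrightarrow> r \<sigma> > 0" "\<And>\<sigma>. \<sigma> \<in> ?S \<Longrightarrow> maff n a (\<lambda>i. l (\<sigma> i) + r \<sigma>) = 0"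
      by metis
    have fin: "finite ?S" by (rule finite_permutations) simp
    have ne: "?S \<noteq> {}" using permutes_id by blast
    define s where "s = Min (r ` ?S)"
    have s: "s > 0" "\<And>\<sigma>. \<sigma> \<in> ?S \<Longrightarrow> s \<le> r \<sigma>"
      using fin ne r(1) by (auto simp: s_def)
    have "maff n a (\<lambda>i. l (\<sigma> i) + s) \<le> 0" if "\<sigma> \<in> ?S" for \<sigma>
    proof -
      have "maff n a (\<lambda>i. l (\<sigma> i) + s) = maff n a (\<lambda>i. l (\<sigma> i) + r \<sigma>) - (r \<sigma> - s) * maff n a (\<lambda>_. 1)"
        unfolding maff sum_distrib_left sum_subtractf[symmetric]
        by (intro sum.cong refl) (simp add: algebra_simps)
      also have "\<dots> \<le> 0" using r(2)[OF that] s(2)[OF that] pos by simp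
      finally show ?thesis .
    qed
    then show "\<exists>s>0. \<forall>\<sigma>\<in>?S. maff n a (\<lambda>i. l (\<sigma> i) + s) \<le> 0" using s(1) by blast
  qed
  then show "\<exists>\<sigma>. \<sigma> permutes {..<n} \<and> (\<forall>s>0. maff n a (\<lambda>i. l (\<sigma> i) + s) \<noteq> 0)" by blast
qed

lemma subsets_card_corank_one:
  assumes "n \<ge> 1"
  shows "{T. T \<subseteq> {..<n} \<and> card T = n - 1} = (\<lambda>i. {..<n} - {i}) ` {..<n}"
proof (intro equalityI subsetI)
  fix T assume "T \<in> {T. T \<subseteq> {..<n} \<and> card T = n - 1}"
  then have T: "T \<subseteq> {..<n}" and card: "card T = n - 1" by simp_all
  have "card ({..<n} - T) = 1"
    using assms card by (simp add: card_Diff_subset[OF finite_subset[OF T] T])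
  then obtain i where i: "{..<n} - T = {i}" by (auto simp: card_1_singleton_iff)
  have "T = {..<n} - ({..<n} - T)" using T by (simp add: double_diff)
  then have "T = {..<n} - {i}" unfolding i .
  moreover have "i \<in> {..<n}" using i by blast
  ultimately show "T \<in> (\<lambda>i. {..<n} - {i}) ` {..<n}" by (rule image_eqI)
qed auto

lemma sum_homog_corank_one:
  fixes f :: "nat set \<Rightarrow> real"
  assumes "homog_coefs n (n - 1) a" "n \<ge> 1"
  shows "(\<Sum>J\<in>Pow {..<n}. a J * f J) = (\<Sum>i<n. a ({..<n} - {i}) * f ({..<n} - {i}))"
proof -
  have "(\<Sum>J\<in>Pow {..<n}. a J * f J) = (\<Sum>J\<in>(\<lambda>i. {..<n} - {i}) ` {..<n}. a J * f J)"
  proof (rule sum.mono_neutral_right)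
    show "\<forall>J\<in>Pow {..<n} - (\<lambda>i. {..<n} - {i}) ` {..<n}. a J * f J = 0"
    proof
      fix J assume J: "J \<in> Pow {..<n} - (\<lambda>i. {..<n} - {i}) ` {..<n}"
      have "card J \<noteq> n - 1"
        using J unfolding subsets_card_corank_one[OF assms(2), symmetric] by simp
      then show "a J * f J = 0" using assms J by (auto simp: homog_coefs_def)
    qed
  qed auto
  moreover have "inj_on (\<lambda>i. {..<n} - {i}) {..<n}" by (rule inj_onI) auto
  ultimately show ?thesis by (simp add: sum.reindex)
qed

lemma pminor_corank_one_spectral_form:
  assumes U: "orthogonal_fun n U" and i: "i < n"
  shows "pminor (spectral_form n l U) ({..<n} - {i})
    = (\<Sum>k<n. (\<Prod>j\<in>{..<n} - {k}. l j) * (U k i * U k i))"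
proof -
  have card: "card ({..<n} - {i}) = n - 1" using i by simp
  have n: "n \<ge> 1" using i by simp
  have dd: "{..<n} - ({..<n} - {i}) = {i}" using i by auto
  have "pminor (spectral_form n l U) ({..<n} - {i})
      = (\<Sum>T\<in>(\<lambda>i. {..<n} - {i}) ` {..<n}. pminor (outer_gram {i} U) ({..<n} - T) * (\<Prod>k\<in>T. l k))"
    using pminor_spectral_form[OF U Diff_subset[of "{..<n}" "{i}"], of l]
    unfolding card dd subsets_card_corank_one[OF n] .
  also have "\<dots> = (\<Sum>k<n. pminor (outer_gram {i} U) ({..<n} - ({..<n} - {k})) * (\<Prod>j\<in>{..<n} - {k}. l j))"
  proof -
    have inj: "inj_on (\<lambda>i. {..<n} - {i}) {..<n}" by (rule inj_onI) auto
    show ?thesis unfolding sum.reindex[OF inj] o_def ..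
  qed
  also have "\<dots> = (\<Sum>k<n. (\<Prod>j\<in>{..<n} - {k}. l j) * (U k i * U k i))"
  proof (intro sum.cong refl)
    fix k assume "k \<in> {..<n}"
    then have "{..<n} - ({..<n} - {k}) = {k}" by auto
    then show "pminor (outer_gram {i} U) ({..<n} - ({..<n} - {k})) * (\<Prod>j\<in>{..<n} - {k}. l j)
        = (\<Prod>j\<in>{..<n} - {k}. l j) * (U k i * U k i)"
      by (simp add: outer_gram_def)
  qed
  finally show ?thesis .
qed

text \<open>In degree \<open>n - 1\<close> the principal minor that omits \<open>i\<close> is the average, with weights \<open>(U k i)\<^sup>2\<close>,
  of the products of all eigenvalues but \<open>l k\<close>, so that the rearrangement bound gives the mixture.\<close>
lemma corank_one_contains_spectra:
  assumes n: "n \<ge> 1" and homog: "homog_coefs n (n - 1) a" and pos: "maff n a (\<lambda>_. 1) > 0"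
    and interlace: "\<And>l. (\<And>\<sigma>. \<sigma> permutes {..<n} \<Longrightarrow> \<exists>s>0. maff n a (\<lambda>i. l (\<sigma> i) + s) = 0) \<Longrightarrow>
      \<exists>s>0. \<forall>\<sigma>. \<sigma> permutes {..<n} \<longrightarrow> maff n a (\<lambda>i. l (\<sigma> i) + s) \<le> 0"
  shows "contains_spectra n a"
  unfolding contains_spectra_def
proof (intro allI impI)
  fix l U assume U: "orthogonal_fun n U"
    and nz: "\<forall>s>0. mlift n a (shift_diag (spectral_form n l U) s) \<noteq> 0"
  let ?S = "{\<sigma>. \<sigma> permutes {..<n}}"
  have "\<exists>\<sigma>\<in>?S. \<forall>s>0. maff n a (\<lambda>i. l (\<sigma> i) + s) \<noteq> 0"
  proof (rule containment_of_family[OF homog pos])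
    show "mlift n a (shift_diag (spectral_form n l U) s) \<noteq> 0" if "s > 0" for s using nz that by blast
    show "\<exists>s>0. \<forall>\<sigma>\<in>?S. maff n a (\<lambda>i. l (\<sigma> i) + s) \<le> 0"
      if "\<And>\<sigma>. \<sigma> \<in> ?S \<Longrightarrow> \<exists>s>0. maff n a (\<lambda>i. l (\<sigma> i) + s) = 0"
      using interlace[of l] that by simp
    fix s :: real assume "s > 0"
    let ?b = "\<lambda>i. a ({..<n} - {i})" and ?c = "\<lambda>k. \<Prod>j\<in>{..<n} - {k}. l j + s"
    have "mlift n a (shift_diag (spectral_form n l U) s)
        = (\<Sum>i<n. ?b i * pminor (spectral_form n (\<lambda>k. l k + s) U) ({..<n} - {i}))"
      using sum_homog_corank_one[OF homog n, of "pminor (spectral_form n (\<lambda>k. l k + s) U)"]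
      by (simp only: mlift_shift_diag_spectral_form[OF U]) (simp only: mlift_def)
    also have "\<dots> = (\<Sum>i<n. ?b i * (\<Sum>k<n. ?c k * (U k i * U k i)))"
      by (intro sum.cong refl) (simp add: pminor_corank_one_spectral_form[OF U])
    finally have eq: "mlift n a (shift_diag (spectral_form n l U) s) = \<dots>" .
    obtain \<sigma> where \<sigma>: "\<sigma> permutes {..<n}"
      and le: "(\<Sum>i<n. ?b i * (\<Sum>k<n. ?c k * (U k i * U k i))) \<le> (\<Sum>i<n. ?b i * ?c (\<sigma> i))"
      using spectral_mixture_le_permutation[OF U, of ?b ?c] by blast
    have "(\<Sum>i<n. ?b i * ?c (\<sigma> i)) = (\<Sum>i<n. ?b i * (\<Prod>j\<in>{..<n} - {i}. l (\<sigma> j) + s))"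
    proof (intro sum.cong refl)
      fix i assume "i \<in> {..<n}"
      have "\<sigma> ` ({..<n} - {i}) = {..<n} - {\<sigma> i}"
        using permutes_image[OF \<sigma>] permutes_inj[OF \<sigma>] by (simp add: image_set_diff)
      then have "?c (\<sigma> i) = (\<Prod>j\<in>\<sigma> ` ({..<n} - {i}). l j + s)" by simp
      also have "\<dots> = (\<Prod>j\<in>{..<n} - {i}. l (\<sigma> j) + s)"
        by (subst prod.reindex[OF permutes_inj_on[OF \<sigma>]]) simp
      finally show "?b i * ?c (\<sigma> i) = ?b i * (\<Prod>j\<in>{..<n} - {i}. l (\<sigma> j) + s)" by simp
    qed
    also have "\<dots> = maff n a (\<lambda>i. l (\<sigma> i) + s)"
      unfolding maff_def by (rule sum_homog_corank_one[OF homog n, symmetric])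
    finally show "\<exists>\<sigma>\<in>?S. mlift n a (shift_diag (spectral_form n l U) s) \<le> maff n a (\<lambda>i. l (\<sigma> i) + s)"
      using \<sigma> le eq by auto
  qed
  then show "\<exists>\<sigma>. \<sigma> permutes {..<n} \<and> (\<forall>s>0. maff n a (\<lambda>i. l (\<sigma> i) + s) \<noteq> 0)" by blast
qed

lemma real_rooted_factorization:
  fixes q :: "real poly"
  assumes "q \<noteq> 0" "\<And>z :: complex. poly (map_poly of_real q) z = 0 \<Longrightarrow> z \<in> \<real>"
  shows "q = Polynomial.smult (lead_coeff q) (\<Prod>x\<in>#proots q. [:- x, 1:])"
  using assms
proof (induction "degree q" arbitrary: q)
  case 0
  then obtain c where "q = [:c:]" by (metis degree_eq_zeroE)
  then show ?case using 0 by simp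
next
  case (Suc k)
  have "degree (map_poly complex_of_real q) \<noteq> 0" using Suc.hyps(2) by simp
  then obtain z where z: "poly (map_poly complex_of_real q) z = 0"
    using fundamental_theorem_of_algebra[of "map_poly complex_of_real q"] by (auto simp: constant_degree)
  then obtain r where "z = of_real r" using Suc.prems(2) by (auto elim: Reals_cases)
  then have "poly q r = 0" using z by simp
  then obtain h where h: "q = [:- r, 1:] * h" by (auto simp: poly_eq_0_iff_dvd elim: dvdE)
  have h0: "h \<noteq> 0" using h Suc.prems(1) by auto
  have deg: "degree q = Suc (degree h)" unfolding h using h0 by (subst degree_mult_eq) auto
  interpret oh: map_poly_inj_idom_hom "of_real :: real \<Rightarrow> complex" ..
  have "w \<in> \<real>" if "poly (map_poly complex_of_real h) w = 0" for w
    using that by (intro Suc.prems(2)) (simp add: h oh.hom_mult del: mult_pCons_left)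
  then have IH: "h = Polynomial.smult (lead_coeff h) (\<Prod>x\<in>#proots h. [:- x, 1:])"
    using Suc.hyps h0 deg by (intro Suc.hyps(1)) auto
  have "proots q = add_mset r (proots h)"
    unfolding h using h0 by (subst proots_mult) auto
  moreover have "lead_coeff q = lead_coeff h"
    unfolding h by (simp add: lead_coeff_mult del: mult_pCons_left)
  ultimately have "Polynomial.smult (lead_coeff q) (\<Prod>x\<in>#proots q. [:- x, 1:])
      = [:- r, 1:] * Polynomial.smult (lead_coeff h) (\<Prod>x\<in>#proots h. [:- x, 1:])"
    by (simp del: mult_pCons_left)
  then show ?case using IH h by simp
qed

lemma prod_mset_nonneg:
  "(\<And>x. x \<in># A \<Longrightarrow> f x \<ge> (0::real)) \<Longrightarrow> (\<Prod>x\<in>#A. f x) \<ge> 0"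
  by (induction A) auto

text \<open>Passing from the left of the first root to the interval between the first two roots changes the sign.\<close>
lemma real_rooted_sign_between_roots:
  fixes q :: "real poly"
  assumes q: "q \<noteq> 0" "\<And>z :: complex. poly (map_poly of_real q) z = 0 \<Longrightarrow> z \<in> \<real>"
  defines "xs \<equiv> sorted_list_of_multiset (proots q)"
  assumes ne: "xs \<noteq> []" and t: "xs ! 0 \<le> t" "length xs > 1 \<Longrightarrow> t \<le> xs ! 1" and u: "u < xs ! 0"
  shows "poly q t * poly q u \<le> 0"
proof -
  obtain x ys where xs: "xs = x # ys" using ne by (cases xs) auto
  have "sorted xs" by (simp add: xs_def)
  then have sorted: "sorted ys" "\<And>y. y \<in> set ys \<Longrightarrow> x \<le> y" unfolding xs by auto
  have y: "u < y \<and> t \<le> y" if y: "y \<in> set ys" for y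
  proof
    show "u < y" using u sorted(2)[OF y] unfolding xs by simp
    obtain j where j: "j < length ys" "y = ys ! j" using y by (metis in_set_conv_nth)
    have "t \<le> ys ! 0" using t(2) j(1) unfolding xs by (cases ys) auto
    also have "\<dots> \<le> ys ! j" by (rule sorted_nth_mono[OF sorted(1) le0 j(1)])
    finally show "t \<le> y" using j(2) by simp
  qed
  have "proots q = mset xs" by (simp add: xs_def)
  then have "q = Polynomial.smult (lead_coeff q) (\<Prod>x\<in>#mset xs. [:- x, 1:])"
    using real_rooted_factorization[OF q] by simp
  then have q_eq: "q = Polynomial.smult (lead_coeff q) ([:- x, 1:] * (\<Prod>x\<in>#mset ys. [:- x, 1:]))"
    by (simp only: xs mset.simps image_mset_add_mset prod_mset.add_mset)
  have eval: "poly q v = lead_coeff q * ((v - x) * (\<Prod>y\<in>#mset ys. v - y))" for v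
    by (subst q_eq) (simp add: poly_prod_mset algebra_simps)
  have "(\<Prod>y\<in>#mset ys. t - y) * (\<Prod>y\<in>#mset ys. u - y) = (\<Prod>y\<in>#mset ys. (t - y) * (u - y))"
    by (simp add: prod_mset.distrib)
  also have "\<dots> \<ge> 0"
    by (rule prod_mset_nonneg) (use y in \<open>force intro: mult_nonpos_nonpos\<close>)
  finally have nonneg: "(\<Prod>y\<in>#mset ys. t - y) * (\<Prod>y\<in>#mset ys. u - y) \<ge> 0" .
  have "(t - x) * (u - x) \<le> 0" using t(1) u by (simp add: xs mult_nonneg_nonpos)
  then have "(lead_coeff q)\<^sup>2 * (((t - x) * (u - x))
      * ((\<Prod>y\<in>#mset ys. t - y) * (\<Prod>y\<in>#mset ys. u - y))) \<le> 0"
    by (intro mult_nonneg_nonpos[OF zero_le_power2] mult_nonpos_nonneg[OF _ nonneg])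
  moreover have "poly q t * poly q u = (lead_coeff q)\<^sup>2 * (((t - x) * (u - x))
      * ((\<Prod>y\<in>#mset ys. t - y) * (\<Prod>y\<in>#mset ys. u - y)))"
    unfolding eval by (simp add: power2_eq_square mult_ac)
  ultimately show ?thesis by simp
qed

lemma line_poly_multiaffine_poly:
  fixes v :: "real vec"
  assumes v: "v \<in> carrier_vec n"
  shows "line_poly smult_vec (eval (multiaffine_poly n a)) (ones_vec n) v
    = pcompose (line_maff n a (vec_index v)) [:0, -1:]"
proof -
  have eval: "poly (pcompose (line_maff n a (vec_index v)) [:0, -1:]) t
      = eval (multiaffine_poly n a) (v - t \<cdot>\<^sub>v ones_vec n)" for t
    unfolding eval_multiaffine_poly poly_pcompose poly_line_maff
    by (intro maff_cong) (use v in \<open>auto simp: ones_vec_def\<close>)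
  show ?thesis unfolding line_poly_def
  proof (rule the_equality)
    show "q = pcompose (line_maff n a (vec_index v)) [:0, -1:]"
      if "\<forall>t. poly q t = eval (multiaffine_poly n a) (v - t \<cdot>\<^sub>v ones_vec n)" for q
      using that eval by (simp add: poly_eq_poly_eq_iff[symmetric] fun_eq_iff)
  qed (simp add: eval)
qed

text \<open>The roots in the definition of interlacing are those of \<open>t \<mapsto> p(v - t\<one>)\<close>, so the largest root of \<open>f\<^sub>\<sigma>\<close> is minus the
  first entry of \<open>xs \<sigma>\<close>. The sorted roots of \<open>e\<^bsub>n-2\<^esub>\<close> are the same for all permutations, and the first of them lies
  between the first two entries of each \<open>xs \<sigma>\<close>. Thus the largest first entry \<open>t\<close> lies between the first two
  entries of every \<open>xs \<sigma>\<close>. For \<open>n \<ge> 3\<close> there are at least two roots.\<close>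
lemma corank_one_interlacing:
  assumes n: "n \<ge> 3" and homog: "homog_coefs n (n - 1) a" and one: "maff n a (\<lambda>_. 1) \<noteq> 0"
    and il: "interlaces n (elem_sym (n - 2) n) (multiaffine_poly n a)"
    and roots: "\<And>\<sigma>. \<sigma> permutes {..<n} \<Longrightarrow> \<exists>s>0. maff n a (\<lambda>i. l (\<sigma> i) + s) = 0"
  shows "\<exists>s>0. \<forall>\<sigma>. \<sigma> permutes {..<n} \<longrightarrow> maff n a (\<lambda>i. l (\<sigma> i) + s) * maff n a (\<lambda>_. 1) \<le> 0"
proof -
  define p where "p = multiaffine_poly n a"
  define eC :: "nat set \<Rightarrow> real" where "eC = (\<lambda>J. if J \<subseteq> {..<n} \<and> card J = n - 2 then 1 else 0)"
  define e where "e = multiaffine_poly n eC"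
  define V where "V = (\<lambda>\<sigma>. vec n (\<lambda>i. l (\<sigma> i)))"
  define q where "q = (\<lambda>b \<sigma>. pcompose (line_maff n b (\<lambda>i. l (\<sigma> i))) [:0, -1:])"
  define xs where "xs = (\<lambda>\<sigma>. sorted_list_of_multiset (proots (q a \<sigma>)))"
  have V: "V \<sigma> \<in> carrier_vec n" for \<sigma> by (simp add: V_def)
  have line: "line_poly smult_vec (eval (multiaffine_poly n b)) (ones_vec n) (V \<sigma>) = q b \<sigma>" for b \<sigma>
  proof -
    have "line_maff n b (vec_index (V \<sigma>)) = line_maff n b (\<lambda>i. l (\<sigma> i))"
      unfolding line_maff_def by (intro maff_cong) (auto simp: V_def)
    then show ?thesis by (simp add: line_poly_multiaffine_poly[OF V] q_def)
  qed
  have poly_q: "poly (q a \<sigma>) t = maff n a (\<lambda>i. l (\<sigma> i) + (- t))" for \<sigma> t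
    by (simp add: q_def poly_pcompose poly_line_maff)
  have elem: "elem_sym (n - 2) n = e"
    unfolding e_def eC_def by (rule elem_sym_eq_multiaffine_poly) simp
  obtain d where d: "homogeneous (Suc d) p"
    and hyp: "hyperbolic (carrier_vec n) smult_vec (eval p) (ones_vec n)"
    and ineq: "\<And>v i. v \<in> carrier_vec n \<Longrightarrow> i < d \<Longrightarrow>
        sorted_roots n p v ! i \<le> sorted_roots n e v ! i \<and>
        sorted_roots n e v ! i \<le> sorted_roots n p v ! Suc i"
    using il unfolding interlaces_def elem p_def by blast
  have "d \<ge> 1"
  proof -
    have "\<not> (\<forall>J\<in>Pow {..<n}. a J = 0)"
    proof
      assume "\<forall>J\<in>Pow {..<n}. a J = 0"
      then have "maff n a (\<lambda>_. 1) = 0" unfolding maff_def by (intro sum.neutral) simp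
      then show False using one by simp
    qed
    then obtain J where J: "J \<subseteq> {..<n}" "a J \<noteq> 0" by blast
    then have "card J = n - 1" "card J = Suc d"
      using homog d by (auto simp: homog_coefs_def p_def homogeneous_multiaffine_poly_iff)
    then show ?thesis using n by simp
  qed
  have sr: "sorted_roots n p (V \<sigma>) = xs \<sigma>" for \<sigma>
    unfolding sorted_roots_def p_def line xs_def ..
  have sre: "sorted_roots n e (V \<sigma>) = sorted_roots n e (V id)" if \<sigma>: "\<sigma> permutes {..<n}" for \<sigma>
  proof -
    have "line_maff n eC (\<lambda>i. l (\<sigma> i)) = line_maff n eC l"
      unfolding line_maff_def
    proof (rule maff_permute[OF \<sigma>, where x = "\<lambda>i. [:l i, 1:]"])
      fix J assume J: "J \<subseteq> {..<n}"
      have "\<sigma> ` J \<subseteq> {..<n}" using J permutes_image[OF \<sigma>] by blast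
      moreover have "card (\<sigma> ` J) = card J" by (rule card_image[OF permutes_inj_on[OF \<sigma>]])
      ultimately show "[:eC (\<sigma> ` J):] = [:eC J:]" using J by (simp add: eC_def)
    qed
    then show ?thesis unfolding sorted_roots_def e_def line q_def by simp
  qed
  have nz: "q a \<sigma> \<noteq> 0" "\<And>z :: complex. poly (map_poly of_real (q a \<sigma>)) z = 0 \<Longrightarrow> z \<in> \<real>"
    and far: "\<exists>u < b. poly (q a \<sigma>) u * maff n a (\<lambda>_. 1) > 0" for \<sigma> b
  proof -
    have "((\<lambda>s. maff n a (\<lambda>i. l (\<sigma> i) + s) / s ^ (n - 1) * maff n a (\<lambda>_. 1)) \<longlongrightarrow> maff n a (\<lambda>_. 1) * maff n a (\<lambda>_. 1)) at_top"
      by (intro tendsto_mult maff_asymptotics[OF homog] tendsto_const)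
    then have "((\<lambda>s. maff n a (\<lambda>i. l (\<sigma> i) + s) * maff n a (\<lambda>_. 1) / s ^ (n - 1)) \<longlongrightarrow> maff n a (\<lambda>_. 1) * maff n a (\<lambda>_. 1)) at_top"
      by simp
    moreover have "maff n a (\<lambda>_. 1) * maff n a (\<lambda>_. 1) > 0" using one not_real_square_gt_zero by blast
    ultimately have "eventually (\<lambda>s. maff n a (\<lambda>i. l (\<sigma> i) + s) * maff n a (\<lambda>_. 1) > 0) at_top"
      by (rule eventually_pos_of_ratio)
    then have "eventually (\<lambda>s. maff n a (\<lambda>i. l (\<sigma> i) + s) * maff n a (\<lambda>_. 1) > 0 \<and> s > - b) at_top"
      using eventually_gt_at_top[of "- b"] by (rule eventually_conj)
    then obtain s where "maff n a (\<lambda>i. l (\<sigma> i) + s) * maff n a (\<lambda>_. 1) > 0" "s > - b"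
      using eventually_happens'[OF trivial_limit_at_top_linorder] by blast
    then have "- s < b \<and> poly (q a \<sigma>) (- s) * maff n a (\<lambda>_. 1) > 0" unfolding poly_q by simp
    then show "\<exists>u < b. poly (q a \<sigma>) u * maff n a (\<lambda>_. 1) > 0" by blast
    then show "q a \<sigma> \<noteq> 0" by auto
    show "\<And>z :: complex. poly (map_poly of_real (q a \<sigma>)) z = 0 \<Longrightarrow> z \<in> \<real>"
      using hyp V[of \<sigma>] unfolding hyperbolic_def line[symmetric] p_def by blast
  qed
  have first: "xs \<sigma> \<noteq> []" "xs \<sigma> ! 0 < 0" if \<sigma>: "\<sigma> permutes {..<n}" for \<sigma>
  proof -
    obtain s where s: "s > 0" "maff n a (\<lambda>i. l (\<sigma> i) + s) = 0" using roots[OF \<sigma>] by blast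
    then have "poly (q a \<sigma>) (- s) = 0" by (simp add: poly_q)
    then have mem: "- s \<in> set (xs \<sigma>)" using nz(1) by (simp add: xs_def)
    then show ne: "xs \<sigma> \<noteq> []" by auto
    have sorted: "sorted (xs \<sigma>)" by (simp add: xs_def)
    obtain j where "j < length (xs \<sigma>)" "xs \<sigma> ! j = - s" using mem by (metis in_set_conv_nth)
    then have "xs \<sigma> ! 0 \<le> - s" using sorted_nth_mono[OF sorted le0, of j] by simp
    then show "xs \<sigma> ! 0 < 0" using s(1) by simp
  qed
  let ?S = "{\<sigma>. \<sigma> permutes {..<n}}"
  \<comment> \<open>Minus the smallest of the largest roots of the \<open>f\<^sub>\<sigma>\<close>.\<close>
  define t where "t = Max ((\<lambda>\<sigma>. xs \<sigma> ! 0) ` ?S)"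
  have fin: "finite ?S" by (rule finite_permutations) simp
  have ne: "?S \<noteq> {}" using permutes_id by blast
  obtain \<tau> where \<tau>: "\<tau> permutes {..<n}" "t = xs \<tau> ! 0"
    using Max_in[of "(\<lambda>\<sigma>. xs \<sigma> ! 0) ` ?S"] fin ne unfolding t_def by blast
  have "maff n a (\<lambda>i. l (\<sigma> i) + (- t)) * maff n a (\<lambda>_. 1) \<le> 0" if \<sigma>: "\<sigma> permutes {..<n}" for \<sigma>
  proof -
    have "xs \<sigma> ! 0 \<le> t" unfolding t_def using fin \<sigma> by (intro Max_ge) auto
    moreover have "t \<le> xs \<sigma> ! 1"
    proof -
      have "t \<le> sorted_roots n e (V \<tau>) ! 0" using ineq[OF V, of 0 \<tau>] \<open>d \<ge> 1\<close> \<tau>(2) by (simp add: sr)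
      also have "\<dots> = sorted_roots n e (V \<sigma>) ! 0" using sre[OF \<tau>(1)] sre[OF \<sigma>] by simp
      also have "\<dots> \<le> xs \<sigma> ! 1" using ineq[OF V, of 0 \<sigma>] \<open>d \<ge> 1\<close> by (simp add: sr)
      finally show ?thesis .
    qed
    moreover obtain u where u: "u < xs \<sigma> ! 0" "poly (q a \<sigma>) u * maff n a (\<lambda>_. 1) > 0" using far by blast
    ultimately have "poly (q a \<sigma>) t * poly (q a \<sigma>) u \<le> 0"
      using real_rooted_sign_between_roots[where q = "q a \<sigma>" and t = t and u = u, OF nz] first(1)[OF \<sigma>] by (simp add: xs_def)
    then have "poly (q a \<sigma>) t * maff n a (\<lambda>_. 1) \<le> 0"
      using u(2) by (auto simp: mult_le_0_iff zero_less_mult_iff)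
    then show ?thesis by (simp add: poly_q)
  qed
  moreover have "- t > 0" using first(2)[OF \<tau>(1)] \<tau>(2) by simp
  ultimately show ?thesis by blast
qed

section \<open>Monotonicity of hyperbolicity cones\<close>

lemma ratio_tendsto_zero:
  fixes F G :: "real \<Rightarrow> real"
  assumes "((\<lambda>s. F s / s ^ d) \<longlongrightarrow> c) at_top" "((\<lambda>s. G s / s ^ d) \<longlongrightarrow> c) at_top" "c \<noteq> 0"
  shows "((\<lambda>s. (G s - F s) / F s) \<longlongrightarrow> 0) at_top"
proof -
  have "((\<lambda>s. (G s / s ^ d - F s / s ^ d) / (F s / s ^ d)) \<longlongrightarrow> (c - c) / c) at_top"
    by (intro tendsto_divide tendsto_diff assms)
  moreover have "eventually (\<lambda>s. (G s / s ^ d - F s / s ^ d) / (F s / s ^ d) = (G s - F s) / F s) at_top"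
    using eventually_gt_at_top[of 0] by eventually_elim (simp add: divide_simps)
  ultimately show ?thesis using Lim_transform_eventually by fastforce
qed

lemma positive_of_no_positive_root:
  fixes f :: "real poly"
  assumes "eventually (\<lambda>x. poly f x > 0) at_top" "\<And>x. x > 0 \<Longrightarrow> poly f x \<noteq> 0" "x > 0"
  shows "poly f x > 0"
proof (rule ccontr)
  assume "\<not> poly f x > 0"
  then have neg: "poly f x < 0" using assms(2)[OF assms(3)] by simp
  have "eventually (\<lambda>y. poly f y > 0 \<and> y > x) at_top"
    using assms(1) eventually_gt_at_top[of x] by (rule eventually_conj)
  then obtain y where "poly f y > 0" "y > x"
    using eventually_happens'[OF trivial_limit_at_top_linorder] by blast
  then obtain z where "x < z" "poly f z = 0" using poly_IVT_pos[of x y f] neg by blast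
  then show False using assms(2)[of z] assms(3) by simp
qed

lemma maff_update:
  assumes k: "k < n"
  shows "maff n a (x(k := x k + y)) = maff n a x + y * maff n (\<lambda>J. if k \<in> J then 0 else a (insert k J)) x"
proof -
  let ?K = "{..<n} - {k}"
  have N: "{..<n} = insert k ?K" using k by auto
  have split: "(\<Sum>J\<in>Pow {..<n}. f J) = (\<Sum>J\<in>Pow ?K. f J) + (\<Sum>J\<in>Pow ?K. f (insert k J))" for f :: "nat set \<Rightarrow> 'a"
    by (subst N) (rule sum_Pow_insert, auto)
  have p1: "(\<Prod>i\<in>J. (x(k := z)) i) = (\<Prod>i\<in>J. x i)" if "J \<in> Pow ?K" for J z
    using that by (intro prod.cong) auto
  have p2: "(\<Prod>i\<in>insert k J. (x(k := z)) i) = z * (\<Prod>i\<in>J. x i)" if J: "J \<in> Pow ?K" for J z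
  proof -
    have "k \<notin> J" "finite J" using J by (auto intro: finite_subset)
    then show ?thesis using p1[OF J, of z] by simp
  qed
  have e: "maff n a (x(k := z)) = (\<Sum>J\<in>Pow ?K. a J * (\<Prod>i\<in>J. x i)) + z * (\<Sum>J\<in>Pow ?K. a (insert k J) * (\<Prod>i\<in>J. x i))" for z
  proof -
    have "(\<Sum>J\<in>Pow ?K. a J * (\<Prod>i\<in>J. (x(k := z)) i)) = (\<Sum>J\<in>Pow ?K. a J * (\<Prod>i\<in>J. x i))"
      by (intro sum.cong refl) (simp only: p1)
    moreover have "(\<Sum>J\<in>Pow ?K. a (insert k J) * (\<Prod>i\<in>insert k J. (x(k := z)) i))
        = z * (\<Sum>J\<in>Pow ?K. a (insert k J) * (\<Prod>i\<in>J. x i))"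
      unfolding sum_distrib_left by (intro sum.cong refl) (simp only: p2 mult.left_commute)
    ultimately show ?thesis unfolding maff_def split by (simp only:)
  qed
  have "maff n (\<lambda>J. if k \<in> J then 0 else a (insert k J)) x = (\<Sum>J\<in>Pow ?K. a (insert k J) * (\<Prod>i\<in>J. x i))"
  proof -
    have "(if k \<in> J then 0 else a (insert k J)) * (\<Prod>i\<in>J. x i) = a (insert k J) * (\<Prod>i\<in>J. x i)"
      if "J \<in> Pow ?K" for J using that by auto
    then show ?thesis unfolding maff_def split by simp
  qed
  then show ?thesis using e[of "x k + y"] e[of "x k"] by (simp add: distrib_right)
qed

text \<open>Let \<open>f(s) = p(u + s\<one>)\<close> and let \<open>g\<close> be the derivative of \<open>p\<close> in direction \<open>k\<close> along the same line. Since \<open>p\<close> is multiaffine,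
  increasing coordinate \<open>k\<close> by \<open>y\<close> gives \<open>f + y g\<close>; with complex \<open>y\<close> this is a stable pencil, so \<open>g \<ge> 0\<close> right of the
  largest root of \<open>f\<close>.\<close>
lemma cone_mono_coordinate:
  assumes stab: "stable_coefs n a" and homog: "homog_coefs n d a" and one: "maff n a (\<lambda>_. 1) > 0"
    and u: "\<And>s. s > 0 \<Longrightarrow> maff n a (\<lambda>i. u i + s) \<noteq> 0" and y: "y \<ge> 0" and k: "k < n" and s: "s > 0"
  shows "maff n a (\<lambda>i. (u(k := u k + y)) i + s) \<noteq> 0"
proof -
  define b where "b = (\<lambda>J. if k \<in> J then 0 else a (insert k J))"
  define f where "f = line_maff n a u"
  define g where "g = line_maff n b u"
  have upd: "maff n a (\<lambda>i. (u(k := u k + z)) i + t) = poly f t + z * poly g t" for z t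
  proof -
    have "(\<lambda>i. (u(k := u k + z)) i + t) = (\<lambda>i. u i + t)(k := (u k + t) + z)" by (auto simp: fun_eq_iff)
    then show ?thesis using maff_update[OF k, of a "\<lambda>i. u i + t" z] by (simp add: f_def g_def poly_line_maff b_def)
  qed
  have ev: "eventually (\<lambda>t. poly f t > 0) at_top"
    unfolding f_def poly_line_maff using maff_asymptotics[OF homog] one by (rule eventually_pos_of_ratio)
  have pos: "poly f t > 0" if "t > 0" for t
    using ev by (rule positive_of_no_positive_root) (use u that in \<open>auto simp: f_def poly_line_maff\<close>)
  have "stable_pencil f g"
    unfolding stable_pencil_def
  proof (intro allI impI)
    fix t z :: complex assume tz: "Im t > 0" "Im z > 0"
    let ?x = "\<lambda>i. complex_of_real (u i) + t"
    have "maff n (\<lambda>J. complex_of_real (a J)) (?x(k := ?x k + z))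
        = rpoly f t + z * maff n (\<lambda>J. if k \<in> J then 0 else complex_of_real (a (insert k J))) ?x"
      using maff_update[OF k, of "\<lambda>J. complex_of_real (a J)" ?x z] by (simp only: f_def rpoly_line_maff)
    also have "maff n (\<lambda>J. if k \<in> J then 0 else complex_of_real (a (insert k J))) ?x = rpoly g t"
      unfolding g_def rpoly_line_maff b_def by (intro maff_cong) auto
    finally have "maff n (\<lambda>J. complex_of_real (a J)) (?x(k := ?x k + z)) = rpoly f t + z * rpoly g t" .
    moreover have "maff n (\<lambda>J. complex_of_real (a J)) (?x(k := ?x k + z)) \<noteq> 0"
      using stab tz by (simp add: stable_coefs_def)
    ultimately show "rpoly f t + z * rpoly g t \<noteq> 0" by simp
  qed
  moreover have "((\<lambda>t. poly g t / poly f t) \<longlongrightarrow> 0) at_top"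
  proof -
    have "((\<lambda>t. (maff n a (\<lambda>i. (u(k := u k + 1)) i + t) - maff n a (\<lambda>i. u i + t)) / maff n a (\<lambda>i. u i + t)) \<longlongrightarrow> 0) at_top"
      using one by (intro ratio_tendsto_zero[where d = d and c = "maff n a (\<lambda>_. 1)"] maff_asymptotics[OF homog]) auto
    then show ?thesis unfolding upd by (simp add: f_def poly_line_maff)
  qed
  ultimately have "poly g s \<ge> 0"
    using stable_pencil_ratio_decreasing(2)[of f g 0 s s] pos s by blast
  then have "poly f s + y * poly g s > 0" using pos[OF s] y by (simp add: add_pos_nonneg)
  then show ?thesis unfolding upd by simp
qed

lemma cone_mono:
  assumes stab: "stable_coefs n a" and homog: "homog_coefs n d a" and one: "maff n a (\<lambda>_. 1) > 0"
    and u: "\<And>s. s > 0 \<Longrightarrow> maff n a (\<lambda>i. u i + s) \<noteq> 0" and uv: "\<And>i. i < n \<Longrightarrow> u i \<le> v i" and s: "s > 0"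
  shows "maff n a (\<lambda>i. v i + s) \<noteq> 0"
proof -
  have "\<forall>s>0. maff n a (\<lambda>i. (if i < m then v i else u i) + s) \<noteq> 0" if "m \<le> n" for m
    using that
  proof (induction m)
    case (Suc m)
    let ?w = "\<lambda>i. if i < m then v i else u i"
    have "(\<lambda>i. if i < Suc m then v i else u i) = ?w(m := ?w m + (v m - u m))"
      by (auto simp: fun_eq_iff less_Suc_eq)
    moreover have "\<forall>s>0. maff n a (\<lambda>i. (?w(m := ?w m + (v m - u m))) i + s) \<noteq> 0"
      using Suc uv[of m] by (intro allI impI cone_mono_coordinate[OF stab homog one]) auto
    ultimately show ?case by (simp only: fun_eq_iff)
  qed (use u in simp)
  from this[of n] have "maff n a (\<lambda>i. (if i < n then v i else u i) + s) \<noteq> 0" using s by simp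
  moreover have "maff n a (\<lambda>i. (if i < n then v i else u i) + s) = maff n a (\<lambda>i. v i + s)"
    by (intro maff_cong) auto
  ultimately show ?thesis by simp
qed

section \<open>Weyl monotonicity of eigenvalues\<close>

lemma pminor_zero_row:
  assumes "finite K" "n \<in> K" "\<And>j. M n j = 0"
  shows "pminor M K = 0"
  unfolding pminor_def
proof (rule sum.neutral, rule ballI)
  fix p
  have "(\<Prod>i\<in>K. M i (p i)) = 0"
    by (rule prod_zero[OF assms(1) bexI[OF _ assms(2)]]) (rule assms(3))
  then show "signof p * (\<Prod>i\<in>K. M i (p i)) = 0" by simp
qed

lemma underdetermined_system:
  fixes R :: "nat \<Rightarrow> nat \<Rightarrow> real"
  assumes h: "h < n"
  obtains x where "\<exists>i<n. x i \<noteq> 0" "\<And>k. k < n \<Longrightarrow> k \<noteq> h \<Longrightarrow> (\<Sum>i<n. R k i * x i) = 0"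
proof -
  define M where "M = (\<lambda>k i. if k = h then 0 else R k i)"
  define X where "X = mat n n (\<lambda>(k, i). M k i)"
  have X: "X \<in> carrier_mat n n" by (simp add: X_def)
  have "det X = pminor M {..<n}" by (simp add: X_def pminor_lessThan)
  also have "\<dots> = 0" by (rule pminor_zero_row[of _ h]) (use h in \<open>auto simp: M_def\<close>)
  finally obtain v where v: "v \<in> carrier_vec n" "v \<noteq> 0\<^sub>v n" "X *\<^sub>v v = 0\<^sub>v n"
    using det_0_iff_vec_prod_zero[OF X] by auto
  show thesis
  proof (rule that[of "vec_index v"])
    show "\<exists>i<n. vec_index v i \<noteq> 0"
    proof (rule ccontr)
      assume "\<not> ?thesis"
      then have "v = 0\<^sub>v n" using v(1) by (intro eq_vecI) auto
      then show False using v(2) by simp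
    qed
    fix k assume k: "k < n" "k \<noteq> h"
    have "vec_index (X *\<^sub>v v) k = (\<Sum>i<n. R k i * vec_index v i)"
      using k v(1) by (simp add: X_def M_def scalar_prod_def atLeast0LessThan)
    then show "(\<Sum>i<n. R k i * vec_index v i) = 0" using v(3) k by simp
  qed
qed

lemma orthogonal_fun_Parseval:
  assumes U: "orthogonal_fun n U"
  shows "(\<Sum>k<n. (\<Sum>i<n. U k i * x i)\<^sup>2) = (\<Sum>i<n. (x i)\<^sup>2)"
proof -
  have "(\<Sum>k<n. (\<Sum>i<n. U k i * x i)\<^sup>2) = (\<Sum>k<n. \<Sum>i<n. \<Sum>j<n. (U k i * U k j) * (x i * x j))"
    unfolding power2_eq_square sum_product by (simp only: mult_ac)
  also have "\<dots> = (\<Sum>i<n. \<Sum>k<n. \<Sum>j<n. (U k i * U k j) * (x i * x j))" by (rule sum.swap)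
  also have "\<dots> = (\<Sum>i<n. \<Sum>j<n. \<Sum>k<n. (U k i * U k j) * (x i * x j))"
    by (intro sum.cong refl sum.swap)
  also have "\<dots> = (\<Sum>i<n. \<Sum>j<n. if i = j then x i * x j else 0)"
    by (intro sum.cong refl) (use U in \<open>simp add: orthogonal_fun_def flip: sum_distrib_right\<close>)
  also have "\<dots> = (\<Sum>i<n. (x i)\<^sup>2)" by (simp add: power2_eq_square)
  finally show ?thesis .
qed

text \<open>The argument of Courant and Fischer. With both spectra sorted, a nonzero vector orthogonal to the first \<open>h\<close>
  eigenvectors of the smaller form and to the last \<open>n - 1 - h\<close> eigenvectors of the larger one exists by counting
  equations. Relative to the squared norm, the smaller form is at
  least the \<open>h\<close>-th value of \<open>m\<close> on this vector, and the larger one at most the \<open>h\<close>-th value of \<open>l\<close>.\<close>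
theorem eigenvalue_monotonicity:
  assumes U: "orthogonal_fun n U" and V: "orthogonal_fun n V"
    and le: "\<And>x. (\<Sum>k<n. m k * (\<Sum>i<n. V k i * x i)\<^sup>2) \<le> (\<Sum>k<n. l k * (\<Sum>i<n. U k i * x i)\<^sup>2)"
  shows "\<exists>\<sigma>. \<sigma> permutes {..<n} \<and> (\<forall>k<n. m k \<le> l (\<sigma> k))"
proof -
  obtain \<pi> where \<pi>: "\<pi> permutes {..<n}" "\<And>i j. i \<le> j \<Longrightarrow> j < n \<Longrightarrow> m (\<pi> i) \<le> m (\<pi> j)"
    using sorting_permutation[of n m] by blast
  obtain \<rho> where \<rho>: "\<rho> permutes {..<n}" "\<And>i j. i \<le> j \<Longrightarrow> j < n \<Longrightarrow> l (\<rho> i) \<le> l (\<rho> j)"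
    using sorting_permutation[of n l] by blast
  have main: "m (\<pi> h) \<le> l (\<rho> h)" if h: "h < n" for h
  proof (rule ccontr)
    assume "\<not> m (\<pi> h) \<le> l (\<rho> h)"
    then have less: "l (\<rho> h) < m (\<pi> h)" by simp
    obtain x where x: "\<exists>i<n. x i \<noteq> 0"
      and zero: "\<And>k. k < n \<Longrightarrow> k \<noteq> h \<Longrightarrow> (\<Sum>i<n. (if k < h then V (\<pi> k) i else U (\<rho> k) i) * x i) = 0"
      using underdetermined_system[OF h, of "\<lambda>k i. if k < h then V (\<pi> k) i else U (\<rho> k) i"] by metis
    have Vz: "(\<Sum>i<n. V (\<pi> k) i * x i) = 0" if "k < h" for k
      using zero[of k] that h by simp
    have Uz: "(\<Sum>i<n. U (\<rho> k) i * x i) = 0" if "h < k" "k < n" for k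
      using zero[of k] that by simp
    define N where "N = (\<Sum>i<n. (x i)\<^sup>2)"
    have N: "N > 0"
    proof -
      obtain i where i: "i < n" "x i \<noteq> 0" using x by blast
      then have "0 < (x i)\<^sup>2" by simp
      also have "\<dots> \<le> N" unfolding N_def using i by (intro member_le_sum) auto
      finally show ?thesis .
    qed
    have NV: "N = (\<Sum>k<n. (\<Sum>i<n. V (\<pi> k) i * x i)\<^sup>2)"
      unfolding N_def
      using permuted_sum[OF \<pi>(1), of "\<lambda>k. (\<Sum>i<n. V k i * x i)\<^sup>2"] orthogonal_fun_Parseval[OF V, of x]
      by simp
    have NU: "N = (\<Sum>k<n. (\<Sum>i<n. U (\<rho> k) i * x i)\<^sup>2)"
      unfolding N_def
      using permuted_sum[OF \<rho>(1), of "\<lambda>k. (\<Sum>i<n. U k i * x i)\<^sup>2"] orthogonal_fun_Parseval[OF U, of x]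
      by simp
    have "m (\<pi> h) * N = (\<Sum>k<n. m (\<pi> h) * (\<Sum>i<n. V (\<pi> k) i * x i)\<^sup>2)"
      by (subst NV) (rule sum_distrib_left)
    also have "\<dots> \<le> (\<Sum>k<n. m (\<pi> k) * (\<Sum>i<n. V (\<pi> k) i * x i)\<^sup>2)"
    proof (rule sum_mono)
      fix k assume "k \<in> {..<n}"
      then show "m (\<pi> h) * (\<Sum>i<n. V (\<pi> k) i * x i)\<^sup>2 \<le> m (\<pi> k) * (\<Sum>i<n. V (\<pi> k) i * x i)\<^sup>2"
        using Vz[of k] \<pi>(2)[of h k] by (cases "k < h") (auto intro: mult_right_mono)
    qed
    also have "\<dots> = (\<Sum>k<n. m k * (\<Sum>i<n. V k i * x i)\<^sup>2)" by (rule permuted_sum[OF \<pi>(1)])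
    also have "\<dots> \<le> (\<Sum>k<n. l k * (\<Sum>i<n. U k i * x i)\<^sup>2)" by (rule le)
    also have "\<dots> = (\<Sum>k<n. l (\<rho> k) * (\<Sum>i<n. U (\<rho> k) i * x i)\<^sup>2)"
      by (rule permuted_sum[OF \<rho>(1), symmetric])
    also have "\<dots> \<le> (\<Sum>k<n. l (\<rho> h) * (\<Sum>i<n. U (\<rho> k) i * x i)\<^sup>2)"
    proof (rule sum_mono)
      fix k assume "k \<in> {..<n}"
      then show "l (\<rho> k) * (\<Sum>i<n. U (\<rho> k) i * x i)\<^sup>2 \<le> l (\<rho> h) * (\<Sum>i<n. U (\<rho> k) i * x i)\<^sup>2"
        using Uz[of k] \<rho>(2)[of k h] h by (cases "h < k") (auto intro: mult_right_mono)
    qed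
    also have "\<dots> = l (\<rho> h) * N"
      by (subst NU) (rule sum_distrib_left[symmetric])
    finally show False using less N by simp
  qed
  have inv: "inv_into UNIV \<pi> permutes {..<n}" by (rule permutes_inv[OF \<pi>(1)])
  have "m k \<le> l ((\<rho> \<circ> inv_into UNIV \<pi>) k)" if "k < n" for k
    using main[of "inv_into UNIV \<pi> k"] permutes_in_image[OF inv, of k] permutes_inverses(1)[OF \<pi>(1)] that
    by simp
  then show ?thesis using permutes_compose[OF inv \<rho>(1)] by blast
qed

lemma spectral_form_quadratic:
  "(\<Sum>i<n. \<Sum>j<n. spectral_form n l U i j * (x i * x j)) = (\<Sum>k<n. l k * (\<Sum>i<n. U k i * x i)\<^sup>2)"
proof -
  have "(\<Sum>i<n. \<Sum>j<n. spectral_form n l U i j * (x i * x j))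
      = (\<Sum>i<n. \<Sum>j<n. \<Sum>k<n. l k * ((U k i * x i) * (U k j * x j)))"
    by (simp add: spectral_form_def sum_distrib_left sum_distrib_right mult_ac)
  also have "\<dots> = (\<Sum>i<n. \<Sum>k<n. \<Sum>j<n. l k * ((U k i * x i) * (U k j * x j)))"
    by (intro sum.cong refl sum.swap)
  also have "\<dots> = (\<Sum>k<n. \<Sum>i<n. \<Sum>j<n. l k * ((U k i * x i) * (U k j * x j)))" by (rule sum.swap)
  also have "\<dots> = (\<Sum>k<n. l k * (\<Sum>i<n. U k i * x i)\<^sup>2)"
    by (simp only: power2_eq_square sum_product) (simp only: sum_distrib_left)
  finally show ?thesis .
qed

section \<open>Multiplication by a new variable\<close>

text \<open>The minor lift of \<open>x\<^sub>n p\<close>, with the corner entry \<open>M n n\<close> as a separate argument \<open>b\<close>; it is affine in \<open>b\<close>.\<close>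
definition bordered_lift :: "nat \<Rightarrow> (nat set \<Rightarrow> 'a :: comm_ring_1) \<Rightarrow> (nat \<Rightarrow> nat \<Rightarrow> 'a) \<Rightarrow> 'a \<Rightarrow> 'a" where
  "bordered_lift n a M b =
     (\<Sum>J\<in>Pow {..<n}. a J * pminor (\<lambda>i j. if i = n \<and> j = n then b else M i j) (insert n J))"

lemma finite_notin_Pow_lessThan: "J \<in> Pow {..<n::nat} \<Longrightarrow> finite J \<and> n \<notin> J"
  using finite_subset by auto

lemma bordered_lift_affine: "bordered_lift n a M b = b * mlift n a M + bordered_lift n a M 0"
proof -
  have "pminor (\<lambda>i j. if i = n \<and> j = n then b else M i j) (insert n J)
      = b * pminor M J + pminor (\<lambda>i j. if i = n \<and> j = n then 0 else M i j) (insert n J)"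
    if J: "J \<in> Pow {..<n}" for J
  proof -
    let ?M = "\<lambda>i j. if i = n \<and> j = n then 0 else M i j"
    have "pminor (\<lambda>i j. if i = n \<and> j = n then b else M i j) (insert n J)
        = pminor (\<lambda>i j. (if i = j then (if i = n then b else 0) else 0) + ?M i j) (insert n J)"
      by (rule pminor_cong) auto
    also have "\<dots> = b * pminor ?M J + pminor ?M (insert n J)"
      using finite_notin_Pow_lessThan[OF J] by (intro pminor_add_diag_entry) auto
    also have "pminor ?M J = pminor M J"
      using finite_notin_Pow_lessThan[OF J] by (intro pminor_cong) auto
    finally show ?thesis .
  qed
  then have "bordered_lift n a M b = (\<Sum>J\<in>Pow {..<n}. b * (a J * pminor M J)
      + a J * pminor (\<lambda>i j. if i = n \<and> j = n then 0 else M i j) (insert n J))"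
    unfolding bordered_lift_def by (intro sum.cong refl) (simp only: distrib_left mult.left_commute)
  then show ?thesis by (simp only: bordered_lift_def mlift_def sum_distrib_left sum.distrib)
qed

lemma bordered_lift_Schur:
  fixes b :: "'a :: field"
  assumes "b \<noteq> 0"
  shows "bordered_lift n a M b = b * mlift n a (\<lambda>i j. M i j - M i n * M n j / b)"
proof -
  have "pminor (\<lambda>i j. if i = n \<and> j = n then b else M i j) (insert n J)
      = b * pminor (\<lambda>i j. M i j - M i n * M n j / b) J" if J: "J \<in> Pow {..<n}" for J
  proof -
    let ?M = "\<lambda>i j. if i = n \<and> j = n then b else M i j"
    have "pminor ?M (insert n J) = ?M n n * pminor (\<lambda>i j. ?M i j - ?M i n * ?M n j / ?M n n) J"
      using finite_notin_Pow_lessThan[OF J] assms by (intro pminor_Schur_complement) auto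
    also have "pminor (\<lambda>i j. ?M i j - ?M i n * ?M n j / ?M n n) J = pminor (\<lambda>i j. M i j - M i n * M n j / b) J"
      using finite_notin_Pow_lessThan[OF J] by (intro pminor_cong) auto
    finally show ?thesis by simp
  qed
  then show ?thesis unfolding bordered_lift_def mlift_def sum_distrib_left
    by (intro sum.cong refl) (simp only: mult.left_commute)
qed

lemma (in comm_ring_hom) hom_bordered_lift:
  "hom (bordered_lift n a M b) = bordered_lift n (\<lambda>J. hom (a J)) (\<lambda>i j. hom (M i j)) (hom b)"
  unfolding bordered_lift_def by (simp add: hom_distribs hom_pminor if_distrib)

text \<open>The coefficients of \<open>x\<^sub>n p\<close>.\<close>
definition border_coefs :: "nat \<Rightarrow> (nat set \<Rightarrow> 'a :: comm_ring_1) \<Rightarrow> nat set \<Rightarrow> 'a" where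
  "border_coefs n a J = (if n \<in> J then a (J - {n}) else 0)"

lemma maff_border_coefs: "maff (Suc n) (border_coefs n a) x = x n * maff n a x"
proof -
  have "maff n (border_coefs n a) x = 0" unfolding maff_def
    by (rule sum.neutral) (auto simp: border_coefs_def)
  moreover have "maff n (\<lambda>J. border_coefs n a (insert n J)) x = maff n a x"
    by (rule maff_cong) (auto simp: border_coefs_def intro!: arg_cong[of _ _ a])
  ultimately show ?thesis by (simp add: maff_Suc)
qed

lemma mlift_border_coefs: "mlift (Suc n) (border_coefs n a) M = bordered_lift n a M (M n n)"
proof -
  have "(\<Sum>J\<in>Pow {..<n}. border_coefs n a J * pminor M J) = 0"
    by (rule sum.neutral) (auto simp: border_coefs_def)
  moreover have "border_coefs n a (insert n J) * pminor M (insert n J)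
      = a J * pminor (\<lambda>i j. if i = n \<and> j = n then M n n else M i j) (insert n J)" if "J \<in> Pow {..<n}" for J
  proof -
    have "insert n J - {n} = J" using that by auto
    moreover have "pminor M (insert n J) = pminor (\<lambda>i j. if i = n \<and> j = n then M n n else M i j) (insert n J)"
      by (rule pminor_cong) auto
    ultimately show ?thesis by (simp add: border_coefs_def)
  qed
  ultimately show ?thesis unfolding mlift_def sum_Pow_Suc bordered_lift_def by simp
qed

lemma homog_border_coefs:
  assumes "homog_coefs n d a"
  shows "homog_coefs (Suc n) (Suc d) (border_coefs n a)"
  unfolding homog_coefs_def
proof (intro allI impI)
  fix J assume J: "J \<subseteq> {..<Suc n}" "border_coefs n a J \<noteq> 0"
  then have n: "n \<in> J" and "a (J - {n}) \<noteq> 0" by (auto simp: border_coefs_def split: if_splits)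
  moreover have "J - {n} \<subseteq> {..<n}" using J(1) by (auto simp: lessThan_Suc)
  ultimately have "card (J - {n}) = d" using assms by (simp add: homog_coefs_def)
  moreover have "finite J" using J(1) finite_subset by blast
  ultimately show "card J = Suc d" using n by (metis card.remove)
qed

lemma stable_border_coefs:
  assumes "stable_coefs n a"
  shows "stable_coefs (Suc n) (border_coefs n a)"
  unfolding stable_coefs_def
proof (intro allI impI)
  fix x :: "nat \<Rightarrow> complex" assume x: "\<forall>i<Suc n. Im (x i) > 0"
  have "(\<lambda>J. complex_of_real (border_coefs n a J)) = border_coefs n (\<lambda>J. complex_of_real (a J))"
    by (auto simp: border_coefs_def fun_eq_iff)
  moreover have "maff n (\<lambda>J. complex_of_real (a J)) x \<noteq> 0" using assms x by (simp add: stable_coefs_def)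
  moreover have "x n \<noteq> 0" using x by auto
  ultimately show "maff (Suc n) (\<lambda>J. complex_of_real (border_coefs n a J)) x \<noteq> 0"
    by (simp add: maff_border_coefs)
qed

lemma im_pos_def_rank_one:
  fixes A :: "nat \<Rightarrow> nat \<Rightarrow> real" and c :: "nat \<Rightarrow> real"
  assumes symm: "\<And>i j. i < n \<Longrightarrow> j < n \<Longrightarrow> A i j = A j i" and y: "Im y > 0"
  shows "im_pos_def n (Im s) (\<lambda>i j. of_real (A i j) + (if i = j then s else 0) + y * of_real (c i) * of_real (c j))"
  unfolding im_pos_def_def
proof
  fix v :: "nat \<Rightarrow> complex"
  define Q where "Q = (\<Sum>i<n. \<Sum>j<n. cnj (v i) * of_real (A i j) * v j)"
  define w where "w = (\<Sum>j<n. of_real (c j) * v j)"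
  have "cnj Q = (\<Sum>i<n. \<Sum>j<n. v i * of_real (A i j) * cnj (v j))" by (simp add: Q_def)
  also have "\<dots> = (\<Sum>j<n. \<Sum>i<n. v i * of_real (A i j) * cnj (v j))" by (rule sum.swap)
  also have "\<dots> = Q" unfolding Q_def
    by (intro sum.cong refl) (use symm in \<open>auto simp: mult_ac\<close>)
  finally have Q: "Im Q = 0" by (simp add: complex_eq_iff)
  have "(\<Sum>i<n. \<Sum>j<n. cnj (v i) * (of_real (A i j) + (if i = j then s else 0) + y * of_real (c i) * of_real (c j)) * v j)
      = (\<Sum>i<n. \<Sum>j<n. cnj (v i) * of_real (A i j) * v j + (if i = j then s * (v i * cnj (v i)) else 0)
          + y * ((of_real (c i) * cnj (v i)) * (of_real (c j) * v j)))"
    by (intro sum.cong refl) (auto simp: algebra_simps)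
  also have "\<dots> = Q + (\<Sum>i<n. s * (v i * cnj (v i))) + y * (cnj w * w)"
  proof -
    have "(\<Sum>i<n. \<Sum>j<n. if i = j then s * (v i * cnj (v i)) else 0) = (\<Sum>i<n. s * (v i * cnj (v i)))"
      by simp
    moreover have "(\<Sum>i<n. \<Sum>j<n. y * ((of_real (c i) * cnj (v i)) * (of_real (c j) * v j))) = y * (cnj w * w)"
    proof -
      have "cnj w = (\<Sum>i<n. of_real (c i) * cnj (v i))" by (simp add: w_def)
      then have "cnj w * w = (\<Sum>i<n. \<Sum>j<n. (of_real (c i) * cnj (v i)) * (of_real (c j) * v j))"
        by (simp only: w_def sum_product)
      then show ?thesis by (simp only: sum_distrib_left)
    qed
    ultimately show ?thesis by (simp only: Q_def sum.distrib)
  qed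
  also have "\<dots> = Q + s * of_real (\<Sum>i<n. (cmod (v i))\<^sup>2) + y * of_real ((cmod w)\<^sup>2)"
    by (simp only: complex_norm_square of_real_sum sum_distrib_left mult.commute[of "cnj w"])
  finally have "Im (\<Sum>i<n. \<Sum>j<n. cnj (v i) * (of_real (A i j) + (if i = j then s else 0) + y * of_real (c i) * of_real (c j)) * v j)
      = Im s * (\<Sum>i<n. (cmod (v i))\<^sup>2) + Im y * (cmod w)\<^sup>2"
    using Q by (simp only:) simp
  then show "Im s * (\<Sum>i<n. (cmod (v i))\<^sup>2)
      \<le> Im (\<Sum>i<n. \<Sum>j<n. cnj (v i) * (of_real (A i j) + (if i = j then s else 0) + y * of_real (c i) * of_real (c j)) * v j)"
    using y by simp
qed

lemma spectral_form_commute: "spectral_form n l U i j = spectral_form n l U j i"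
  by (simp add: spectral_form_def mult_ac)

lemma orthogonal_fun_extend:
  assumes V: "orthogonal_fun n V"
  shows "orthogonal_fun (Suc n) (\<lambda>k i. if k < n \<and> i < n then V k i else if k = i then 1 else 0)"
  using V unfolding orthogonal_fun_def by (auto simp: less_Suc_eq)

text \<open>The Schur complement formula, read as a formula for a rank one update. The right-hand side is affine in
  \<open>1 / b\<close>, and this is what produces a pencil of polynomials below.\<close>
lemma bordered_lift_rank_one_update:
  fixes A :: "nat \<Rightarrow> nat \<Rightarrow> 'a :: field"
  assumes b: "b \<noteq> 0"
  shows "mlift n a (\<lambda>i j. shift_diag A s i j - A i n * A n j / b)
    = mlift n a (shift_diag A s) + bordered_lift n a (shift_diag A s) 0 / b"
proof -
  have "b * mlift n a (\<lambda>i j. shift_diag A s i j - A i n * A n j / b)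
      = b * mlift n a (\<lambda>i j. shift_diag A s i j - shift_diag A s i n * shift_diag A s n j / b)"
    by (intro arg_cong2[where f = "(*)"] refl mlift_cong) (auto simp: shift_diag_def)
  also have "\<dots> = b * mlift n a (shift_diag A s) + bordered_lift n a (shift_diag A s) 0"
    using bordered_lift_Schur[OF b, of n a "shift_diag A s"] bordered_lift_affine[of n a "shift_diag A s" b] by simp
  finally show ?thesis using b by (simp add: field_simps)
qed

text \<open>Let \<open>A'\<close> be the leading block of \<open>A\<close>, \<open>v\<close> its last column without the corner \<open>c\<close>, and
  \<open>R(t) = P(A' + tI)\<close>. There is a polynomial \<open>D\<close> with \<open>P(A' + tI + y v v\<^sup>T) = R(t) + y D(t)\<close>, and \<open>R + y D\<close> is a stable pencil because
  the imaginary part of the matrix is positive definite. The lift of \<open>x\<^sub>n p\<close> along the line is \<open>Q = (c + t) R - D\<close>.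
  At the largest root of \<open>(c + t) R\<close>, were it positive, \<open>D \<ge> 0\<close> would contradict \<open>Q > 0\<close>. Hence
  \<open>c \<ge> 0\<close> and \<open>R > 0\<close> on the positive reals, and \<open>D / R\<close> decreases there. From \<open>D / R < c + s\<close> at \<open>s\<close> the same bound follows
  at \<open>s + r\<close>, which is the second claim.\<close>
lemma Schur_complement_in_cone:
  assumes stab: "stable_coefs n a" and homog: "homog_coefs n d a" and one: "maff n a (\<lambda>_. 1) > 0"
    and symm: "\<And>i j. A i j = A j i"
    and nz: "\<And>s. s > 0 \<Longrightarrow> mlift (Suc n) (border_coefs n a) (shift_diag A s) \<noteq> 0"
    and s: "s > 0"
  shows "A n n + s > 0"
    and "\<And>r. r > 0 \<Longrightarrow> mlift n a (\<lambda>i j. shift_diag A (s + r) i j - A i n * A n j / (A n n + s)) \<noteq> 0"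
proof -
  define c where "c = A n n"
  define R where "R = line_mlift n a A"
  define D where "D = - bordered_lift n (\<lambda>J. [:a J:]) (\<lambda>i j. [:A i j, if i = j then 1 else 0:]) 0"
  have R: "poly R t = mlift n a (shift_diag A t)" for t by (simp add: R_def poly_line_mlift)
  have shift: "(\<lambda>i j. poly [:A i j, if i = j then 1 else 0:] t) = shift_diag A t" for t
    by (auto simp: shift_diag_def fun_eq_iff)
  have D: "poly D t = - bordered_lift n a (shift_diag A t) 0" for t
    unfolding D_def poly_minus poly_hom.hom_bordered_lift shift by simp
  have update: "mlift n a (\<lambda>i j. shift_diag A t i j - A i n * A n j / b) = poly R t - poly D t / b" if "b \<noteq> 0" for b t
    using bordered_lift_rank_one_update[OF that, of n a A t] by (simp add: R D)
  define Q where "Q = [:c, 1:] * R - D"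
  have Q: "poly Q t = mlift (Suc n) (border_coefs n a) (shift_diag A t)" for t
    using bordered_lift_affine[of n a "shift_diag A t" "c + t"]
    by (simp add: mlift_border_coefs Q_def R D shift_diag_def c_def algebra_simps)
  have R_ev: "eventually (\<lambda>t. poly R t > 0) at_top"
    unfolding R using mlift_asymptotics[OF homog] one by (rule eventually_pos_of_ratio)
  have Q_ev: "eventually (\<lambda>t. poly Q t > 0) at_top"
    unfolding Q using mlift_asymptotics[OF homog_border_coefs[OF homog]]
    by (rule eventually_pos_of_ratio) (simp add: maff_border_coefs one)
  have Q_pos: "poly Q t > 0" if "t > 0" for t
    using Q_ev by (rule positive_of_no_positive_root) (use nz that in \<open>auto simp: Q\<close>)
  have pencil: "stable_pencil R D"
    unfolding stable_pencil_def
  proof (intro allI impI)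
    fix t y :: complex assume t: "Im t > 0" and y: "Im y > 0"
    let ?A = "\<lambda>i j. complex_of_real (A i j)" and ?a = "\<lambda>J. complex_of_real (a J)"
    interpret rh: comm_ring_hom "\<lambda>f. rpoly f t" by (rule rpoly_hom)
    have rshift: "(\<lambda>i j. rpoly [:A i j, if i = j then 1 else 0:] t) = shift_diag ?A t"
      by (auto simp: shift_diag_def fun_eq_iff rpoly_linear)
    have rD: "rpoly D t = - bordered_lift n ?a (shift_diag ?A t) 0"
      unfolding D_def rh.hom_uminus rh.hom_bordered_lift rshift by (simp add: rpoly_linear)
    have rR: "rpoly R t = mlift n ?a (shift_diag ?A t)" by (simp add: R_def rpoly_line_mlift)
    have y0: "y \<noteq> 0" using y by auto
    then have "mlift n ?a (\<lambda>i j. shift_diag ?A t i j - ?A i n * ?A n j / (- 1 / y)) = rpoly R t + y * rpoly D t"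
      using bordered_lift_rank_one_update[of "- 1 / y" n ?a ?A t] by (simp add: rR rD mult.commute)
    moreover have "mlift n ?a (\<lambda>i j. shift_diag ?A t i j - ?A i n * ?A n j / (- 1 / y)) \<noteq> 0"
    proof (rule mlift_nonzero)
      show "maff n ?a x \<noteq> 0" if "\<And>i. i < n \<Longrightarrow> Im (x i) > 0" for x
        using stab that by (simp add: stable_coefs_def)
      have "im_pos_def n (Im t) (\<lambda>i j. ?A i j + (if i = j then t else 0) + y * complex_of_real (A i n) * complex_of_real (A j n))"
        by (rule im_pos_def_rank_one[where c = "\<lambda>i. A i n", OF symm y])
      moreover have "(\<lambda>i j. shift_diag ?A t i j - ?A i n * ?A n j / (- 1 / y))
          = (\<lambda>i j. ?A i j + (if i = j then t else 0) + y * complex_of_real (A i n) * complex_of_real (A j n))"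
        using symm[of n] by (auto simp: shift_diag_def fun_eq_iff)
      ultimately show "im_pos_def n (Im t) (\<lambda>i j. shift_diag ?A t i j - ?A i n * ?A n j / (- 1 / y))" by simp
    qed (rule t)
    ultimately show "rpoly R t + y * rpoly D t \<noteq> 0" by simp
  qed
  have lim: "((\<lambda>t. poly D t / poly R t) \<longlongrightarrow> 0) at_top"
  proof -
    have "((\<lambda>t. (mlift n a (shift_diag (\<lambda>i j. A i j + A i n * A n j) t) - mlift n a (shift_diag A t)) / mlift n a (shift_diag A t)) \<longlongrightarrow> 0) at_top"
      using one by (intro ratio_tendsto_zero[where d = d and c = "maff n a (\<lambda>_. 1)"] mlift_asymptotics[OF homog]) auto
    moreover have "mlift n a (shift_diag (\<lambda>i j. A i j + A i n * A n j) t) - mlift n a (shift_diag A t) = poly D t" for t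
    proof -
      have "mlift n a (shift_diag (\<lambda>i j. A i j + A i n * A n j) t)
          = mlift n a (\<lambda>i j. shift_diag A t i j - A i n * A n j / (- 1))"
        by (intro mlift_cong) (auto simp: shift_diag_def)
      then show ?thesis using update[of "- 1" t] by (simp add: R)
    qed
    ultimately show ?thesis by (simp add: R)
  qed
  define G where "G = [:c, 1:] * R"
  have G: "poly G t = (c + t) * poly R t" for t by (simp add: G_def algebra_simps)
  have c_ev: "eventually (\<lambda>t. c + t > 0) at_top"
    using eventually_gt_at_top[of "- c"] by eventually_elim simp
  have G_ev: "eventually (\<lambda>t. poly G t > 0) at_top"
    using R_ev c_ev by eventually_elim (simp add: G)
  have G_nz: "poly G x \<noteq> 0" if x: "x > 0" for x
  proof
    assume "poly G x = 0"
    from largest_root[OF this G_ev] obtain r where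
      r: "poly G r = 0" "x \<le> r" and pos: "\<And>t. t > r \<Longrightarrow> poly G t > 0" by blast
    have r0: "r > 0" using r(2) x by simp
    have "c + t > 0" if "t > r" for t
    proof (rule ccontr)
      assume "\<not> c + t > 0"
      then have "- c > r" using pos[OF that] that by (cases "c + t = 0") (auto simp: G)
      from pos[OF this] show False by (simp add: G)
    qed
    then have Rpos: "poly R t > 0" if "t > r" for t
      using pos[OF that] that by (simp add: G zero_less_mult_iff) (metis less_asym)
    have Dpos: "poly D t \<ge> 0" if "t > r" for t
      using stable_pencil_ratio_decreasing(2)[OF pencil Rpos lim that order_refl] .
    have "(poly D \<longlongrightarrow> poly D r) (at_right r)"
    proof -
      have "isCont (poly D) r" by simp
      then show ?thesis by (simp add: isCont_def filterlim_at_split)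
    qed
    moreover have "eventually (\<lambda>t. 0 \<le> poly D t) (at_right r)"
      using Dpos by (simp add: eventually_at_filter)
    ultimately have "poly D r \<ge> 0" by (intro tendsto_lowerbound[where F = "at_right r"]) auto
    moreover have "poly Q r = - poly D r" using r(1) by (simp add: Q_def G_def)
    ultimately show False using Q_pos[OF r0] by simp
  qed
  have c0: "c + t > 0" if "t > 0" for t
  proof (rule ccontr)
    assume "\<not> c + t > 0"
    then have "- c > 0" using that by simp
    from G_nz[OF this] show False by (simp add: G)
  qed
  have Rpos: "poly R t > 0" if "t > 0" for t
    using R_ev by (rule positive_of_no_positive_root) (use G_nz that in \<open>auto simp: G\<close>)
  show "A n n + s > 0" using c0[OF s] by (simp add: c_def)
  fix r :: real assume r: "r > 0"
  have "poly D (s + r) / poly R (s + r) \<le> poly D s / poly R s"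
    using stable_pencil_ratio_decreasing(1)[OF pencil Rpos lim s, of "s + r"] r by simp
  also have "\<dots> < c + s"
    using Q_pos[OF s] Rpos[OF s] by (simp add: Q_def field_simps)
  finally have "poly D (s + r) / (c + s) < poly R (s + r)"
    using Rpos[of "s + r"] c0[OF s] r s by (simp add: field_simps)
  then have "poly R (s + r) - poly D (s + r) / (c + s) \<noteq> 0" by simp
  moreover have "c + s \<noteq> 0" using c0[OF s] by simp
  ultimately have "mlift n a (\<lambda>i j. shift_diag A (s + r) i j - A i n * A n j / (c + s)) \<noteq> 0"
    by (simp only: update not_False_eq_True)
  then show "mlift n a (\<lambda>i j. shift_diag A (s + r) i j - A i n * A n j / (A n n + s)) \<noteq> 0"
    by (simp add: c_def)
qed

text \<open>Completing the square: the difference of the two quadratic forms is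
  \<open>M n n (x n + t / M n n)\<^sup>2\<close> with \<open>t = \<Sum>i<n. M i n * x i\<close>.\<close>
lemma bordered_quadratic_form_ge:
  fixes M :: "nat \<Rightarrow> nat \<Rightarrow> real"
  assumes symm: "\<And>i. M i n = M n i" and b: "M n n > 0"
  shows "(\<Sum>i<n. \<Sum>j<n. (M i j - M i n * M n j / M n n) * (x i * x j))
    \<le> (\<Sum>i<Suc n. \<Sum>j<Suc n. M i j * (x i * x j))"
proof -
  define t where "t = (\<Sum>i<n. M i n * x i)"
  have t': "(\<Sum>i<n. M n i * x i) = t"
    unfolding t_def by (rule sum.cong[OF refl]) (simp only: symm)
  have c1: "(\<Sum>i<n. M i n * (x i * x n)) = t * x n"
    by (simp only: t_def sum_distrib_right mult.assoc)
  have c2: "(\<Sum>j<n. M n j * (x n * x j)) = x n * t"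
    by (simp only: t'[symmetric] sum_distrib_left mult.left_commute)
  have "(\<Sum>i<Suc n. \<Sum>j<Suc n. M i j * (x i * x j))
      = (\<Sum>i<n. \<Sum>j<n. M i j * (x i * x j)) + (t * x n + x n * t + M n n * (x n * x n))"
    by (simp only: sum.lessThan_Suc sum.distrib c1 c2 add.assoc)
  moreover have "(\<Sum>i<n. \<Sum>j<n. (M i j - M i n * M n j / M n n) * (x i * x j))
      = (\<Sum>i<n. \<Sum>j<n. M i j * (x i * x j)) - t * t / M n n"
  proof -
    have "(\<Sum>i<n. \<Sum>j<n. (M i n * x i) * (M n j * x j) / M n n)
        = (\<Sum>i<n. M i n * x i) * (\<Sum>j<n. M n j * x j) / M n n"
      by (simp only: sum_product sum_divide_distrib)
    also have "\<dots> = t * t / M n n" by (simp only: t' t_def[symmetric])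
    moreover have "(\<Sum>i<n. \<Sum>j<n. (M i j - M i n * M n j / M n n) * (x i * x j))
        = (\<Sum>i<n. \<Sum>j<n. M i j * (x i * x j) - (M i n * x i) * (M n j * x j) / M n n)"
      by (intro sum.cong refl) (simp add: algebra_simps)
    ultimately show ?thesis by (simp only: sum_subtractf)
  qed
  moreover have "t * x n + x n * t + M n n * (x n * x n) + t * t / M n n = M n n * (x n + t / M n n)\<^sup>2"
    using b by (simp add: power2_eq_square field_simps)
  moreover have "\<dots> \<ge> 0" using b by simp
  ultimately show ?thesis by simp
qed

text \<open>For each \<open>s > 0\<close> the eigenvalues of \<open>A + sI\<close>, in some order, dominate those of \<open>B \<oplus> 0\<close>, where \<open>B\<close> is the Schur
  complement. This places \<open>l \<circ> \<sigma> + s\<one>\<close> in the cone of \<open>x\<^sub>n p\<close>, with \<open>\<sigma>\<close> depending on \<open>s\<close>. There are finitely many \<open>\<sigma>\<close>,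
  so an \<open>s\<close> below all positive roots of the \<open>f\<^sub>\<sigma>\<close> shows that some \<open>f\<^sub>\<sigma>\<close> has no positive root.\<close>
theorem border_contains_spectra:
  assumes stab: "stable_coefs n a" and homog: "homog_coefs n d a" and one: "maff n a (\<lambda>_. 1) > 0"
    and SC: "\<And>B. B \<in> sym_mats n \<Longrightarrow>
      (\<And>s. s > 0 \<Longrightarrow> mlift n a (\<lambda>i j. B $$ (i, j) + (if i = j then s else 0)) \<noteq> 0) \<Longrightarrow>
      \<exists>m :: real vec. eigenvalue_vector B m \<and> (\<forall>s>0. maff n a (\<lambda>i. m $ i + s) \<noteq> 0)"
  shows "contains_spectra (Suc n) (border_coefs n a)"
  unfolding contains_spectra_def
proof (intro allI impI)
  fix l U assume U: "orthogonal_fun (Suc n) U"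
    and nz: "\<forall>s>0. mlift (Suc n) (border_coefs n a) (shift_diag (spectral_form (Suc n) l U) s) \<noteq> 0"
  define A where "A = spectral_form (Suc n) l U"
  have symm: "A i j = A j i" for i j unfolding A_def by (rule spectral_form_commute)
  let ?S = "{\<sigma>. \<sigma> permutes {..<Suc n}}"
  have step: "\<exists>\<sigma>\<in>?S. \<forall>r>0. maff (Suc n) (border_coefs n a) (\<lambda>i. l (\<sigma> i) + s + r) \<noteq> 0" if s: "s > 0" for s
  proof -
    define b where "b = A n n + s"
    have nzA: "\<And>s. s > 0 \<Longrightarrow> mlift (Suc n) (border_coefs n a) (shift_diag A s) \<noteq> 0"
      using nz by (simp add: A_def)
    have b: "b > 0"
      unfolding b_def using nzA by (intro Schur_complement_in_cone(1)[OF stab homog one symm _ s])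
    define B where "B = mat n n (\<lambda>(i, j). shift_diag A s i j - A i n * A n j / b)"
    have B: "B \<in> sym_mats n"
      unfolding sym_mats_def by (auto simp: B_def shift_diag_def symm intro!: eq_matI)
    have "mlift n a (\<lambda>i j. B $$ (i, j) + (if i = j then r else 0)) \<noteq> 0" if r: "r > 0" for r
    proof -
      have "mlift n a (\<lambda>i j. B $$ (i, j) + (if i = j then r else 0))
          = mlift n a (\<lambda>i j. shift_diag A (s + r) i j - A i n * A n j / b)"
        by (intro mlift_cong) (auto simp: B_def shift_diag_def)
      moreover have "\<dots> \<noteq> 0"
        unfolding b_def using nzA by (intro Schur_complement_in_cone(2)[OF stab homog one symm _ s r])
      ultimately show ?thesis by simp
    qed
    from SC[OF B this] obtain m :: "real vec" where m: "eigenvalue_vector B m"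
      and m_cone: "\<And>r. r > 0 \<Longrightarrow> maff n a (\<lambda>i. m $ i + r) \<noteq> 0" by blast
    obtain V where V: "orthogonal_fun n V"
      and BV: "\<And>i j. i < n \<Longrightarrow> j < n \<Longrightarrow> B $$ (i, j) = (\<Sum>k<n. m $ k * V k i * V k j)"
      using spectral_decomposition[OF B m] by blast
    \<comment> \<open>The eigenvectors and eigenvalues of \<open>B \<oplus> 0\<close>.\<close>
    define V' where "V' = (\<lambda>k i. if k < n \<and> i < n then V k i else if k = i then 1 else 0)"
    define m' where "m' = (\<lambda>k. if k < n then m $ k else 0)"
    have V': "orthogonal_fun (Suc n) V'" unfolding V'_def by (rule orthogonal_fun_extend[OF V])
    have "\<exists>\<sigma>. \<sigma> permutes {..<Suc n} \<and> (\<forall>k<Suc n. m' k \<le> l (\<sigma> k) + s)"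
    proof (rule eigenvalue_monotonicity[OF U V', of m' "\<lambda>k. l k + s"])
      fix x
      have "(\<Sum>k<Suc n. m' k * (\<Sum>i<Suc n. V' k i * x i)\<^sup>2) = (\<Sum>k<n. m $ k * (\<Sum>i<n. V k i * x i)\<^sup>2)"
        by (simp add: m'_def V'_def)
      also have "\<dots> = (\<Sum>i<n. \<Sum>j<n. B $$ (i, j) * (x i * x j))"
        unfolding spectral_form_quadratic[symmetric]
        by (intro sum.cong refl) (simp add: BV spectral_form_def)
      also have "\<dots> = (\<Sum>i<n. \<Sum>j<n. (shift_diag A s i j - shift_diag A s i n * shift_diag A s n j / shift_diag A s n n) * (x i * x j))"
        by (intro sum.cong refl) (auto simp: B_def shift_diag_def b_def)
      also have "\<dots> \<le> (\<Sum>i<Suc n. \<Sum>j<Suc n. shift_diag A s i j * (x i * x j))"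
        using b by (intro bordered_quadratic_form_ge) (auto simp: shift_diag_def symm b_def)
      also have "\<dots> = (\<Sum>i<Suc n. \<Sum>j<Suc n. spectral_form (Suc n) (\<lambda>k. l k + s) U i j * (x i * x j))"
        unfolding A_def by (intro sum.cong refl) (simp only: shift_diag_spectral_form[OF U] lessThan_iff)
      also have "\<dots> = (\<Sum>k<Suc n. (l k + s) * (\<Sum>i<Suc n. U k i * x i)\<^sup>2)"
        by (rule spectral_form_quadratic)
      finally show "(\<Sum>k<Suc n. m' k * (\<Sum>i<Suc n. V' k i * x i)\<^sup>2) \<le> (\<Sum>k<Suc n. (l k + s) * (\<Sum>i<Suc n. U k i * x i)\<^sup>2)" .
    qed
    then obtain \<sigma> where \<sigma>: "\<sigma> permutes {..<Suc n}" "\<And>k. k < Suc n \<Longrightarrow> m' k \<le> l (\<sigma> k) + s" by blast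
    have "maff (Suc n) (border_coefs n a) (\<lambda>i. l (\<sigma> i) + s + r) \<noteq> 0" if r: "r > 0" for r
    proof -
      have "l (\<sigma> n) + s + r \<noteq> 0" using \<sigma>(2)[of n] r by (simp add: m'_def)
      moreover have "maff n a (\<lambda>i. l (\<sigma> i) + s + r) \<noteq> 0"
      proof (rule cone_mono[OF stab homog one m_cone _ r])
        show "m $ i \<le> l (\<sigma> i) + s" if "i < n" for i using \<sigma>(2)[of i] that by (simp add: m'_def)
      qed
      ultimately show ?thesis by (simp add: maff_border_coefs)
    qed
    then show ?thesis using \<sigma>(1) by blast
  qed
  show "\<exists>\<sigma>. \<sigma> permutes {..<Suc n} \<and> (\<forall>s>0. maff (Suc n) (border_coefs n a) (\<lambda>i. l (\<sigma> i) + s) \<noteq> 0)"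
  proof (rule ccontr)
    assume "\<not> ?thesis"
    then have "\<forall>\<sigma>\<in>?S. \<exists>s>0. maff (Suc n) (border_coefs n a) (\<lambda>i. l (\<sigma> i) + s) = 0" by blast
    then obtain r where r: "\<And>\<sigma>. \<sigma> \<in> ?S \<Longrightarrow> r \<sigma> > 0"
      "\<And>\<sigma>. \<sigma> \<in> ?S \<Longrightarrow> maff (Suc n) (border_coefs n a) (\<lambda>i. l (\<sigma> i) + r \<sigma>) = 0" by metis
    have fin: "finite ?S" by (rule finite_permutations) simp
    have ne: "?S \<noteq> {}" using permutes_id by blast
    \<comment> \<open>Half of the minimum, so that every root \<open>r \<sigma>\<close> is still at a positive distance from \<open>s\<close>.\<close>
    define s where "s = Min (r ` ?S) / 2"
    have s: "s > 0" using fin ne r(1) by (simp add: s_def)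
    from step[OF s] obtain \<sigma> where \<sigma>: "\<sigma> \<in> ?S"
      and c: "\<And>t. t > 0 \<Longrightarrow> maff (Suc n) (border_coefs n a) (\<lambda>i. l (\<sigma> i) + s + t) \<noteq> 0" by blast
    have "2 * s \<le> r \<sigma>" using fin \<sigma> by (simp add: s_def)
    then have "r \<sigma> - s > 0" using s by simp
    from c[OF this] show False using r(2)[OF \<sigma>] by simp
  qed
qed

section \<open>Stability of perturbed elementary symmetric polynomials\<close>

lemma blossom_const:
  assumes "finite K"
  shows "blossom K c (\<lambda>_. y) = (\<Sum>j\<le>card K. of_nat (card K choose j) * c j * y ^ j)"
proof -
  have "blossom K c (\<lambda>_. y) = (\<Sum>J\<in>Pow K. c (card J) * y ^ card J)" by (simp add: blossom_def)
  also have "\<dots> = (\<Sum>j\<le>card K. \<Sum>J\<in>{J \<in> Pow K. card J = j}. c (card J) * y ^ card J)"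
    using assms by (intro sum.group[symmetric]) (auto intro: card_mono)
  also have "\<dots> = (\<Sum>j\<le>card K. of_nat (card K choose j) * c j * y ^ j)"
  proof (intro sum.cong refl)
    fix j
    have "(\<Sum>J\<in>{J \<in> Pow K. card J = j}. c (card J) * y ^ card J) = (\<Sum>J\<in>{J \<in> Pow K. card J = j}. c j * y ^ j)"
      by (intro sum.cong) auto
    also have "\<dots> = of_nat (card {J \<in> Pow K. card J = j}) * (c j * y ^ j)" by simp
    also have "card {J \<in> Pow K. card J = j} = card K choose j"
      using n_subsets[OF assms, of j] by (simp add: Pow_def)
    finally show "(\<Sum>J\<in>{J \<in> Pow K. card J = j}. c (card J) * y ^ card J) = of_nat (card K choose j) * c j * y ^ j"
      by (simp add: mult.assoc)
  qed
  finally show ?thesis .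
qed

text \<open>The polynomials that are symmetric and multiaffine in each of two groups of variables. The polynomials
  \<open>e\<^sub>d + \<epsilon> e\<^sub>d(x\<^sub>1, \<dots>, x\<^sub>k)\<close> are of this kind, for the groups \<open>{..<k}\<close> and \<open>{k..<n}\<close>.\<close>
definition blossom2 :: "'i set \<Rightarrow> 'i set \<Rightarrow> (nat \<Rightarrow> nat \<Rightarrow> 'a :: comm_ring_1) \<Rightarrow> ('i \<Rightarrow> 'a) \<Rightarrow> ('i \<Rightarrow> 'a) \<Rightarrow> 'a" where
  "blossom2 K Z c y z = (\<Sum>J\<in>Pow K. \<Sum>L\<in>Pow Z. c (card J) (card L) * (\<Prod>i\<in>J. y i) * (\<Prod>i\<in>L. z i))"

lemma blossom2_left: "blossom2 K Z c y z = blossom K (\<lambda>i. blossom Z (c i) z) y"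
  unfolding blossom2_def blossom_def sum_distrib_right
  by (intro sum.cong refl) (simp add: mult_ac)

lemma blossom2_right: "blossom2 K Z c y z = blossom Z (\<lambda>j. blossom K (\<lambda>i. c i j) y) z"
  unfolding blossom2_def blossom_def sum_distrib_right by (rule sum.swap)

text \<open>The polynomial is a polar form in each group separately, so the one-group theorem applies first to \<open>y\<close>
  with \<open>z\<close> on the diagonal, and then to \<open>z\<close>.\<close>
theorem Grace_Walsh_Szego2:
  fixes c :: "nat \<Rightarrow> nat \<Rightarrow> complex"
  assumes K: "finite K" and Z: "finite Z"
    and diag: "\<And>\<eta> \<zeta>. Im \<eta> > 0 \<Longrightarrow> Im \<zeta> > 0 \<Longrightarrow> blossom2 K Z c (\<lambda>_. \<eta>) (\<lambda>_. \<zeta>) \<noteq> 0"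
    and y: "\<And>i. i \<in> K \<Longrightarrow> Im (y i) > 0" and z: "\<And>i. i \<in> Z \<Longrightarrow> Im (z i) > 0"
  shows "blossom2 K Z c y z \<noteq> 0"
proof -
  have "blossom2 K Z c y (\<lambda>_. \<zeta>) \<noteq> 0" if \<zeta>: "Im \<zeta> > 0" for \<zeta>
    unfolding blossom2_left
  proof (rule Grace_Walsh_Szego[OF K _ y])
    fix \<eta> :: complex assume "Im \<eta> > 0"
    from diag[OF this \<zeta>]
    show "(\<Sum>j\<le>card K. of_nat (card K choose j) * blossom Z (c j) (\<lambda>_. \<zeta>) * \<eta> ^ j) \<noteq> 0"
      unfolding blossom2_left blossom_const[OF K] .
  qed
  then show ?thesis
    unfolding blossom2_right blossom_const[OF Z]
    by (intro Grace_Walsh_Szego[OF Z _ z]) auto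
qed

lemma maff_eq_blossom2:
  fixes a :: "nat set \<Rightarrow> 'a :: comm_ring_1"
  assumes k: "k \<le> n"
    and a: "\<And>J L. J \<subseteq> {..<k} \<Longrightarrow> L \<subseteq> {k..<n} \<Longrightarrow> a (J \<union> L) = c (card J) (card L)"
  shows "maff n a x = blossom2 {..<k} {k..<n} c x x"
proof -
  let ?P = "Pow {..<k} \<times> Pow {k..<n}"
  have "bij_betw (\<lambda>(J, L). J \<union> L) ?P (Pow {..<n})"
  proof (rule bij_betw_byWitness[where f' = "\<lambda>I. (I \<inter> {..<k}, I \<inter> {k..<n})"])
    show "\<forall>p\<in>?P. ((case p of (J, L) \<Rightarrow> J \<union> L) \<inter> {..<k}, (case p of (J, L) \<Rightarrow> J \<union> L) \<inter> {k..<n}) = p"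
      by force
    show "\<forall>I\<in>Pow {..<n}. (case (I \<inter> {..<k}, I \<inter> {k..<n}) of (J, L) \<Rightarrow> J \<union> L) = I" by fastforce
    show "(\<lambda>(J, L). J \<union> L) ` ?P \<subseteq> Pow {..<n}" using k by fastforce
    show "(\<lambda>I. (I \<inter> {..<k}, I \<inter> {k..<n})) ` Pow {..<n} \<subseteq> ?P" by auto
  qed
  then have "maff n a x = (\<Sum>p\<in>?P. a (case p of (J, L) \<Rightarrow> J \<union> L) * (\<Prod>i\<in>(case p of (J, L) \<Rightarrow> J \<union> L). x i))"
    unfolding maff_def by (rule sum.reindex_bij_betw[symmetric])
  also have "\<dots> = (\<Sum>(J, L)\<in>?P. c (card J) (card L) * (\<Prod>i\<in>J. x i) * (\<Prod>i\<in>L. x i))"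
  proof (intro sum.cong refl)
    fix p assume p: "p \<in> ?P"
    obtain J L where JL: "p = (J, L)" by (cases p)
    then have sub: "J \<subseteq> {..<k}" "L \<subseteq> {k..<n}" using p by auto
    have "J \<inter> L \<subseteq> {..<k} \<inter> {k..<n}" using sub by blast
    also have "\<dots> = {}" by auto
    finally have "finite J" "finite L" "J \<inter> L = {}" using sub by (auto intro: finite_subset)
    then have "(\<Prod>i\<in>J \<union> L. x i) = (\<Prod>i\<in>J. x i) * (\<Prod>i\<in>L. x i)" by (rule prod.union_disjoint)
    then show "a (case p of (J, L) \<Rightarrow> J \<union> L) * (\<Prod>i\<in>(case p of (J, L) \<Rightarrow> J \<union> L). x i)
        = (case p of (J, L) \<Rightarrow> c (card J) (card L) * (\<Prod>i\<in>J. x i) * (\<Prod>i\<in>L. x i))"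
      using a[OF sub] by (simp add: JL mult.assoc)
  qed
  finally show ?thesis by (simp add: blossom2_def sum.cartesian_product)
qed

definition elem_coefs :: "nat \<Rightarrow> nat set \<Rightarrow> real" where
  "elem_coefs d J = (if card J = d then 1 else 0)"

text \<open>The coefficients of \<open>e\<^sub>d(x\<^sub>1, \<dots>, x\<^sub>n) + \<epsilon> e\<^sub>d(x\<^sub>1, \<dots>, x\<^sub>k)\<close>, by one formula for all \<open>n \<ge> k\<close>.\<close>
definition pert_coefs :: "nat \<Rightarrow> nat \<Rightarrow> real \<Rightarrow> nat set \<Rightarrow> real" where
  "pert_coefs d k \<epsilon> J = elem_coefs d J + \<epsilon> * (if J \<subseteq> {..<k} \<and> card J = d then 1 else 0)"

text \<open>\<open>e\<^sub>d\<close> at \<open>k\<close> ones and \<open>m\<close> copies of \<open>z\<close>; up to a factor this is the hypergeometric polynomial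
  \<open>\<^sub>2F\<^sub>1(-d, -m; k - d + 1; z)\<close>.\<close>
definition diag_poly :: "nat \<Rightarrow> nat \<Rightarrow> nat \<Rightarrow> real poly" where
  "diag_poly d k m = (\<Sum>j\<le>d. monom (of_nat (k choose (d - j)) * of_nat (m choose j)) j)"

lemma coeff_diag_poly:
  "coeff (diag_poly d k m) j = (if j \<le> d then of_nat (k choose (d - j)) * of_nat (m choose j) else 0)"
  by (simp add: diag_poly_def coeff_sum)

lemma maff_pert_coefs:
  assumes k: "k \<le> n" and d: "d \<ge> 1"
  shows "maff n (\<lambda>J. complex_of_real (pert_coefs d k \<epsilon> J)) x
    = blossom2 {..<k} {k..<n} (\<lambda>i j. (if i + j = d then 1 else 0) + of_real \<epsilon> * (if i = d \<and> j = 0 then 1 else 0)) x x"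
proof (rule maff_eq_blossom2[OF k])
  fix J L :: "nat set" assume JL: "J \<subseteq> {..<k}" "L \<subseteq> {k..<n}"
  have "J \<inter> L \<subseteq> {..<k} \<inter> {k..<n}" using JL by blast
  also have "\<dots> = {}" by auto
  finally have fin: "finite J" "finite L" and disj: "J \<inter> L = {}" using JL by (auto intro: finite_subset)
  have card: "card (J \<union> L) = card J + card L" by (rule card_Un_disjoint[OF fin disj])
  have "L \<subseteq> {..<k} \<longleftrightarrow> L = {}"
  proof
    assume "L \<subseteq> {..<k}"
    then have "L \<subseteq> {..<k} \<inter> {k..<n}" using JL by blast
    also have "\<dots> = {}" by auto
    finally show "L = {}" by simp
  qed simp
  then have "J \<union> L \<subseteq> {..<k} \<longleftrightarrow> card L = 0"
    using JL fin by simp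
  then show "complex_of_real (pert_coefs d k \<epsilon> (J \<union> L))
      = (if card J + card L = d then 1 else 0) + of_real \<epsilon> * (if card J = d \<and> card L = 0 then 1 else 0)"
    by (auto simp: pert_coefs_def elem_coefs_def card)
qed

text \<open>At \<open>k\<close> copies of \<open>Y\<close> and \<open>n - k\<close> copies of \<open>W\<close>, homogeneity leaves a function of the quotient \<open>W / Y\<close>, and the perturbation
  only changes its constant term.\<close>
lemma blossom2_const:
  assumes k: "k \<le> n" and d: "d \<le> k" and Y: "Y \<noteq> 0"
  shows "blossom2 {..<k} {k..<n} (\<lambda>i j. (if i + j = d then 1 else 0) + \<epsilon> * (if i = d \<and> j = 0 then 1 else 0)) (\<lambda>_. Y) (\<lambda>_. W)
    = Y ^ d * (rpoly (diag_poly d k (n - k)) (W / Y) + \<epsilon> * of_nat (k choose d))"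
proof -
  define m where "m = n - k"
  let ?c = "\<lambda>i j. (if i + j = d then 1 else 0) + \<epsilon> * (if i = d \<and> j = 0 then 1 else 0) :: complex"
  have "blossom2 {..<k} {k..<n} ?c (\<lambda>_. Y) (\<lambda>_. W)
      = (\<Sum>j\<le>m. of_nat (m choose j) * (\<Sum>i\<le>k. of_nat (k choose i) * ?c i j * Y ^ i) * W ^ j)"
    unfolding blossom2_right by (simp add: blossom_const m_def)
  also have "\<dots> = (\<Sum>j\<le>m. (if j \<le> d then of_nat (m choose j) * (of_nat (k choose (d - j)) * Y ^ (d - j)) * W ^ j else 0)
      + (if j = 0 then \<epsilon> * of_nat (k choose d) * Y ^ d else 0))"
  proof (intro sum.cong refl)
    fix j
    have "(\<Sum>i\<le>k. of_nat (k choose i) * ?c i j * Y ^ i)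
        = (\<Sum>i\<le>k. (if i = d - j then (if j \<le> d then of_nat (k choose i) * Y ^ i else 0) else 0)
          + (if i = d then (if j = 0 then \<epsilon> * of_nat (k choose i) * Y ^ i else 0) else 0))"
      by (intro sum.cong refl) (auto simp: algebra_simps)
    also have "\<dots> = (if j \<le> d then of_nat (k choose (d - j)) * Y ^ (d - j) else 0)
        + (if j = 0 then \<epsilon> * of_nat (k choose d) * Y ^ d else 0)"
    proof -
      have "d - j \<le> k" using d by simp
      then show ?thesis using d by (simp add: sum.distrib)
    qed
    finally show "of_nat (m choose j) * (\<Sum>i\<le>k. of_nat (k choose i) * ?c i j * Y ^ i) * W ^ j
        = (if j \<le> d then of_nat (m choose j) * (of_nat (k choose (d - j)) * Y ^ (d - j)) * W ^ j else 0)
          + (if j = 0 then \<epsilon> * of_nat (k choose d) * Y ^ d else 0)"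
      by (simp add: algebra_simps)
  qed
  also have "\<dots> = (\<Sum>j\<le>m. if j \<le> d then of_nat (m choose j) * (of_nat (k choose (d - j)) * Y ^ (d - j)) * W ^ j else 0)
      + \<epsilon> * of_nat (k choose d) * Y ^ d"
    by (simp add: sum.distrib)
  also have "(\<Sum>j\<le>m. if j \<le> d then of_nat (m choose j) * (of_nat (k choose (d - j)) * Y ^ (d - j)) * W ^ j else 0)
      = (\<Sum>j\<le>d. of_nat (m choose j) * (of_nat (k choose (d - j)) * Y ^ (d - j)) * W ^ j)"
    by (rule sum.mono_neutral_cong) (auto simp: not_le binomial_eq_0)
  also have "\<dots> = Y ^ d * rpoly (diag_poly d k m) (W / Y)"
  proof -
    have "rpoly (diag_poly d k m) (W / Y) = (\<Sum>j\<le>d. of_nat (k choose (d - j)) * of_nat (m choose j) * (W / Y) ^ j)"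
    proof -
      interpret rh: comm_ring_hom "\<lambda>f. rpoly f (W / Y)" by (rule rpoly_hom)
      show ?thesis unfolding diag_poly_def rh.hom_sum
        by (intro sum.cong refl) (simp add: rpoly_def map_poly_monom poly_monom)
    qed
    moreover have "of_nat (m choose j) * (of_nat (k choose (d - j)) * Y ^ (d - j)) * W ^ j
        = Y ^ d * (of_nat (k choose (d - j)) * of_nat (m choose j) * (W / Y) ^ j)" if "j \<le> d" for j
      using Y that by (simp add: power_divide power_diff)
    then have "(\<Sum>j\<le>d. of_nat (m choose j) * (of_nat (k choose (d - j)) * Y ^ (d - j)) * W ^ j)
        = (\<Sum>j\<le>d. Y ^ d * (of_nat (k choose (d - j)) * of_nat (m choose j) * (W / Y) ^ j))"
      by (intro sum.cong refl) simp_all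
    ultimately show ?thesis by (simp only: sum_distrib_left)
  qed
  finally show ?thesis by (simp add: m_def algebra_simps)
qed

lemma stable_coefsD:
  assumes "stable_coefs n a" "\<And>i. i < n \<Longrightarrow> Im (x i) > 0"
  shows "maff n (\<lambda>J. complex_of_real (a J)) x \<noteq> 0"
  using assms by (simp add: stable_coefs_def)

lemma elem_coefs_stable:
  assumes "d \<le> n"
  shows "stable_coefs n (elem_coefs d)"
  unfolding stable_coefs_def
proof (intro allI impI)
  fix x :: "nat \<Rightarrow> complex" assume x: "\<forall>i<n. Im (x i) > 0"
  let ?c = "\<lambda>j. if j = d then 1 else 0 :: complex"
  have "maff n (\<lambda>J. complex_of_real (elem_coefs d J)) x = blossom {..<n} ?c x"
    unfolding maff_def blossom_def by (intro sum.cong refl) (simp add: elem_coefs_def)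
  moreover have "blossom {..<n} ?c x \<noteq> 0"
  proof (rule Grace_Walsh_Szego)
    fix \<zeta> :: complex assume \<zeta>: "Im \<zeta> > 0"
    have "(\<Sum>j\<le>n. of_nat (n choose j) * ?c j * \<zeta> ^ j) = (\<Sum>j\<le>n. if j = d then of_nat (n choose j) * \<zeta> ^ j else 0)"
      by (intro sum.cong) auto
    also have "\<dots> = of_nat (n choose d) * \<zeta> ^ d" using assms by simp
    finally show "(\<Sum>j\<le>card {..<n}. of_nat (card {..<n} choose j) * ?c j * \<zeta> ^ j) \<noteq> 0"
      using \<zeta> assms by auto
  qed (use x in auto)
  ultimately show "maff n (\<lambda>J. complex_of_real (elem_coefs d J)) x \<noteq> 0" by simp
qed

lemma diag_poly_real_rooted:
  assumes d: "1 \<le> d" "d \<le> k" and z: "Im z \<noteq> 0"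
  shows "rpoly (diag_poly d k m) z \<noteq> 0"
proof
  assume zero: "rpoly (diag_poly d k m) z = 0"
  define \<eta> where "\<eta> = \<bar>Im z\<bar> / (2 * (\<bar>Re z\<bar> + 1))"
  have \<eta>: "\<eta> > 0" using z by (simp add: \<eta>_def)
  define Y where "Y = Complex (sgn (Im z)) \<eta>"
  have ImY: "Im Y > 0" using \<eta> by (simp add: Y_def)
  then have Y0: "Y \<noteq> 0" by auto
  have ImW: "Im (z * Y) > 0"
  proof -
    have "\<bar>Re z * \<eta>\<bar> \<le> \<bar>Im z\<bar> / 2"
    proof -
      have "\<bar>Re z\<bar> * \<eta> \<le> (\<bar>Re z\<bar> + 1) * \<eta>" using \<eta> by simp
      also have "\<dots> = \<bar>Im z\<bar> / 2"
      proof -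
        define D where "D = \<bar>Re z\<bar> + 1"
        have "D > 0" by (simp add: D_def)
        then have "D * (\<bar>Im z\<bar> / (2 * D)) = \<bar>Im z\<bar> / 2" by simp
        then show ?thesis by (simp only: \<eta>_def D_def)
      qed
      finally show ?thesis using \<eta> by (simp add: abs_mult)
    qed
    moreover have "Im (z * Y) = Re z * \<eta> + \<bar>Im z\<bar>" by (simp add: Y_def abs_sgn)
    ultimately show ?thesis using z by linarith
  qed
  let ?n = "k + m"
  let ?x = "\<lambda>i. if i < k then Y else z * Y"
  have "maff ?n (\<lambda>J. complex_of_real (pert_coefs d k 0 J)) ?x
      = blossom2 {..<k} {k..<?n} (\<lambda>i j. (if i + j = d then 1 else 0) + of_real 0 * (if i = d \<and> j = 0 then 1 else 0)) ?x ?x"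
    using d by (intro maff_pert_coefs) auto
  also have "\<dots> = blossom2 {..<k} {k..<?n} (\<lambda>i j. (if i + j = d then 1 else 0) + 0 * (if i = d \<and> j = 0 then 1 else 0)) (\<lambda>_. Y) (\<lambda>_. z * Y)"
    unfolding blossom2_def
    by (intro sum.cong refl arg_cong2[where f = "(*)"] prod.cong) auto
  also have "\<dots> = Y ^ d * (rpoly (diag_poly d k (?n - k)) (z * Y / Y) + 0 * of_nat (k choose d))"
    using d Y0 by (intro blossom2_const) auto
  also have "\<dots> = 0" using zero Y0 by simp
  finally have vanish: "maff ?n (\<lambda>J. complex_of_real (elem_coefs d J)) ?x = 0" by (simp add: pert_coefs_def)
  have "stable_coefs ?n (elem_coefs d)" using d by (intro elem_coefs_stable) auto
  then have "maff ?n (\<lambda>J. complex_of_real (elem_coefs d J)) ?x \<noteq> 0"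
  proof (rule stable_coefsD)
    show "Im (?x i) > 0" if "i < ?n" for i using ImY ImW by (simp del: times_complex.sel)
  qed
  with vanish show False by contradiction
qed

lemma binomial_Suc_ratio:
  "real (Suc j) * real (n choose Suc j) = (real n - real j) * real (n choose j)"
proof (cases "j \<le> n")
  case True
  have "Suc j * (n choose Suc j) = (n - j) * (n choose j)"
    using binomial_absorption[of j n] binomial_absorb_comp[of n j] by linarith
  then have "real (Suc j * (n choose Suc j)) = real ((n - j) * (n choose j))" by simp
  then show ?thesis using True by (simp only: of_nat_mult of_nat_diff)
qed (simp add: binomial_eq_0)

lemma diag_poly_coeff_recurrence:
  assumes "d \<le> k"
  shows "real (Suc j) * (real (k - d) + real j + 1) * coeff (diag_poly d k m) (Suc j)
    = (real d - real j) * (real m - real j) * coeff (diag_poly d k m) j"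
proof (cases "Suc j \<le> d")
  case True
  define i where "i = d - Suc j"
  have dj: "d - j = Suc i" "real d - real j = real (Suc i)" "real (k - d) + real j + 1 = real k - real i"
    using True assms by (auto simp: i_def)
  have "real (Suc j) * (real (k - d) + real j + 1) * coeff (diag_poly d k m) (Suc j)
      = ((real k - real i) * real (k choose i)) * (real (Suc j) * real (m choose Suc j))"
    using True by (simp only: dj coeff_diag_poly i_def[symmetric] if_True mult_ac)
  also have "\<dots> = (real (Suc i) * real (k choose Suc i)) * ((real m - real j) * real (m choose j))"
    by (simp only: binomial_Suc_ratio)
  also have "\<dots> = (real d - real j) * (real m - real j) * coeff (diag_poly d k m) j"
    using True by (simp add: dj coeff_diag_poly del: of_nat_Suc binomial_Suc_Suc)
  finally show ?thesis .
next
  case False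
  then show ?thesis by (cases "j = d") (auto simp: coeff_diag_poly)
qed

text \<open>The hypergeometric differential equation, equivalent to the two-term recurrence of the coefficients.\<close>
lemma diag_poly_ODE:
  assumes dk: "d \<le> k" and G: "G = diag_poly d k m"
  shows "[:0, 1, -1:] * pderiv (pderiv G) + [:real (k - d) + 1, real m + real d - 1:] * pderiv G
    = Polynomial.smult (real m * real d) G"
proof (rule poly_eqI)
  fix j
  note rec = diag_poly_coeff_recurrence[OF dk, of _ m, folded G]
  consider "j = 0" | "j = 1" | i where "j = Suc (Suc i)" by (metis One_nat_def not0_implies_Suc)
  then show "coeff ([:0, 1, -1:] * pderiv (pderiv G) + [:real (k - d) + 1, real m + real d - 1:] * pderiv G) j
      = coeff (Polynomial.smult (real m * real d) G) j"
  proof cases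
    case 1
    then show ?thesis using rec[of 0] by (simp add: coeff_pderiv algebra_simps)
  next
    case 2
    then show ?thesis using rec[of 1] by (simp add: coeff_pderiv algebra_simps)
  next
    case 3
    then show ?thesis using rec[of "Suc (Suc i)"] by (simp add: coeff_pderiv algebra_simps)
  qed
qed

text \<open>Away from the singular points \<open>0\<close> and \<open>1\<close> of the differential equation, a multiple root \<open>r\<close> of order \<open>e + 2\<close> would
  have order \<open>e\<close> in the leading term, but order at least \<open>e + 1\<close> in all others.\<close>
lemma diag_poly_simple_roots:
  assumes dk: "d \<le> k" and r: "poly (diag_poly d k m) r = 0" "r < 0"
  shows "poly (pderiv (diag_poly d k m)) r \<noteq> 0"
proof
  define G where "G = diag_poly d k m"
  assume "poly (pderiv (diag_poly d k m)) r = 0"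
  then have G': "poly (pderiv G) r = 0" and G: "poly G r = 0" using r by (simp_all add: G_def)
  have "coeff G 0 > 0" using dk by (simp add: G_def coeff_diag_poly)
  then have G0: "G \<noteq> 0" by auto
  have deg: "pderiv p \<noteq> 0" if "p \<noteq> 0" "poly p r = 0" for p :: "real poly"
  proof
    assume "pderiv p = 0"
    then have "degree p = 0" by (simp add: pderiv_eq_0_iff)
    then show False using that by (metis degree_eq_zeroE mult_zero_right pCons_0_0 poly_0 poly_pCons add_0_right)
  qed
  have G'0: "pderiv G \<noteq> 0" by (rule deg[OF G0 G])
  have G''0: "pderiv (pderiv G) \<noteq> 0" by (rule deg[OF G'0 G'])
  \<comment> \<open>The order of \<open>r\<close> drops by one with each derivative.\<close>
  define e where "e = Polynomial.order r (pderiv (pderiv G))"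
  have o1: "Polynomial.order r (pderiv G) = Suc e"
    unfolding e_def by (rule order_pderiv[OF G'0 G'])
  have o2: "Polynomial.order r G = Suc (Suc e)"
    unfolding o1[symmetric] by (rule order_pderiv[OF G0 G])
  let ?q = "[:- r, 1:] ^ Suc e"
  have "?q dvd pderiv G" using order_1[of r "pderiv G"] by (simp only: o1)
  moreover have "?q dvd G"
    using order_1[of r G] unfolding o2 by (rule dvd_trans[rotated]) (rule le_imp_power_dvd, simp)
  ultimately have "?q dvd Polynomial.smult (real m * real d) G - [:real (k - d) + 1, real m + real d - 1:] * pderiv G"
    by (intro dvd_diff dvd_smult dvd_mult)
  then have "?q dvd [:0, 1, -1:] * pderiv (pderiv G)"
    by (simp only: diag_poly_ODE[OF dk G_def, symmetric] add_diff_cancel_right')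
  moreover have nz: "[:0, 1, -1:] * pderiv (pderiv G) \<noteq> 0"
    using G''0 by (simp only: mult_eq_0_iff) simp
  ultimately have "Suc e \<le> Polynomial.order r ([:0, 1, -1:] * pderiv (pderiv G))" by (rule order_max)
  moreover have "Polynomial.order r ([:0, 1, -1:] * pderiv (pderiv G)) = e"
  proof -
    have "poly [:0, 1, -1:] r \<noteq> 0" using r(2) by (simp add: algebra_simps)
    then have "Polynomial.order r [:0, 1, -1:] = 0" by (rule order_0I)
    then show ?thesis using order_mult[OF nz, of r] by (simp only: e_def)
  qed
  ultimately show False by simp
qed

text \<open>In the Taylor expansion at \<open>r\<close> the linear term dominates the differences of all
  higher terms on a small disc.\<close>
lemma locally_injective_poly:
  fixes P :: "complex poly"
  assumes "poly (pderiv P) r \<noteq> 0"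
  obtains \<rho> where "\<rho> > 0"
    "\<And>z w. cmod (z - r) < \<rho> \<Longrightarrow> cmod (w - r) < \<rho> \<Longrightarrow> poly P z = poly P w \<Longrightarrow> z = w"
proof -
  define S where "S = pcompose P [:r, 1:]"
  define N where "N = degree S"
  define s where "s = coeff S"
  have S: "poly P z = (\<Sum>j\<le>N. s j * (z - r) ^ j)" for z
  proof -
    have "poly P z = poly S (z - r)" by (simp add: S_def poly_pcompose)
    then show ?thesis by (simp add: poly_altdef N_def s_def)
  qed
  have "poly (pderiv S) 0 = poly (pderiv P) r"
    by (simp add: S_def pderiv_pcompose poly_pcompose pderiv_pCons)
  then have s1: "s 1 \<noteq> 0" using assms by (simp add: s_def coeff_pderiv poly_0_coeff_0)
  then have N: "1 \<le> N" unfolding s_def N_def by (rule le_degree)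
  define C where "C = (\<Sum>j\<le>N. cmod (s j) * real j)"
  have C: "C \<ge> 0" unfolding C_def by (intro sum_nonneg) auto
  define \<rho> where "\<rho> = min 1 (cmod (s 1) / (C + 1))"
  have \<rho>: "\<rho> > 0" "\<rho> \<le> 1" "\<rho> * (C + 1) \<le> cmod (s 1)"
  proof -
    show "\<rho> > 0" using s1 C by (simp add: \<rho>_def)
    show "\<rho> \<le> 1" by (simp add: \<rho>_def)
    have "\<rho> \<le> cmod (s 1) / (C + 1)" by (simp add: \<rho>_def)
    then show "\<rho> * (C + 1) \<le> cmod (s 1)" using C by (simp add: pos_le_divide_eq)
  qed
  show thesis
  proof (rule that[OF \<rho>(1)], rule ccontr)
    fix z w assume z: "cmod (z - r) < \<rho>" and w: "cmod (w - r) < \<rho>" and eq: "poly P z = poly P w" and ne: "z \<noteq> w"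
    define h k where "h = z - r" and "k = w - r"
    have hk: "cmod h \<le> 1" "cmod k \<le> 1" "cmod h \<le> \<rho>" "cmod k \<le> \<rho>" using z w \<rho>(2) by (auto simp: h_def k_def)
    have D: "cmod (h - k) > 0" using ne by (simp add: h_def k_def)
    have bound: "cmod (s j * ((h ^ j - k ^ j) - (if j = 1 then h - k else 0))) \<le> (cmod (s j) * real j) * (\<rho> * cmod (h - k))" for j
    proof -
      consider "j = 0" | "j = 1" | i where "j = Suc (Suc i)" by (metis One_nat_def not0_implies_Suc)
      then show ?thesis
      proof cases
        case 3
        have "h ^ j - k ^ j = h ^ Suc i * (h - k) + k * (h ^ Suc i - k ^ Suc i)"
          by (simp add: 3 algebra_simps)
        then have "cmod (h ^ j - k ^ j) \<le> cmod (h ^ Suc i) * cmod (h - k) + cmod k * cmod (h ^ Suc i - k ^ Suc i)"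
          using norm_triangle_ineq[of "h ^ Suc i * (h - k)" "k * (h ^ Suc i - k ^ Suc i)"] by (simp add: norm_mult)
        also have "\<dots> \<le> \<rho> * cmod (h - k) + \<rho> * (real (Suc i) * cmod (h - k))"
        proof (intro add_mono mult_mono)
          have "cmod (h ^ Suc i) = cmod h * cmod h ^ i" by (simp add: norm_mult norm_power)
          also have "\<dots> \<le> \<rho> * 1" using hk \<rho>(1) by (intro mult_mono power_le_one) auto
          finally show "cmod (h ^ Suc i) \<le> \<rho>" by simp
          show "cmod (h ^ Suc i - k ^ Suc i) \<le> real (Suc i) * cmod (h - k)"
            by (rule norm_power_diff) (use hk in auto)
        qed (use hk \<rho>(1) in auto)
        also have "\<dots> = real j * (\<rho> * cmod (h - k))" by (simp add: 3 algebra_simps)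
        finally show ?thesis using 3 by (simp add: norm_mult mult.assoc mult_left_mono)
      qed (use \<rho> in auto)
    qed
    have "(\<Sum>j\<le>N. s j * ((h ^ j - k ^ j) - (if j = 1 then h - k else 0)))
        = (\<Sum>j\<le>N. s j * h ^ j) - (\<Sum>j\<le>N. s j * k ^ j) - (\<Sum>j\<le>N. if j = 1 then s j * (h - k) else 0)"
      unfolding sum_subtractf[symmetric] by (intro sum.cong refl) (auto simp: algebra_simps)
    also have "\<dots> = - (s 1 * (h - k))" using S[of z] S[of w] eq N by (simp add: h_def k_def)
    finally have "cmod (s 1) * cmod (h - k)
        = cmod (\<Sum>j\<le>N. s j * ((h ^ j - k ^ j) - (if j = 1 then h - k else 0)))"
      by (simp add: norm_mult)
    also have "\<dots> \<le> (\<Sum>j\<le>N. (cmod (s j) * real j) * (\<rho> * cmod (h - k)))"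
      by (rule sum_norm_le) (rule bound)
    also have "\<dots> = C * \<rho> * cmod (h - k)" by (simp add: C_def sum_distrib_right mult.assoc)
    finally have "cmod (s 1) \<le> C * \<rho>" using D by simp
    moreover have "C * \<rho> < \<rho> * (C + 1)" using \<rho>(1) by (simp add: algebra_simps)
    ultimately show False using \<rho>(3) by linarith
  qed
qed

lemma prod_mset_lower_bound:
  fixes f :: "'a \<Rightarrow> real"
  assumes "\<And>x. x \<in># A \<Longrightarrow> \<rho> \<le> f x" "\<rho> \<ge> 0"
  shows "\<rho> ^ size A \<le> (\<Prod>x\<in>#A. f x)"
  using assms
proof (induction A)
  case (add x A)
  have "\<rho> \<le> f x" "\<rho> ^ size A \<le> (\<Prod>x\<in>#A. f x)" using add by auto
  then have "\<rho> * \<rho> ^ size A \<le> f x * (\<Prod>x\<in>#A. f x)"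
    using add.prems(2) by (intro mult_mono) auto
  then show ?case by simp
qed simp

text \<open>A nonreal \<open>z\<close> with \<open>G z = - c\<close> real comes with its conjugate, which has the same value. Near a simple root \<open>G\<close> is
  injective and distinguishes the two; away from the roots \<open>|G|\<close> is bounded below by the factorization.\<close>
lemma real_rooted_perturbation:
  fixes G :: "real poly"
  assumes G0: "G \<noteq> 0" and rr: "\<And>z. Im z \<noteq> 0 \<Longrightarrow> rpoly G z \<noteq> 0"
    and simple: "\<And>r. poly G r = 0 \<Longrightarrow> poly (pderiv G) r \<noteq> 0"
  obtains \<delta> where "\<delta> > 0" "\<And>c z. \<bar>c\<bar> < \<delta> \<Longrightarrow> Im z \<noteq> 0 \<Longrightarrow> rpoly G z + of_real c \<noteq> 0"
proof -
  define A where "A = proots G"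
  have A: "x \<in># A \<longleftrightarrow> poly G x = 0" for x using G0 by (simp add: A_def)
  have "\<forall>r\<in>set_mset A. \<exists>\<rho>>0. \<forall>z w. cmod (z - of_real r) < \<rho> \<longrightarrow> cmod (w - of_real r) < \<rho> \<longrightarrow> rpoly G z = rpoly G w \<longrightarrow> z = w"
  proof
    fix r assume "r \<in># A"
    then have "poly (pderiv G) r \<noteq> 0" using simple A by blast
    then have "poly (pderiv (map_poly complex_of_real G)) (of_real r) \<noteq> 0"
      by (simp flip: of_real_hom.map_poly_pderiv)
    from locally_injective_poly[OF this] obtain \<rho> where "\<rho> > 0"
      "\<And>z w. cmod (z - of_real r) < \<rho> \<Longrightarrow> cmod (w - of_real r) < \<rho> \<Longrightarrow>
        poly (map_poly complex_of_real G) z = poly (map_poly complex_of_real G) w \<Longrightarrow> z = w" by blast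
    then show "\<exists>\<rho>>0. \<forall>z w. cmod (z - of_real r) < \<rho> \<longrightarrow> cmod (w - of_real r) < \<rho> \<longrightarrow> rpoly G z = rpoly G w \<longrightarrow> z = w"
      unfolding rpoly_def by blast
  qed
  then obtain R where R: "\<And>r. r \<in># A \<Longrightarrow> R r > 0"
    "\<And>r z w. r \<in># A \<Longrightarrow> cmod (z - of_real r) < R r \<Longrightarrow> cmod (w - of_real r) < R r \<Longrightarrow> rpoly G z = rpoly G w \<Longrightarrow> z = w"
    by metis
  define \<rho> where "\<rho> = Min (insert 1 (R ` set_mset A))"
  have \<rho>: "\<rho> > 0" "\<And>r. r \<in># A \<Longrightarrow> \<rho> \<le> R r" using R(1) by (auto simp: \<rho>_def)
  \<comment> \<open>A lower bound for \<open>|G|\<close> outside the discs of radius \<open>\<rho>\<close> around the roots.\<close>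
  define \<delta> where "\<delta> = \<bar>lead_coeff G\<bar> * \<rho> ^ size A"
  have \<delta>: "\<delta> > 0" using G0 \<rho>(1) by (simp add: \<delta>_def)
  have fact: "rpoly G z = of_real (lead_coeff G) * (\<Prod>x\<in>#A. z - of_real x)" for z
  proof -
    interpret rh: comm_ring_hom "\<lambda>f. rpoly f z" by (rule rpoly_hom)
    have "w \<in> \<real>" if "poly (map_poly complex_of_real G) w = 0" for w
      using rr[of w] that by (auto simp: rpoly_def complex_is_Real_iff)
    from real_rooted_factorization[OF G0 this]
    have "rpoly G z = rpoly ([:lead_coeff G:] * (\<Prod>x\<in>#A. [:- x, 1:])) z" by (simp add: A_def)
    also have "\<dots> = of_real (lead_coeff G) * (\<Prod>x\<in>#A. rpoly [:- x, 1:] z)"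
      by (simp only: rh.hom_mult rh.hom_prod_mset rpoly_linear multiset.map_comp o_def)
    also have "(\<Prod>x\<in>#A. rpoly [:- x, 1:] z) = (\<Prod>x\<in>#A. z - of_real x)"
      by (simp add: rpoly_linear)
    finally show ?thesis .
  qed
  show thesis
  proof (rule that[OF \<delta>], rule notI)
    fix c z assume c: "\<bar>c\<bar> < \<delta>" and z: "Im z \<noteq> 0" and zero: "rpoly G z + of_real c = 0"
    then have val: "rpoly G z = of_real (- c)" by (simp add: add_eq_0_iff2)
    show False
    proof (cases "\<exists>r\<in>#A. cmod (z - of_real r) < \<rho>")
      case True
      then obtain r where r: "r \<in># A" "cmod (z - of_real r) < \<rho>" by blast
      have "rpoly G (cnj z) = cnj (rpoly G z)"
      proof -
        have "(\<Prod>x\<in>#A. cnj z - of_real x) = cnj (\<Prod>x\<in>#A. z - of_real x)"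
          by (induction A) auto
        then show ?thesis by (simp add: fact)
      qed
      then have "rpoly G (cnj z) = rpoly G z" by (simp add: val)
      moreover have "cmod (cnj z - of_real r) = cmod (z - of_real r)"
        by (metis complex_cnj_complex_of_real complex_cnj_diff complex_mod_cnj)
      ultimately have "cnj z = z" using R(2)[OF r(1), of "cnj z" z] \<rho>(2)[OF r(1)] r(2) by simp
      then show False using z by (simp add: complex_eq_iff)
    next
      case False
      have "\<rho> ^ size A \<le> (\<Prod>x\<in>#A. cmod (z - of_real x))"
        by (rule prod_mset_lower_bound) (use False \<rho>(1) in \<open>auto simp: not_less\<close>)
      also have "\<dots> = cmod (\<Prod>x\<in>#A. z - of_real x)" by (induction A) (auto simp: norm_mult)
      finally have "\<delta> \<le> cmod (rpoly G z)" by (simp add: fact \<delta>_def norm_mult mult_left_mono)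
      then show False using c by (simp add: val)
    qed
  qed
qed

text \<open>On the diagonal of the two groups the polynomial is \<open>Y\<^sup>d (G (W / Y) + \<epsilon> b)\<close> with \<open>b = k choose d\<close>. If \<open>W / Y\<close> is not
  real, \<open>G + \<epsilon> b\<close> does not vanish there because it is still real-rooted. If \<open>W / Y\<close> is real, it is positive, and the nonnegative coefficients
  of \<open>G\<close> give \<open>G \<ge> b\<close>.\<close>
theorem pert_coefs_stable:
  assumes d: "1 \<le> d" "d \<le> k" and k: "k \<le> n"
  shows "\<exists>\<epsilon>0>0. \<forall>\<epsilon>::real. \<bar>\<epsilon>\<bar> < \<epsilon>0 \<longrightarrow> stable_coefs n (pert_coefs d k \<epsilon>)"
proof -
  define G where "G = diag_poly d k (n - k)"
  define b where "b = real (k choose d)"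
  have b: "b > 0" using d by (simp add: b_def)
  have G_ge: "poly G x \<ge> b" if "x \<ge> 0" for x
  proof -
    have "poly G x = (\<Sum>j\<le>d. real (k choose (d - j)) * real ((n - k) choose j) * x ^ j)"
      by (simp add: G_def diag_poly_def poly_sum poly_monom)
    also have "\<dots> \<ge> (\<Sum>j\<in>{0}. real (k choose (d - j)) * real ((n - k) choose j) * x ^ j)"
      using that by (intro sum_mono2) auto
    finally show ?thesis by (simp add: b_def)
  qed
  have G0: "G \<noteq> 0" using G_ge[of 0] b by auto
  have rr: "rpoly G z \<noteq> 0" if "Im z \<noteq> 0" for z
    unfolding G_def by (rule diag_poly_real_rooted[OF d that])
  have simple: "poly (pderiv G) r \<noteq> 0" if r: "poly G r = 0" for r
  proof -
    have "r < 0" using G_ge[of r] r b by (cases "r \<ge> 0") auto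
    then show ?thesis using diag_poly_simple_roots[OF d(2), of "n - k" r] r by (simp add: G_def)
  qed
  obtain \<delta> where \<delta>: "\<delta> > 0" "\<And>c z. \<bar>c\<bar> < \<delta> \<Longrightarrow> Im z \<noteq> 0 \<Longrightarrow> rpoly G z + of_real c \<noteq> 0"
    using real_rooted_perturbation[OF G0 rr simple] by blast
  define \<epsilon>0 where "\<epsilon>0 = min (\<delta> / b) 1"
  have "stable_coefs n (pert_coefs d k \<epsilon>)" if \<epsilon>: "\<bar>\<epsilon>\<bar> < \<epsilon>0" for \<epsilon>
    unfolding stable_coefs_def maff_pert_coefs[OF k d(1)]
  proof (intro allI impI)
    fix x :: "nat \<Rightarrow> complex" assume x: "\<forall>i<n. Im (x i) > 0"
    let ?c = "\<lambda>i j. (if i + j = d then 1 else 0) + of_real \<epsilon> * (if i = d \<and> j = 0 then 1 else 0) :: complex"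
    show "blossom2 {..<k} {k..<n} ?c x x \<noteq> 0"
    proof (rule Grace_Walsh_Szego2)
    fix Y W :: complex assume Y: "Im Y > 0" and W: "Im W > 0"
    then have Y0: "Y \<noteq> 0" by auto
    have \<epsilon>b: "\<bar>\<epsilon> * b\<bar> < \<delta>" "\<bar>\<epsilon>\<bar> < 1" using \<epsilon> b by (auto simp: \<epsilon>0_def abs_mult field_simps)
    have "rpoly G (W / Y) + of_real (\<epsilon> * b) \<noteq> 0"
    proof (cases "Im (W / Y) = 0")
      case True
      then have WY: "W / Y = of_real (Re (W / Y))" by (simp add: complex_eq_iff)
      have "Re (W / Y) > 0"
      proof -
        have "W = of_real (Re (W / Y)) * Y" using WY Y0 by (metis nonzero_divide_eq_eq)
        then have "Im W = Re (W / Y) * Im Y" by (metis Im_complex_of_real Re_complex_of_real add_0_right mult_zero_left times_complex.simps(2))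
        then show ?thesis using Y W by (simp add: zero_less_mult_iff)
      qed
      then have "poly G (Re (W / Y)) \<ge> b" by (intro G_ge) simp
      moreover have "\<bar>\<epsilon> * b\<bar> < b" using \<epsilon>b(2) b by (simp add: abs_mult)
      ultimately have "poly G (Re (W / Y)) + \<epsilon> * b \<noteq> 0" by linarith
      then show ?thesis by (subst WY) (simp del: of_real_mult flip: of_real_add)
    next
      case False
      then show ?thesis by (rule \<delta>(2)[OF \<epsilon>b(1)])
    qed
    then show "blossom2 {..<k} {k..<n} ?c (\<lambda>_. Y) (\<lambda>_. W) \<noteq> 0"
      unfolding blossom2_const[OF k d(2) Y0] using Y0 by (simp add: G_def b_def)
    qed (use k x in auto)
  qed
  moreover have "\<epsilon>0 > 0" using \<delta>(1) b by (simp add: \<epsilon>0_def)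
  ultimately show ?thesis by blast
qed

section \<open>Perturbed elementary symmetric polynomials\<close>

text \<open>The function \<open>c\<close> holds the coefficients of \<open>p + y q\<close> in \<open>n + 1\<close> variables, with \<open>q\<close> symmetric. Its stability makes
  \<open>q(l \<circ> \<sigma> + s\<one>)\<close>, which is the same polynomial for all \<open>\<sigma>\<close>, a common interlacer.\<close>
lemma interlaced_mixture_contains_spectra:
  assumes homog: "homog_coefs n d a" and one: "maff n a (\<lambda>_. 1) > 0" and d: "d \<ge> 1"
    and homogb: "homog_coefs n (d - 1) b" and oneb: "maff n b (\<lambda>_. 1) > 0"
    and symm: "\<And>\<sigma> J. \<sigma> permutes {..<n} \<Longrightarrow> J \<subseteq> {..<n} \<Longrightarrow> b (\<sigma> ` J) = b J"
    and stab: "stable_coefs (Suc n) c"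
    and c: "\<And>J. J \<subseteq> {..<n} \<Longrightarrow> c J = a J" "\<And>J. J \<subseteq> {..<n} \<Longrightarrow> c (insert n J) = b J"
    and mix: "\<And>l U. orthogonal_fun n U \<Longrightarrow>
      \<exists>\<sigma>. \<sigma> permutes {..<n} \<and> mlift n a (spectral_form n l U) \<le> maff n a (\<lambda>i. l (\<sigma> i))"
  shows "contains_spectra n a"
  unfolding contains_spectra_def
proof (intro allI impI)
  fix l U assume U: "orthogonal_fun n U"
    and nz: "\<forall>s>0. mlift n a (shift_diag (spectral_form n l U) s) \<noteq> 0"
  let ?S = "{\<sigma>. \<sigma> permutes {..<n}}"
  define f where "f = (\<lambda>\<sigma>. line_maff n a (\<lambda>i. l (\<sigma> i)))"
  define g where "g = line_maff n b l"
  have f: "poly (f \<sigma>) s = maff n a (\<lambda>i. l (\<sigma> i) + s)" for \<sigma> s by (simp add: f_def poly_line_maff)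
  have g: "g = line_maff n b (\<lambda>i. l (\<sigma> i))" if \<sigma>: "\<sigma> permutes {..<n}" for \<sigma>
    unfolding g_def line_maff_def
    by (rule maff_permute[OF \<sigma>, where x = "\<lambda>i. [:l i, 1:]", symmetric]) (simp add: symm[OF \<sigma>])
  have g_asym: "((\<lambda>s. poly g s / s ^ (d - 1)) \<longlongrightarrow> maff n b (\<lambda>_. 1)) at_top"
    unfolding g_def poly_line_maff by (rule maff_asymptotics[OF homogb])
  have "\<exists>\<sigma>\<in>?S. \<forall>s>0. maff n a (\<lambda>i. l (\<sigma> i) + s) \<noteq> 0"
  proof (rule containment_of_family[OF homog one])
    show "mlift n a (shift_diag (spectral_form n l U) s) \<noteq> 0" if "s > 0" for s using nz that by blast
    show "\<exists>\<sigma>\<in>?S. mlift n a (shift_diag (spectral_form n l U) s) \<le> maff n a (\<lambda>i. l (\<sigma> i) + s)" if "s > 0" for s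
      using mix[OF U, of "\<lambda>k. l k + s"] by (simp add: mlift_shift_diag_spectral_form[OF U])
    assume roots: "\<And>\<sigma>. \<sigma> \<in> ?S \<Longrightarrow> \<exists>s>0. maff n a (\<lambda>i. l (\<sigma> i) + s) = 0"
    have "\<exists>s>0. \<forall>\<sigma>\<in>?S. poly (f \<sigma>) s \<le> 0"
    proof (rule common_interlacer_nonpos[where g = g])
      show "finite ?S" by (rule finite_permutations) simp
      show "?S \<noteq> {}" using permutes_id by blast
      show "g \<noteq> 0"
        using eventually_happens'[OF trivial_limit_at_top_linorder eventually_pos_of_ratio[OF g_asym oneb]] by auto
      fix \<sigma> assume \<sigma>: "\<sigma> \<in> ?S"
      show "\<exists>x>0. poly (f \<sigma>) x = 0" using roots[OF \<sigma>] by (simp add: f)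
      have f_asym: "((\<lambda>s. poly (f \<sigma>) s / s ^ d) \<longlongrightarrow> maff n a (\<lambda>_. 1)) at_top"
        unfolding f by (rule maff_asymptotics[OF homog])
      show "eventually (\<lambda>x. poly (f \<sigma>) x > 0) at_top" using f_asym one by (rule eventually_pos_of_ratio)
      have "((\<lambda>s. (poly g s / s ^ (d - 1)) * (1 / s + 0)) \<longlongrightarrow> maff n b (\<lambda>_. 1) * 0) at_top"
        by (intro tendsto_mult g_asym tendsto_divide_plus)
      moreover have "(\<lambda>s. (poly g s / s ^ (d - 1)) * (1 / s + 0)) = (\<lambda>s. poly g s / s ^ d)"
        using d by (cases d) (auto simp: fun_eq_iff field_simps)
      ultimately have "((\<lambda>s. poly g s / s ^ d) \<longlongrightarrow> 0) at_top" by simp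
      from tendsto_divide[OF this f_asym] one
      have "((\<lambda>s. (poly g s / s ^ d) / (poly (f \<sigma>) s / s ^ d)) \<longlongrightarrow> 0) at_top" by simp
      moreover have "eventually (\<lambda>s. (poly g s / s ^ d) / (poly (f \<sigma>) s / s ^ d) = poly g s / poly (f \<sigma>) s) at_top"
        using eventually_gt_at_top[of 0] by eventually_elim simp
      ultimately show "((\<lambda>x. poly g x / poly (f \<sigma>) x) \<longlongrightarrow> 0) at_top" by (rule Lim_transform_eventually)
      show "stable_pencil (f \<sigma>) g"
        unfolding stable_pencil_def
      proof (intro allI impI)
        fix s y :: complex assume s: "Im s > 0" and y: "Im y > 0"
        let ?x = "\<lambda>i. if i < n then complex_of_real (l (\<sigma> i)) + s else y"
        have "maff (Suc n) (\<lambda>J. complex_of_real (c J)) ?x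
            = maff n (\<lambda>J. complex_of_real (c J)) ?x + y * maff n (\<lambda>J. complex_of_real (c (insert n J))) ?x"
          by (simp add: maff_Suc)
        also have "maff n (\<lambda>J. complex_of_real (c J)) ?x = rpoly (f \<sigma>) s"
          unfolding f_def rpoly_line_maff by (rule maff_cong) (simp_all add: c)
        also have "maff n (\<lambda>J. complex_of_real (c (insert n J))) ?x = rpoly g s"
          unfolding g[OF CollectD[OF \<sigma>]] rpoly_line_maff by (rule maff_cong) (simp_all add: c)
        finally show "rpoly (f \<sigma>) s + y * rpoly g s \<noteq> 0"
          using stable_coefsD[OF stab, of ?x] s y by simp
      qed
    qed
    then show "\<exists>s>0. \<forall>\<sigma>\<in>?S. maff n a (\<lambda>i. l (\<sigma> i) + s) \<le> 0" by (simp add: f)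
  qed
  then show "\<exists>\<sigma>. \<sigma> permutes {..<n} \<and> (\<forall>s>0. maff n a (\<lambda>i. l (\<sigma> i) + s) \<noteq> 0)" by blast
qed

lemma sum_Pow_card:
  fixes f :: "nat set \<Rightarrow> real"
  shows "(\<Sum>J\<in>Pow {..<n}. elem_coefs d J * f J) = (\<Sum>J | J \<subseteq> {..<n} \<and> card J = d. f J)"
  unfolding elem_coefs_def by (intro sum.mono_neutral_cong_right) auto

lemma maff_elem_coefs: "maff n (elem_coefs d) x = elem_sum d {..<n} x"
  unfolding maff_def elem_sum_def by (rule sum_Pow_card)

lemma homog_elem_coefs: "homog_coefs n d (elem_coefs d)"
  by (simp add: homog_coefs_def elem_coefs_def)

lemma elem_sum_ones: "finite K \<Longrightarrow> elem_sum d K (\<lambda>_. 1) = real (card K choose d)"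
  by (simp add: elem_sum_def n_subsets)

lemma elem_coefs_permute: "\<sigma> permutes {..<n} \<Longrightarrow> elem_coefs d (\<sigma> ` J) = elem_coefs d J"
  by (simp add: elem_coefs_def card_image[OF permutes_inj_on])

lemma elem_sum_reindex:
  assumes \<sigma>: "\<sigma> permutes N" and K: "\<sigma> ` K = T"
  shows "elem_sum d K (\<lambda>i. x (\<sigma> i)) = elem_sum d T x"
proof -
  have inj: "inj_on \<sigma> J" for J by (rule permutes_inj_on[OF \<sigma>])
  have bij: "bij_betw ((`) \<sigma>) {L. L \<subseteq> K \<and> card L = d} {L. L \<subseteq> T \<and> card L = d}"
  proof (rule bij_betw_imageI)
    show "inj_on ((`) \<sigma>) {L. L \<subseteq> K \<and> card L = d}"
      by (rule inj_onI) (simp only: inj_image_eq_iff[OF permutes_inj[OF \<sigma>]])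
    show "(`) \<sigma> ` {L. L \<subseteq> K \<and> card L = d} = {L. L \<subseteq> T \<and> card L = d}"
    proof (intro equalityI subsetI)
      fix L assume L: "L \<in> {L. L \<subseteq> T \<and> card L = d}"
      then obtain M where "M \<subseteq> K" "L = \<sigma> ` M" unfolding K[symmetric] by (auto simp: subset_image_iff)
      then show "L \<in> (`) \<sigma> ` {L. L \<subseteq> K \<and> card L = d}" using L by (auto simp: card_image[OF inj])
    qed (use K in \<open>auto simp: card_image[OF inj]\<close>)
  qed
  have "elem_sum d T x = (\<Sum>L | L \<subseteq> K \<and> card L = d. \<Prod>i\<in>\<sigma> ` L. x i)"
    unfolding elem_sum_def by (rule sum.reindex_bij_betw[OF bij, symmetric])
  also have "\<dots> = elem_sum d K (\<lambda>i. x (\<sigma> i))"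
    unfolding elem_sum_def by (intro sum.cong refl) (simp add: prod.reindex[OF inj])
  finally show ?thesis by simp
qed

lemma full_minor_sum:
  assumes U: "orthogonal_fun n U" and d: "d \<le> n"
  shows "(\<Sum>J | J \<subseteq> {..<n} \<and> card J = d. pminor (spectral_form n l U) J) = elem_sum d {..<n} l"
proof -
  have Ts: "{T. T \<subseteq> {..<n} \<and> card T = card {..<n}} = {{..<n}}"
    using card_subset_eq[of "{..<n}"] by auto
  have "d \<le> card {..<n}" using d by simp
  note mix = principal_minor_sums_mixture(1,2)[OF U order_refl this]
  show ?thesis using mix(1)[of l] mix(2) unfolding Ts by simp
qed

lemma permutation_mapping_subset:
  assumes N: "finite N" and K: "K \<subseteq> N" and T: "T \<subseteq> N" and card: "card T = card K"
  obtains \<sigma> where "\<sigma> permutes N" "\<sigma> ` K = T"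
proof -
  have fin: "finite K" "finite T" "finite (N - K)" "finite (N - T)"
    using N K T finite_subset by auto
  obtain f where f: "bij_betw f K T" using finite_same_card_bij[OF fin(1,2)] card by auto
  have "card (N - K) = card (N - T)" using card by (simp add: card_Diff_subset K T fin)
  then obtain g where g: "bij_betw g (N - K) (N - T)" using finite_same_card_bij[OF fin(3,4)] by auto
  define \<sigma> where "\<sigma> = (\<lambda>x. if x \<in> K then f x else if x \<in> N then g x else x)"
  have 1: "bij_betw \<sigma> K T" by (rule bij_betw_cong[THEN iffD1, OF _ f]) (simp add: \<sigma>_def)
  have 2: "bij_betw \<sigma> (N - K) (N - T)" by (rule bij_betw_cong[THEN iffD1, OF _ g]) (simp add: \<sigma>_def)
  have "bij_betw \<sigma> (K \<union> (N - K)) (T \<union> (N - T))" using 1 2 by (rule bij_betw_combine) auto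
  then have "bij_betw \<sigma> N N" using K T by (simp add: Un_absorb1)
  then have "\<sigma> permutes N" by (rule bij_imp_permutes) (use K in \<open>auto simp: \<sigma>_def\<close>)
  then show thesis using that 1 by (auto simp: bij_betw_def)
qed

lemma maff_pert_coefs_real:
  assumes k: "k \<le> n"
  shows "maff n (pert_coefs d k \<epsilon>) x = elem_sum d {..<n} x + \<epsilon> * elem_sum d {..<k} x"
    and "mlift n (pert_coefs d k \<epsilon>) M = (\<Sum>J | J \<subseteq> {..<n} \<and> card J = d. pminor M J)
      + \<epsilon> * (\<Sum>J | J \<subseteq> {..<k} \<and> card J = d. pminor M J)"
proof -
  have *: "(\<Sum>J\<in>Pow {..<n}. pert_coefs d k \<epsilon> J * f J) = (\<Sum>J | J \<subseteq> {..<n} \<and> card J = d. f J)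
      + \<epsilon> * (\<Sum>J | J \<subseteq> {..<k} \<and> card J = d. f J)" for f
  proof -
    have "(\<Sum>J\<in>Pow {..<n}. pert_coefs d k \<epsilon> J * f J)
        = (\<Sum>J\<in>Pow {..<n}. elem_coefs d J * f J) + \<epsilon> * (\<Sum>J\<in>Pow {..<n}. if J \<subseteq> {..<k} \<and> card J = d then f J else 0)"
      unfolding sum_distrib_left sum.distrib[symmetric]
      by (intro sum.cong refl) (simp add: pert_coefs_def algebra_simps)
    also have "(\<Sum>J\<in>Pow {..<n}. if J \<subseteq> {..<k} \<and> card J = d then f J else 0) = (\<Sum>J | J \<subseteq> {..<k} \<and> card J = d. f J)"
      using k by (intro sum.mono_neutral_cong_right) auto
    finally show ?thesis by (simp add: sum_Pow_card)
  qed
  show "maff n (pert_coefs d k \<epsilon>) x = elem_sum d {..<n} x + \<epsilon> * elem_sum d {..<k} x"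
    unfolding maff_def elem_sum_def by (rule *)
  show "mlift n (pert_coefs d k \<epsilon>) M = (\<Sum>J | J \<subseteq> {..<n} \<and> card J = d. pminor M J)
      + \<epsilon> * (\<Sum>J | J \<subseteq> {..<k} \<and> card J = d. pminor M J)"
    unfolding mlift_def by (rule *)
qed

text \<open>The part \<open>e\<^sub>d\<close> of the polynomial takes the same value at \<open>A\<close> and at all orders of \<open>l\<close>, and the part in the first \<open>k\<close>
  variables is a mixture over the \<open>k\<close>-element sets \<open>T\<close>. A best \<open>T\<close> is moved to the first \<open>k\<close> positions;
  the sign of \<open>\<epsilon>\<close> is absorbed into the averaged function.\<close>
lemma pert_mixture:
  assumes U: "orthogonal_fun n U" and d: "d \<le> k" and k: "k \<le> n"
  shows "\<exists>\<sigma>. \<sigma> permutes {..<n} \<and>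
    mlift n (pert_coefs d k \<epsilon>) (spectral_form n l U) \<le> maff n (pert_coefs d k \<epsilon>) (\<lambda>i. l (\<sigma> i))"
proof -
  let ?Ts = "{T. T \<subseteq> {..<n} \<and> card T = card {..<k}}"
  define w where "w = (\<lambda>T. pminor (outer_gram ({..<n} - {..<k}) U) ({..<n} - T))"
  have "{..<k} \<subseteq> {..<n}" "d \<le> card {..<k}" using k d by auto
  note mix0 = principal_minor_sums_mixture[OF U this]
  have mix1: "(\<Sum>J | J \<subseteq> {..<k} \<and> card J = d. pminor (spectral_form n l U) J) = (\<Sum>T\<in>?Ts. w T * elem_sum d T l)"
    unfolding w_def by (rule mix0(1))
  have mix2: "sum w ?Ts = 1" unfolding w_def by (rule mix0(2))
  have finTs: "finite ?Ts" by (rule finite_subset[of _ "Pow {..<n}"]) auto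
  have w_nonneg: "w T \<ge> 0" for T unfolding w_def by (rule mix0(3))
  obtain T where T: "T \<in> ?Ts"
    and le: "(\<Sum>T\<in>?Ts. w T * (\<epsilon> * elem_sum d T l)) \<le> \<epsilon> * elem_sum d T l"
    using bexE[OF convex_combination_le_some[of ?Ts w "\<lambda>T. \<epsilon> * elem_sum d T l", OF finTs w_nonneg mix2]] .
  obtain \<sigma> where \<sigma>: "\<sigma> permutes {..<n}" "\<sigma> ` {..<k} = T"
  proof (rule permutation_mapping_subset[of "{..<n}" "{..<k}" T])
    show "{..<k} \<subseteq> {..<n}" "T \<subseteq> {..<n}" "card T = card {..<k}" using T k by auto
  qed auto
  have "mlift n (pert_coefs d k \<epsilon>) (spectral_form n l U)
      = elem_sum d {..<n} l + (\<Sum>T\<in>?Ts. w T * (\<epsilon> * elem_sum d T l))"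
    using full_minor_sum[OF U, of d l] d k
    by (simp add: maff_pert_coefs_real[OF k] mix1 sum_distrib_left mult.left_commute)
  also have "\<dots> \<le> elem_sum d {..<n} l + \<epsilon> * elem_sum d T l" using le by simp
  also have "\<dots> = maff n (pert_coefs d k \<epsilon>) (\<lambda>i. l (\<sigma> i))"
    using elem_sum_reindex[OF \<sigma>(1) \<sigma>(2)] elem_sum_reindex[OF \<sigma>(1) permutes_image[OF \<sigma>(1)]]
    by (simp add: maff_pert_coefs_real[OF k])
  finally show ?thesis using \<sigma>(1) by blast
qed

text \<open>Adding \<open>y e\<^bsub>d-1\<^esub>\<close> to \<open>e\<^sub>d(x\<^sub>1, \<dots>, x\<^sub>n)\<close> gives \<open>e\<^sub>d\<close> in \<open>n + 1\<close> variables, so \<open>p + y e\<^bsub>d-1\<^esub>\<close> has the same coefficient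
  function \<open>pert_coefs d k \<epsilon>\<close>, whose stability in \<open>n + 1\<close> variables is known.\<close>
theorem pert_spectral_containment:
  assumes d: "1 \<le> d" "d \<le> k" and k: "k \<le> n"
  shows "\<exists>\<epsilon>0>0. \<forall>\<epsilon>::real. \<bar>\<epsilon>\<bar> < \<epsilon>0 \<longrightarrow>
    spectral_containment n (multiaffine_poly n (pert_coefs d k \<epsilon>))"
proof -
  obtain e1 where e1: "e1 > 0" "\<And>\<epsilon>. \<bar>\<epsilon>\<bar> < e1 \<Longrightarrow> stable_coefs n (pert_coefs d k \<epsilon>)"
    using pert_coefs_stable[OF d k] by blast
  obtain e2 where e2: "e2 > 0" "\<And>\<epsilon>. \<bar>\<epsilon>\<bar> < e2 \<Longrightarrow> stable_coefs (Suc n) (pert_coefs d k \<epsilon>)"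
    using pert_coefs_stable[OF d, of "Suc n"] k by auto
  define e where "e = min (min e1 e2) 1"
  have "spectral_containment n (multiaffine_poly n (pert_coefs d k \<epsilon>))" if \<epsilon>: "\<bar>\<epsilon>\<bar> < e" for \<epsilon>
  proof (rule spectral_containmentI)
    show homog: "homog_coefs n d (pert_coefs d k \<epsilon>)"
      by (auto simp: homog_coefs_def pert_coefs_def elem_coefs_def split: if_splits)
    show "stable_coefs n (pert_coefs d k \<epsilon>)" using e1(2) \<epsilon> by (simp add: e_def)
    have "contains_spectra n (pert_coefs d k \<epsilon>)"
    proof (rule interlaced_mixture_contains_spectra[OF homog _ d(1)])
      show "maff n (pert_coefs d k \<epsilon>) (\<lambda>_. 1) > 0"
      proof -
        have "real (k choose d) \<le> real (n choose d)" using binomial_right_mono[OF k, of d] by simp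
        moreover have "real (k choose d) \<ge> 1" using d by (simp add: Suc_le_eq)
        moreover have "\<bar>\<epsilon> * real (k choose d)\<bar> < 1 * real (k choose d)"
        proof -
          have "\<bar>\<epsilon>\<bar> * real (k choose d) < 1 * real (k choose d)"
            using \<epsilon> calculation(2) d by (intro mult_strict_right_mono) (auto simp: e_def)
          then show ?thesis using d by (simp add: abs_mult)
        qed
        ultimately show ?thesis by (simp add: maff_pert_coefs_real[OF k] elem_sum_ones abs_less_iff)
      qed
      show "homog_coefs n (d - 1) (elem_coefs (d - 1))" by (rule homog_elem_coefs)
      show "maff n (elem_coefs (d - 1)) (\<lambda>_. 1) > 0"
        using d k by (simp add: maff_elem_coefs elem_sum_ones)
      show "stable_coefs (Suc n) (pert_coefs d k \<epsilon>)" using e2(2) \<epsilon> by (simp add: e_def)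
      show "elem_coefs (d - 1) (\<sigma> ` J) = elem_coefs (d - 1) J" if "\<sigma> permutes {..<n}" for \<sigma> J
        by (rule elem_coefs_permute[OF that])
      show "pert_coefs d k \<epsilon> (insert n J) = elem_coefs (d - 1) J" if "J \<subseteq> {..<n}" for J
      proof -
        have "finite J" "n \<notin> J" using that finite_subset by auto
        then show ?thesis using d k by (auto simp: pert_coefs_def elem_coefs_def)
      qed
      show "\<exists>\<sigma>. \<sigma> permutes {..<n} \<and>
          mlift n (pert_coefs d k \<epsilon>) (spectral_form n l U) \<le> maff n (pert_coefs d k \<epsilon>) (\<lambda>i. l (\<sigma> i))"
        if "orthogonal_fun n U" for l U by (rule pert_mixture[OF that d(2) k])
    qed simp
    then show "\<exists>\<sigma>. \<sigma> permutes {..<n} \<and> (\<forall>s>0. maff n (pert_coefs d k \<epsilon>) (\<lambda>i. l (\<sigma> i) + s) \<noteq> 0)"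
      if "orthogonal_fun n U" "\<And>s. s > 0 \<Longrightarrow> mlift n (pert_coefs d k \<epsilon>) (shift_diag (spectral_form n l U) s) \<noteq> 0" for l U
      using that unfolding contains_spectra_def by blast
  qed
  moreover have "e > 0" using e1(1) e2(1) by (simp add: e_def)
  ultimately show ?thesis by blast
qed

section \<open>The perturbed quadratic\<close>

text \<open>The coefficients of \<open>e\<^sub>2 - \<epsilon> (x\<^sub>0 x\<^sub>1 + x\<^sub>0 x\<^sub>2)\<close>, by one formula for every number of variables.\<close>
definition quad_coefs :: "real \<Rightarrow> nat set \<Rightarrow> real" where
  "quad_coefs \<epsilon> J = elem_coefs 2 J - \<epsilon> * ((if J = {0, 1} then 1 else 0) + (if J = {0, 2} then 1 else 0))"

lemma elem_sum_two:
  fixes x :: "nat \<Rightarrow> 'a :: comm_ring_1"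
  shows "2 * maff n (\<lambda>J. if card J = 2 then 1 else 0) x = (\<Sum>i<n. x i)\<^sup>2 - (\<Sum>i<n. (x i)\<^sup>2)"
proof -
  have card: "card (insert n J) = Suc (card J)" if "J \<subseteq> {..<n}" for J and n :: nat
  proof -
    have "finite J" "n \<notin> J" using that finite_subset by auto
    then show ?thesis by simp
  qed
  have step: "maff n (\<lambda>J. if card (insert n J) = Suc d then 1 else 0) x = maff n (\<lambda>J. if card J = d then 1 else 0) x"
    for n d by (intro maff_cong) (auto simp: card)
  have step0: "maff n (\<lambda>J. if card (insert n J) = 0 then 1 else 0) x = 0" for n
    unfolding maff_def by (intro sum.neutral) (auto simp: card)
  have zero: "maff n (\<lambda>J. if card J = 0 then 1 else 0) x = 1" for n
  proof (induction n)
    case 0 show ?case by (simp add: maff_def)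
  qed (simp add: maff_Suc step0 del: card_eq_0_iff)
  have one: "maff n (\<lambda>J. if card J = Suc 0 then 1 else 0) x = (\<Sum>i<n. x i)" for n
  proof (induction n)
    case 0 show ?case by (simp add: maff_def)
  qed (simp add: maff_Suc step zero del: card_eq_0_iff)
  have "2 * maff n (\<lambda>J. if card J = Suc (Suc 0) then 1 else 0) x = (\<Sum>i<n. x i)\<^sup>2 - (\<Sum>i<n. (x i)\<^sup>2)"
  proof (induction n)
    case 0 show ?case by (simp add: maff_def)
  next
    case (Suc n)
    have "2 * maff (Suc n) (\<lambda>J. if card J = Suc (Suc 0) then 1 else 0) x
        = 2 * maff n (\<lambda>J. if card J = Suc (Suc 0) then 1 else 0) x + 2 * x n * (\<Sum>i<n. x i)"
      unfolding maff_Suc step one by (simp add: algebra_simps)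
    then show ?case unfolding Suc.IH by (simp add: power2_eq_square algebra_simps)
  qed
  then show ?thesis by (simp add: numeral_2_eq_2)
qed

lemma sum_quad_coefs:
  fixes f :: "nat set \<Rightarrow> 'a :: {real_algebra_1, comm_ring_1}"
  assumes n: "n \<ge> 3"
  shows "(\<Sum>J\<in>Pow {..<n}. of_real (quad_coefs \<epsilon> J) * f J)
    = (\<Sum>J\<in>Pow {..<n}. (if card J = 2 then 1 else 0) * f J) - of_real \<epsilon> * (f {0, 1} + f {0, 2})"
proof -
  have "(\<Sum>J\<in>Pow {..<n}. of_real (quad_coefs \<epsilon> J) * f J)
    = (\<Sum>J\<in>Pow {..<n}. (if card J = 2 then 1 else 0) * f J)
      - of_real \<epsilon> * ((\<Sum>J\<in>Pow {..<n}. if J = {0, 1} then f J else 0) + (\<Sum>J\<in>Pow {..<n}. if J = {0, 2} then f J else 0))"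
    unfolding sum_distrib_left sum.distrib[symmetric] sum_subtractf[symmetric]
    by (intro sum.cong refl) (simp add: quad_coefs_def elem_coefs_def algebra_simps)
  also have "(\<Sum>J\<in>Pow {..<n}. if J = {0, 1} then f J else 0) = f {0, 1}"
    using n by (subst sum.delta) auto
  also have "(\<Sum>J\<in>Pow {..<n}. if J = {0, 2} then f J else 0) = f {0, 2}"
    using n by (subst sum.delta) auto
  finally show ?thesis .
qed

lemma maff_quad_coefs:
  fixes x :: "nat \<Rightarrow> 'a :: {real_algebra_1, comm_ring_1}"
  assumes n: "n \<ge> 3"
  shows "2 * maff n (\<lambda>J. of_real (quad_coefs \<epsilon> J)) x
    = (\<Sum>i<n. x i)\<^sup>2 - ((\<Sum>i<n. (x i)\<^sup>2) + 2 * of_real \<epsilon> * (x 0 * (x 1 + x 2)))"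
proof -
  have "2 * maff n (\<lambda>J. of_real (quad_coefs \<epsilon> J)) x
      = 2 * maff n (\<lambda>J. if card J = 2 then 1 else 0) x - 2 * of_real \<epsilon> * (x 0 * (x 1 + x 2))"
    unfolding maff_def sum_quad_coefs[OF n] by (simp add: algebra_simps)
  then show ?thesis unfolding elem_sum_two by simp
qed

lemma quad_form_nonneg:
  fixes v :: "nat \<Rightarrow> real"
  assumes n: "n \<ge> 3" and \<epsilon>: "\<bar>\<epsilon>\<bar> \<le> 1/2"
  shows "(\<Sum>i<n. (v i)\<^sup>2) + 2 * \<epsilon> * (v 0 * (v 1 + v 2)) \<ge> 0"
proof -
  have "(\<Sum>i\<in>{0, 1, 2}. (v i)\<^sup>2) \<le> (\<Sum>i<n. (v i)\<^sup>2)" by (rule sum_mono2) (use n in auto)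
  moreover have "\<bar>2 * \<epsilon> * (v 0 * (v 1 + v 2))\<bar> \<le> 1 * (\<bar>v 0\<bar> * (\<bar>v 1\<bar> + \<bar>v 2\<bar>))"
    unfolding abs_mult using \<epsilon> by (intro mult_mono abs_triangle_ineq) auto
  moreover have "\<bar>v 0\<bar> * (\<bar>v 1\<bar> + \<bar>v 2\<bar>) \<le> (v 0)\<^sup>2 + (v 1)\<^sup>2 + (v 2)\<^sup>2"
  proof -
    have "0 \<le> (\<bar>v 0\<bar> / 2 - \<bar>v 1\<bar>)\<^sup>2 + (\<bar>v 0\<bar> / 2 - \<bar>v 2\<bar>)\<^sup>2 + \<bar>v 0\<bar>\<^sup>2 / 2" by simp
    also have "\<dots> = (v 0)\<^sup>2 + (v 1)\<^sup>2 + (v 2)\<^sup>2 - \<bar>v 0\<bar> * (\<bar>v 1\<bar> + \<bar>v 2\<bar>)"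
      unfolding power2_diff by (simp add: power_divide algebra_simps)
    finally show ?thesis by simp
  qed
  ultimately show ?thesis by (simp add: abs_le_iff)
qed

lemma maff_quad_coefs_pos:
  assumes n: "n \<ge> 3" and \<epsilon>: "\<bar>\<epsilon>\<bar> \<le> 1/2" and y: "\<And>i. i < n \<Longrightarrow> y i > 0"
  shows "maff n (quad_coefs \<epsilon>) y > 0"
  unfolding maff_def
proof (rule sum_pos2)
  have prod: "(\<Prod>i\<in>J. y i) > 0" if "J \<in> Pow {..<n}" for J using that y by (intro prod_pos) auto
  have ne: "{0, Suc 0} \<noteq> {0, 2::nat}" by (simp add: doubleton_eq_iff)
  show "{0, 1} \<in> Pow {..<n}" using n by auto
  then show "0 < quad_coefs \<epsilon> {0, 1} * (\<Prod>i\<in>{0, 1}. y i)"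
    using y[of 0] y[of 1] n \<epsilon> ne by (intro mult_pos_pos) (auto simp: quad_coefs_def elem_coefs_def abs_le_iff)
  show "quad_coefs \<epsilon> J * (\<Prod>i\<in>J. y i) \<ge> 0" if "J \<in> Pow {..<n}" for J
  proof (rule mult_nonneg_nonneg)
    show "quad_coefs \<epsilon> J \<ge> 0" using \<epsilon> ne by (auto simp: quad_coefs_def elem_coefs_def abs_le_iff)
  qed (use prod[OF that] in simp)
qed simp

text \<open>Twice the polynomial is \<open>L\<^sup>2 - N\<close> with \<open>L\<close> the sum of the variables and \<open>N\<close> a nonnegative quadratic form. At a complex zero \<open>X + \<i> Y\<close> the
  real and the imaginary part determine \<open>N\<close> on the span of \<open>X\<close> and \<open>Y\<close>. At the vector \<open>X + t Y\<close> of this span with \<open>L = 0\<close>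
  the form \<open>N\<close> is negative, because \<open>L\<^sup>2 > N\<close> at the positive vector \<open>Y\<close>.\<close>
lemma quad_coefs_stable:
  assumes n: "n \<ge> 3" and \<epsilon>: "\<bar>\<epsilon>\<bar> \<le> 1/2"
  shows "stable_coefs n (quad_coefs \<epsilon>)"
  unfolding stable_coefs_def
proof (intro allI impI notI)
  fix z :: "nat \<Rightarrow> complex"
  assume im: "\<forall>i<n. Im (z i) > 0" and zero: "maff n (\<lambda>J. complex_of_real (quad_coefs \<epsilon> J)) z = 0"
  define X Y where "X = (\<lambda>i. Re (z i))" and "Y = (\<lambda>i. Im (z i))"
  define LX LY where "LX = (\<Sum>i<n. X i)" and "LY = (\<Sum>i<n. Y i)"
  define N where "N = (\<lambda>v. (\<Sum>i<n. (v i)\<^sup>2) + 2 * \<epsilon> * (v 0 * (v 1 + v 2)) :: real)"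
  define NXY where "NXY = (\<Sum>i<n. X i * Y i) + \<epsilon> * (X 0 * (Y 1 + Y 2) + Y 0 * (X 1 + X 2))"
  have "(\<Sum>i<n. z i)\<^sup>2 = (\<Sum>i<n. (z i)\<^sup>2) + 2 * of_real \<epsilon> * (z 0 * (z 1 + z 2))"
    using maff_quad_coefs[OF n, of \<epsilon> z] zero by simp
  note eq = arg_cong[OF this, of Re] arg_cong[OF this, of Im]
  have re: "LX\<^sup>2 - LY\<^sup>2 = N X - N Y"
    using eq(1) by (simp add: LX_def LY_def N_def X_def Y_def power2_eq_square sum_subtractf algebra_simps)
  have "(\<Sum>i<n. Im (z i) * (Re (z i) * 2)) = 2 * (\<Sum>i<n. Im (z i) * Re (z i))"
    by (simp add: sum_distrib_left mult_ac)
  then have "2 * (LX * LY) = 2 * NXY"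
    using eq(2) by (simp add: LX_def LY_def NXY_def X_def Y_def power2_eq_square sum.distrib algebra_simps)
  then have im_eq: "LX * LY = NXY" by simp
  have pos: "LY\<^sup>2 - N Y > 0"
    using maff_quad_coefs_pos[OF n \<epsilon>, of Y] maff_quad_coefs[OF n, of \<epsilon> Y] im
    by (simp add: LY_def N_def Y_def)
  have "0 \<in> {..<n}" using n by simp
  then have LY: "LY > 0" unfolding LY_def Y_def using im by (intro sum_pos2[of _ 0]) auto
  \<comment> \<open>The vector \<open>X + t Y\<close> has coordinate sum \<open>0\<close>.\<close>
  define t where "t = - LX / LY"
  have "N (\<lambda>i. X i + t * Y i) = N X + 2 * t * NXY + t\<^sup>2 * N Y"
    unfolding N_def NXY_def
    by (simp add: power2_eq_square algebra_simps sum.distrib sum_distrib_left)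
  also have "\<dots> = - (LY\<^sup>2 - N Y) * (1 + t\<^sup>2)"
  proof -
    have LX: "LX = - (t * LY)" using LY by (simp add: t_def)
    have "N X = t\<^sup>2 * LY\<^sup>2 - LY\<^sup>2 + N Y" using re unfolding LX by (simp add: power_mult_distrib)
    moreover have "NXY = - (t * LY\<^sup>2)" using im_eq unfolding LX by (simp add: power2_eq_square)
    ultimately show ?thesis by (simp add: power2_eq_square algebra_simps)
  qed
  also have "\<dots> < 0" using pos by (intro mult_neg_pos) (auto intro: add_pos_nonneg)
  finally show False using quad_form_nonneg[OF n \<epsilon>, of "\<lambda>i. X i + t * Y i"] unfolding N_def by simp
qed

text \<open>The Cauchy--Binet formula for two vectors, with weights \<open>l\<close>.\<close>
lemma weighted_Lagrange_identity:
  fixes l x y :: "nat \<Rightarrow> real"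
  shows "(\<Sum>k<n. \<Sum>m<k. (x k * y m - x m * y k)\<^sup>2 * (l k * l m))
    = (\<Sum>k<n. (x k)\<^sup>2 * l k) * (\<Sum>k<n. (y k)\<^sup>2 * l k) - (\<Sum>k<n. x k * y k * l k)\<^sup>2"
proof (induction n)
  case (Suc n)
  have binomial: "P * Q - R\<^sup>2 + (a * Q + b * P - 2 * c * R) = (P + a) * (Q + b) - (R + c)\<^sup>2"
    if "a * b = c\<^sup>2" for P Q R a b c :: real
    using that by (simp add: power2_eq_square algebra_simps)
  have row: "(\<Sum>m<n. (x n * y m - x m * y n)\<^sup>2 * (l n * l m))
      = (x n)\<^sup>2 * l n * (\<Sum>m<n. (y m)\<^sup>2 * l m) + (y n)\<^sup>2 * l n * (\<Sum>m<n. (x m)\<^sup>2 * l m)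
        - 2 * (x n * y n * l n) * (\<Sum>m<n. x m * y m * l m)"
    unfolding sum_distrib_left sum.distrib[symmetric] sum_subtractf[symmetric]
    by (intro sum.cong refl) (simp add: power2_eq_square algebra_simps)
  show ?case unfolding sum.lessThan_Suc Suc.IH row by (rule binomial) (simp add: power2_eq_square)
qed simp

text \<open>The numbers \<open>(x\<^sub>k y\<^sub>m - x\<^sub>m y\<^sub>k)\<^sup>2\<close> with \<open>m < k\<close> sum to one, and they are the weights of \<open>l\<^sub>k l\<^sub>m\<close> in the subtracted term by Lagrange's
  identity. Giving the pair \<open>(k, m)\<close> the value \<open>\<beta> k\<close> of its larger index dominates the average of \<open>\<beta>\<close> with weights \<open>(x\<^sub>k)\<^sup>2\<close>: the
  heads of the weight sequences compare by Lagrange's identity, and Abel summation applies to the sorted sequence \<open>\<beta>\<close>.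
  Now both terms are averages with the same weights, so some pair is at least as large.\<close>
lemma sorted_pair_mixture:
  fixes l x y \<beta> :: "nat \<Rightarrow> real"
  assumes xx: "(\<Sum>k<n. (x k)\<^sup>2) = 1" and yy: "(\<Sum>k<n. (y k)\<^sup>2) = 1" and xy: "(\<Sum>k<n. x k * y k) = 0"
    and sorted: "\<And>i j. i \<le> j \<Longrightarrow> j < n \<Longrightarrow> \<beta> i \<le> \<beta> j"
  shows "\<exists>k<n. \<exists>m<k. (\<Sum>k<n. (x k)\<^sup>2 * \<beta> k)
      - s * ((\<Sum>k<n. (x k)\<^sup>2 * l k) * (\<Sum>k<n. (y k)\<^sup>2 * l k) - (\<Sum>k<n. x k * y k * l k)\<^sup>2)
    \<le> \<beta> k - s * (l k * l m)"
proof -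
  define M where "M = (\<lambda>k m. (x k * y m - x m * y k)\<^sup>2)"
  define D where "D = (\<lambda>k. (\<Sum>m<k. M k m) - (x k)\<^sup>2)"
  have heads: "(\<Sum>k<r. \<Sum>m<k. M k m) = (\<Sum>k<r. (x k)\<^sup>2) * (\<Sum>k<r. (y k)\<^sup>2) - (\<Sum>k<r. x k * y k)\<^sup>2" for r
    using weighted_Lagrange_identity[of x y "\<lambda>_. 1" r] by (simp add: M_def)
  have total: "(\<Sum>k<n. \<Sum>m<k. M k m) = 1" by (simp add: heads xx yy xy)
  have D_total: "(\<Sum>k<n. D k) = 0" by (simp add: D_def sum_subtractf total xx)
  have tails: "(\<Sum>k=r..<n. D k) \<ge> 0" if r: "r < n" for r
  proof -
    have "(\<Sum>k<r. (y k)\<^sup>2) \<le> (\<Sum>k<n. (y k)\<^sup>2)" by (rule sum_mono2) (use r in auto)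
    then have "(\<Sum>k<r. (x k)\<^sup>2) * (\<Sum>k<r. (y k)\<^sup>2) \<le> (\<Sum>k<r. (x k)\<^sup>2) * 1"
      unfolding yy by (intro mult_left_mono sum_nonneg) auto
    then have "(\<Sum>k<r. D k) \<le> 0" unfolding D_def sum_subtractf heads by (simp add: add_increasing2 diff_le_eq)
    moreover have "(\<Sum>k<r. D k) + (\<Sum>k=r..<n. D k) = (\<Sum>k<n. D k)"
      using sum.atLeastLessThan_concat[of 0 r n D] r by (simp add: atLeast0LessThan)
    ultimately show ?thesis using D_total by simp
  qed
  have "(\<Sum>k<n. \<beta> k * D k) \<ge> 0" using sorted tails D_total by (rule Abel_summation_nonneg)
  then have le: "(\<Sum>k<n. (x k)\<^sup>2 * \<beta> k) \<le> (\<Sum>k<n. \<Sum>m<k. M k m * \<beta> k)"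
    by (simp add: D_def sum_subtractf algebra_simps sum_distrib_left)
  let ?S = "Sigma {..<n} (\<lambda>k. {..<k})"
  let ?f = "\<lambda>p. \<beta> (fst p) - s * (l (fst p) * l (snd p))"
  let ?w = "\<lambda>p. M (fst p) (snd p)"
  have Sig: "(\<Sum>p\<in>?S. g (fst p) (snd p)) = (\<Sum>k<n. \<Sum>m<k. g k m)" for g :: "nat \<Rightarrow> nat \<Rightarrow> real"
    by (subst sum.Sigma) (auto simp: case_prod_beta)
  have "\<exists>p\<in>?S. (\<Sum>p\<in>?S. ?w p * ?f p) \<le> ?f p"
    by (rule convex_combination_le_some) (use total Sig[of M] in \<open>auto simp: M_def\<close>)
  then obtain k m where km: "k < n" "m < k" and "(\<Sum>p\<in>?S. ?w p * ?f p) \<le> \<beta> k - s * (l k * l m)" by auto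
  moreover have "(\<Sum>p\<in>?S. ?w p * ?f p) = (\<Sum>k<n. \<Sum>m<k. M k m * \<beta> k) - s * (\<Sum>k<n. \<Sum>m<k. M k m * (l k * l m))"
    unfolding Sig[of "\<lambda>k m. M k m * (\<beta> k - s * (l k * l m))"]
    by (simp add: algebra_simps sum_subtractf sum_distrib_left)
  ultimately have "(\<Sum>k<n. (x k)\<^sup>2 * \<beta> k) - s * (\<Sum>k<n. \<Sum>m<k. M k m * (l k * l m)) \<le> \<beta> k - s * (l k * l m)"
    using le by linarith
  then show ?thesis using km unfolding M_def weighted_Lagrange_identity by blast
qed

lemma pair_mixture:
  fixes l x y \<beta> :: "nat \<Rightarrow> real"
  assumes xx: "(\<Sum>k<n. (x k)\<^sup>2) = 1" and yy: "(\<Sum>k<n. (y k)\<^sup>2) = 1" and xy: "(\<Sum>k<n. x k * y k) = 0"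
  shows "\<exists>k<n. \<exists>m<n. m \<noteq> k \<and> (\<Sum>k<n. (x k)\<^sup>2 * \<beta> k)
      - s * ((\<Sum>k<n. (x k)\<^sup>2 * l k) * (\<Sum>k<n. (y k)\<^sup>2 * l k) - (\<Sum>k<n. x k * y k * l k)\<^sup>2)
    \<le> \<beta> k - s * (l k * l m)"
proof -
  obtain \<pi> where \<pi>: "\<pi> permutes {..<n}" and sorted: "\<And>i j. i \<le> j \<Longrightarrow> j < n \<Longrightarrow> \<beta> (\<pi> i) \<le> \<beta> (\<pi> j)"
    using sorting_permutation[of n \<beta>] by blast
  note ps = permuted_sum[OF \<pi>]
  have "\<exists>k<n. \<exists>m<k. (\<Sum>k<n. (x (\<pi> k))\<^sup>2 * \<beta> (\<pi> k))
      - s * ((\<Sum>k<n. (x (\<pi> k))\<^sup>2 * l (\<pi> k)) * (\<Sum>k<n. (y (\<pi> k))\<^sup>2 * l (\<pi> k))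
        - (\<Sum>k<n. x (\<pi> k) * y (\<pi> k) * l (\<pi> k))\<^sup>2)
    \<le> \<beta> (\<pi> k) - s * (l (\<pi> k) * l (\<pi> m))"
    by (rule sorted_pair_mixture[OF _ _ _ sorted])
      (use ps[of "\<lambda>k. (x k)\<^sup>2"] ps[of "\<lambda>k. (y k)\<^sup>2"] ps[of "\<lambda>k. x k * y k"] xx yy xy in simp_all)
  then obtain k m where km: "k < n" "m < k" and
    "(\<Sum>k<n. (x k)\<^sup>2 * \<beta> k)
      - s * ((\<Sum>k<n. (x k)\<^sup>2 * l k) * (\<Sum>k<n. (y k)\<^sup>2 * l k) - (\<Sum>k<n. x k * y k * l k)\<^sup>2)
    \<le> \<beta> (\<pi> k) - s * (l (\<pi> k) * l (\<pi> m))"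
    unfolding ps[of "\<lambda>k. (x k)\<^sup>2 * \<beta> k"] ps[of "\<lambda>k. (x k)\<^sup>2 * l k"] ps[of "\<lambda>k. (y k)\<^sup>2 * l k"]
      ps[of "\<lambda>k. x k * y k * l k"] by blast
  moreover have "\<pi> k < n" "\<pi> m < n" using km permutes_in_image[OF \<pi>] by (metis lessThan_iff less_trans)+
  moreover have "\<pi> m \<noteq> \<pi> k" using km permutes_inj[OF \<pi>] by (auto dest: injD)
  ultimately show ?thesis by blast
qed

text \<open>The minors on \<open>{0, 1}\<close> and \<open>{0, 2}\<close> make up \<open>A\<^sub>0\<^sub>0 tr A - (A\<^sup>2)\<^sub>0\<^sub>0\<close> except for the minor on \<open>{0, 3}\<close>. The first
  expression is an average over the eigenvector entries of index \<open>0\<close>, and the minor on \<open>{0, 3}\<close> has the shape of the term in \<open>pair_mixture\<close>.\<close>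
lemma cherry_minors:
  fixes l :: "nat \<Rightarrow> real"
  assumes U: "orthogonal_fun 4 U"
  defines "A \<equiv> spectral_form 4 l U"
  shows "pminor A {0, 1} + pminor A {0, 2}
    = (\<Sum>k<4. (U k 0)\<^sup>2 * (l k * ((\<Sum>k<4. l k) - l k)))
      - ((\<Sum>k<4. (U k 0)\<^sup>2 * l k) * (\<Sum>k<4. (U k 3)\<^sup>2 * l k) - (\<Sum>k<4. U k 0 * U k 3 * l k)\<^sup>2)"
proof -
  have diag: "A i i = (\<Sum>k<4. (U k i)\<^sup>2 * l k)" for i
    unfolding A_def spectral_form_def by (intro sum.cong refl) (simp add: power2_eq_square)
  have symm: "A i j = A j i" for i j unfolding A_def by (rule spectral_form_commute)
  have A03: "A 0 3 = (\<Sum>k<4. U k 0 * U k 3 * l k)"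
    unfolding A_def spectral_form_def by (intro sum.cong refl) simp
  have tr: "(\<Sum>i<4. A i i) = (\<Sum>k<4. l k)"
  proof -
    have "(\<Sum>i<4. A i i) = (\<Sum>k<4. \<Sum>i<4. l k * (U k i * U k i))"
      unfolding A_def spectral_form_def by (subst sum.swap) (simp add: mult.assoc)
    also have "\<dots> = (\<Sum>k<4. l k * 1)"
      unfolding sum_distrib_left[symmetric] using U by (intro sum.cong refl) (simp add: orthogonal_fun_def)
    finally show ?thesis by simp
  qed
  have sq: "(\<Sum>j<4. (A 0 j)\<^sup>2) = (\<Sum>k<4. (U k 0)\<^sup>2 * (l k)\<^sup>2)"
  proof -
    have "(\<Sum>j<4. (A 0 j)\<^sup>2) = (\<Sum>j<4. \<Sum>k<4. \<Sum>m<4. (l k * U k 0) * (l m * U m 0) * (U k j * U m j))"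
      unfolding A_def spectral_form_def power2_eq_square sum_product by (intro sum.cong refl) simp
    also have "\<dots> = (\<Sum>k<4. \<Sum>m<4. \<Sum>j<4. (l k * U k 0) * (l m * U m 0) * (U k j * U m j))"
      by (rule trans[OF sum.swap sum.cong[OF refl sum.swap]])
    also have "\<dots> = (\<Sum>k<4. \<Sum>m<4. (l k * U k 0) * (l m * U m 0) * (if k = m then 1 else 0))"
      unfolding sum_distrib_left[symmetric] using U by (intro sum.cong refl) (simp add: orthogonal_fun_def)
    also have "\<dots> = (\<Sum>k<4. (U k 0)\<^sup>2 * (l k)\<^sup>2)"
      by (intro sum.cong refl) (simp add: power2_eq_square if_distrib cong: if_cong)
    finally show ?thesis .
  qed
  have four: "(\<Sum>i<4. f i) = f 0 + f 1 + f 2 + f 3" for f :: "nat \<Rightarrow> real"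
    by (simp add: eval_nat_numeral lessThan_Suc)
  have "pminor A {0, 1} + pminor A {0, 2}
      = A 0 0 * (\<Sum>i<4. A i i) - (\<Sum>j<4. (A 0 j)\<^sup>2) - (A 0 0 * A 3 3 - (A 0 3)\<^sup>2)"
    unfolding four using symm[of 1 0] symm[of 2 0] by (simp add: pminor_pair power2_eq_square algebra_simps)
  then show ?thesis unfolding tr sq diag[of 0] diag[of 3] A03
    by (simp add: sum_distrib_left sum_distrib_right sum_subtractf power2_eq_square algebra_simps)
qed

text \<open>The pair \<open>(k, m)\<close> found by \<open>pair_mixture\<close> tells which eigenvalues to put in the positions \<open>0\<close> and \<open>3\<close>; the values at
  positions \<open>1\<close> and \<open>2\<close> only enter through their sum.\<close>
lemma quad_mixture:
  assumes U: "orthogonal_fun 4 U"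
  shows "\<exists>\<sigma>. \<sigma> permutes {..<4} \<and>
    mlift 4 (quad_coefs \<epsilon>) (spectral_form 4 l U) \<le> maff 4 (quad_coefs \<epsilon>) (\<lambda>i. l (\<sigma> i))"
proof -
  let ?e1 = "\<Sum>k<4. l k"
  have ex: "(\<Sum>J\<in>Pow {..<4}. (if card J = 2 then 1 else 0) * f J) = (\<Sum>J | J \<subseteq> {..<4} \<and> card J = 2. f J)"
    for f :: "nat set \<Rightarrow> real" using sum_Pow_card[of 2 f 4] by (simp add: elem_coefs_def)
  have lift: "mlift 4 (quad_coefs \<epsilon>) M = (\<Sum>J | J \<subseteq> {..<4} \<and> card J = 2. pminor M J) - \<epsilon> * (pminor M {0, 1} + pminor M {0, 2})"
    for M using sum_quad_coefs[of 4 \<epsilon> "pminor M"] by (simp add: mlift_def ex)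
  have val: "maff 4 (quad_coefs \<epsilon>) v = elem_sum 2 {..<4} v - \<epsilon> * (v 0 * (v 1 + v 2))"
    for v using sum_quad_coefs[of 4 \<epsilon> "prod v", unfolded ex] by (simp add: maff_def elem_sum_def distrib_left)
  have orth: "(\<Sum>k<4. U k i * U k j) = (if i = j then 1 else 0)" if "i < 4" "j < 4" for i j
    using U that by (simp add: orthogonal_fun_def)
  have "\<exists>k<4. \<exists>m<4. m \<noteq> k \<and> (\<Sum>k<4. (U k 0)\<^sup>2 * (- \<epsilon> * (l k * (?e1 - l k))))
      - (- \<epsilon>) * ((\<Sum>k<4. (U k 0)\<^sup>2 * l k) * (\<Sum>k<4. (U k 3)\<^sup>2 * l k) - (\<Sum>k<4. U k 0 * U k 3 * l k)\<^sup>2)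
    \<le> - \<epsilon> * (l k * (?e1 - l k)) - (- \<epsilon>) * (l k * l m)"
    by (rule pair_mixture) (use orth[of 0 0] orth[of 3 3] orth[of 0 3] in \<open>simp_all add: power2_eq_square\<close>)
  then obtain k m where km: "k < 4" "m < 4" "m \<noteq> k"
    and le: "(\<Sum>k<4. (U k 0)\<^sup>2 * (- \<epsilon> * (l k * (?e1 - l k))))
      - (- \<epsilon>) * ((\<Sum>k<4. (U k 0)\<^sup>2 * l k) * (\<Sum>k<4. (U k 3)\<^sup>2 * l k) - (\<Sum>k<4. U k 0 * U k 3 * l k)\<^sup>2)
    \<le> - \<epsilon> * (l k * (?e1 - l k)) - (- \<epsilon>) * (l k * l m)" by blast
  \<comment> \<open>\<open>\<sigma>\<close> sends \<open>0\<close> to \<open>k\<close> and \<open>3\<close> to \<open>m\<close>; \<open>j\<close> is the position that the first transposition moves to \<open>m\<close>.\<close>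
  define j where "j = Transposition.transpose 0 k m"
  define \<sigma> where "\<sigma> = Transposition.transpose 0 k \<circ> Transposition.transpose 3 j"
  have j: "j < 4" "j \<noteq> 0" using km by (auto simp: j_def transpose_def)
  have \<sigma>: "\<sigma> permutes {..<4}"
    unfolding \<sigma>_def using km j by (intro permutes_compose permutes_swap_id) auto
  have \<sigma>0: "\<sigma> 0 = k" using j by (simp add: \<sigma>_def transpose_def)
  have \<sigma>3: "\<sigma> 3 = m" by (simp add: \<sigma>_def j_def)
  have "(\<Sum>i<4. l (\<sigma> i)) = ?e1" by (rule permuted_sum[OF \<sigma>])
  then have e1: "l (\<sigma> 1) + l (\<sigma> 2) = ?e1 - l k - l m"
    by (simp add: eval_nat_numeral lessThan_Suc) (use \<sigma>0 \<sigma>3 in \<open>simp add: eval_nat_numeral\<close>)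
  have "mlift 4 (quad_coefs \<epsilon>) (spectral_form 4 l U)
      = elem_sum 2 {..<4} l - \<epsilon> * (pminor (spectral_form 4 l U) {0, 1} + pminor (spectral_form 4 l U) {0, 2})"
    unfolding lift using full_minor_sum[OF U, of 2 l] by simp
  also have "\<dots> = elem_sum 2 {..<4} l + ((\<Sum>k<4. (U k 0)\<^sup>2 * (- \<epsilon> * (l k * (?e1 - l k))))
      - (- \<epsilon>) * ((\<Sum>k<4. (U k 0)\<^sup>2 * l k) * (\<Sum>k<4. (U k 3)\<^sup>2 * l k) - (\<Sum>k<4. U k 0 * U k 3 * l k)\<^sup>2))"
  proof -
    have "(\<Sum>k<4. (U k 0)\<^sup>2 * (- \<epsilon> * (l k * (?e1 - l k)))) = - \<epsilon> * (\<Sum>k<4. (U k 0)\<^sup>2 * (l k * (?e1 - l k)))"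
      unfolding sum_distrib_left by (intro sum.cong refl) simp
    then show ?thesis unfolding cherry_minors[OF U] by (simp only:) (simp add: right_diff_distrib)
  qed
  also have "\<dots> \<le> elem_sum 2 {..<4} l + (- \<epsilon> * (l k * (?e1 - l k)) - (- \<epsilon>) * (l k * l m))"
    using le by (rule add_left_mono)
  also have "\<dots> = elem_sum 2 {..<4} (\<lambda>i. l (\<sigma> i)) - \<epsilon> * (l (\<sigma> 0) * (l (\<sigma> 1) + l (\<sigma> 2)))"
    unfolding e1 \<sigma>0 elem_sum_reindex[OF \<sigma> permutes_image[OF \<sigma>]] by (simp add: algebra_simps)
  also have "\<dots> = maff 4 (quad_coefs \<epsilon>) (\<lambda>i. l (\<sigma> i))" by (simp add: val)
  finally show ?thesis using \<sigma> by blast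
qed

text \<open>Since \<open>e\<^sub>2 + y e\<^sub>1\<close> is \<open>e\<^sub>2\<close> in five variables, the coefficient function of the perturbed \<open>e\<^sub>2\<close> together with \<open>y e\<^sub>1\<close> is
  \<open>quad_coefs \<epsilon>\<close> again, which is stable in every number of variables from three on.\<close>
theorem quad_spectral_containment:
  assumes \<epsilon>: "\<bar>\<epsilon>\<bar> \<le> 1/2"
  shows "spectral_containment 4 (multiaffine_poly 4 (quad_coefs \<epsilon>))"
proof (rule spectral_containment_normalized)
  show homog: "homog_coefs 4 2 (quad_coefs \<epsilon>)"
    by (auto simp: homog_coefs_def quad_coefs_def elem_coefs_def split: if_splits)
  show "stable_coefs 4 (quad_coefs \<epsilon>)" by (rule quad_coefs_stable) (use \<epsilon> in auto)
  have pos: "maff 4 (quad_coefs \<epsilon>) (\<lambda>_. 1) > 0" by (rule maff_quad_coefs_pos) (use \<epsilon> in auto)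
  fix b assume "b = quad_coefs \<epsilon> \<or> b = (\<lambda>J. - quad_coefs \<epsilon> J)" "maff 4 b (\<lambda>_. 1) > 0"
  then have b: "b = quad_coefs \<epsilon>" using pos by (auto simp: maff_uminus)
  show "contains_spectra 4 b" unfolding b
  proof (rule interlaced_mixture_contains_spectra[OF homog pos _ homog_elem_coefs])
    show "maff 4 (elem_coefs (2 - 1)) (\<lambda>_. 1) > 0" by (simp add: maff_elem_coefs elem_sum_ones)
    show "stable_coefs (Suc 4) (quad_coefs \<epsilon>)" by (rule quad_coefs_stable) (use \<epsilon> in auto)
    show "elem_coefs (2 - 1) (\<sigma> ` J) = elem_coefs (2 - 1) J" if "\<sigma> permutes {..<4}" for \<sigma> J
      by (rule elem_coefs_permute[OF that])
    show "quad_coefs \<epsilon> (insert 4 J) = elem_coefs (2 - 1) J" if J: "J \<subseteq> {..<4}" for J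
    proof -
      have "finite J" "4 \<notin> J" using J finite_subset by auto
      moreover have "insert 4 J \<noteq> {0, 1}" "insert 4 J \<noteq> {0, 2}" by (rule notI, drule equalityD1, simp)+
      ultimately show ?thesis by (simp add: quad_coefs_def elem_coefs_def)
    qed
    show "\<exists>\<sigma>. \<sigma> permutes {..<4} \<and>
        mlift 4 (quad_coefs \<epsilon>) (spectral_form 4 l U) \<le> maff 4 (quad_coefs \<epsilon>) (\<lambda>i. l (\<sigma> i))"
      if "orthogonal_fun 4 U" for l U by (rule quad_mixture[OF that])
  qed simp_all
qed

section \<open>The spectral containment property of the listed polynomials\<close>

lemma homogeneous_stable_coefs:
  assumes "p \<in> poly_ring n" "multiaffine p" "homogeneous d p" "stable_poly n p"
  obtains a where "p = multiaffine_poly n a" "homog_coefs n d a" "stable_coefs n a"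
proof -
  have p: "multiaffine_poly n (coef p) = p" using assms(1,2) by (rule multiaffine_poly_coef)
  then show thesis
    using that[of "coef p"] assms(3,4) homogeneous_multiaffine_poly_iff[of d n "coef p"]
      stable_poly_multiaffine_poly[of n "coef p"]
    by (simp add: homog_coefs_def)
qed

lemma homogeneous_one_multiaffine:
  assumes "homogeneous 1 p"
  shows "multiaffine p"
  unfolding multiaffine_def
proof (intro ballI allI)
  fix m i assume m: "m \<in> Poly_Mapping.keys p"
  show "Poly_Mapping.lookup m i \<le> 1"
  proof (cases "i \<in> Poly_Mapping.keys m")
    case True
    then have "Poly_Mapping.lookup m i \<le> (\<Sum>i\<in>Poly_Mapping.keys m. Poly_Mapping.lookup m i)"
      by (intro member_le_sum) auto
    then show ?thesis using assms m by (simp add: homogeneous_def)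
  qed (simp add: in_keys_iff)
qed

theorem linear_spectral_containment:
  assumes "p \<in> poly_ring n" "homogeneous 1 p" "stable_poly n p"
  shows "spectral_containment n p"
proof -
  obtain a where a: "p = multiaffine_poly n a" "homog_coefs n 1 a" "stable_coefs n a"
    using homogeneous_stable_coefs[OF assms(1) homogeneous_one_multiaffine[OF assms(2)] assms(2,3)] .
  show ?thesis unfolding a(1)
    using a(2,3) linear_contains_spectra by (rule spectral_containment_normalized)
qed

text \<open>For \<open>n = 2\<close> the polynomial is linear. For \<open>n \<ge> 3\<close> the interlacing lemma controls the sign relative to \<open>p(\<one>)\<close>, which
  does not depend on the sign chosen for \<open>p\<close>.\<close>
theorem corank_one_spectral_containment:
  assumes n: "n \<ge> 2" and p: "p \<in> poly_ring n" "homogeneous (n - 1) p" "multiaffine p" "stable_poly n p"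
    and il: "interlaces n (elem_sym (n - 2) n) p"
  shows "spectral_containment n p"
proof (cases "n = 2")
  case True
  then show ?thesis using p by (intro linear_spectral_containment) auto
next
  case False
  with n have n3: "n \<ge> 3" by simp
  obtain a where a: "p = multiaffine_poly n a" "homog_coefs n (n - 1) a" "stable_coefs n a"
    using homogeneous_stable_coefs[OF p(1,3,2,4)] .
  show ?thesis unfolding a(1)
  proof (rule spectral_containment_normalized[OF a(2,3)])
    fix b assume b: "b = a \<or> b = (\<lambda>J. - a J)" "homog_coefs n (n - 1) b" "maff n b (\<lambda>_. 1) > 0"
    show "contains_spectra n b"
    proof (rule corank_one_contains_spectra[OF _ b(2,3)])
      fix l assume "\<And>\<sigma>. \<sigma> permutes {..<n} \<Longrightarrow> \<exists>s>0. maff n b (\<lambda>i. l (\<sigma> i) + s) = 0"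
      then have "\<exists>s>0. maff n a (\<lambda>i. l (\<sigma> i) + s) = 0" if "\<sigma> permutes {..<n}" for \<sigma>
        using that b(1) by (auto simp: maff_uminus)
      then have "\<exists>s>0. \<forall>\<sigma>. \<sigma> permutes {..<n} \<longrightarrow> maff n a (\<lambda>i. l (\<sigma> i) + s) * maff n a (\<lambda>_. 1) \<le> 0"
        by (rule corank_one_interlacing[OF n3 a(2) stable_homog_at_ones[OF a(3,2)] il[unfolded a(1)]])
      moreover have "maff n a x * maff n a (\<lambda>_. 1) = maff n b x * maff n b (\<lambda>_. 1)" for x
        using b(1) by (auto simp: maff_uminus)
      ultimately show "\<exists>s>0. \<forall>\<sigma>. \<sigma> permutes {..<n} \<longrightarrow> maff n b (\<lambda>i. l (\<sigma> i) + s) \<le> 0"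
        using b(3) by (simp add: mult_le_0_iff not_le[symmetric])
    qed (use n in simp)
  qed
qed

theorem Var_times_spectral_containment:
  assumes "spectral_containment n p"
  shows "spectral_containment (Suc n) (Var n * p)"
proof -
  obtain d where "homogeneous d p" using assms by (auto simp: spectral_containment_def)
  then obtain a where a: "p = multiaffine_poly n a" "homog_coefs n d a" "stable_coefs n a"
    using assms homogeneous_stable_coefs[of p n d] unfolding spectral_containment_def by metis
  have "Var n * p = multiaffine_poly (Suc n) (border_coefs n a)"
    unfolding a(1) Var_times_multiaffine_poly by (simp add: border_coefs_def[abs_def])
  also have "spectral_containment (Suc n) \<dots>"
  proof (rule spectral_containment_normalized[OF homog_border_coefs[OF a(2)] stable_border_coefs[OF a(3)]])
    fix b assume b: "b = border_coefs n a \<or> b = (\<lambda>J. - border_coefs n a J)"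
      and pos: "maff (Suc n) b (\<lambda>_. 1) > 0"
    obtain c where c: "c = a \<or> c = (\<lambda>J. - a J)" and bc: "b = border_coefs n c"
    proof -
      have "(\<lambda>J. - border_coefs n a J) = border_coefs n (\<lambda>J. - a J)" by (simp add: border_coefs_def fun_eq_iff)
      then show thesis using that b by metis
    qed
    show "contains_spectra (Suc n) b" unfolding bc
    proof (rule border_contains_spectra)
      show "stable_coefs n c" using c a(3) by (auto simp: stable_coefs_def maff_def sum_negf)
      show "homog_coefs n d c" using c a(2) by (auto simp: homog_coefs_def)
      show "maff n c (\<lambda>_. 1) > 0" using pos by (simp add: bc maff_border_coefs)
      fix B assume B: "B \<in> sym_mats n"
        and nz: "\<And>s. s > 0 \<Longrightarrow> mlift n c (\<lambda>i j. B $$ (i, j) + (if i = j then s else 0)) \<noteq> 0"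
      have "B \<in> cone_lift n p"
        unfolding a(1) cone_lift_multiaffine_poly_iff using B nz c by (auto simp: mlift_uminus)
      then obtain m where "eigenvalue_vector B m" "m \<in> cone_poly n p"
        using assms by (auto simp: spectral_containment_def)
      then show "\<exists>m :: real vec. eigenvalue_vector B m \<and> (\<forall>s>0. maff n c (\<lambda>i. m $ i + s) \<noteq> 0)"
        unfolding a(1) cone_poly_multiaffine_poly_iff using c by (auto simp: maff_uminus)
    qed
  qed
  finally show ?thesis .
qed

lemma elem_sym_perturbation:
  assumes "k \<le> n"
  shows "elem_sym d n + Const \<epsilon> * elem_sym d k = multiaffine_poly n (pert_coefs d k \<epsilon>)"
  unfolding elem_sym_eq_multiaffine_poly[OF assms] elem_sym_eq_multiaffine_poly[OF order_refl[of n]]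
    Const_times_multiaffine_poly multiaffine_poly_add
  by (rule multiaffine_poly_cong) (simp add: pert_coefs_def elem_coefs_def)

lemma prod_Var_eq_multiaffine_poly:
  assumes "K \<subseteq> {..<n}"
  shows "(\<Prod>i\<in>K. Var i) = multiaffine_poly n (\<lambda>J. if J = K then 1 else 0)"
proof -
  have "multiaffine_poly n (\<lambda>J. if J = K then 1 else 0)
      = (\<Sum>J\<in>Pow {..<n}. if J = K then Poly_Mapping.single (sqfree J) 1 else 0)"
    unfolding multiaffine_poly_def by (intro sum.cong refl) simp
  also have "\<dots> = (\<Prod>i\<in>K. Var i)" using assms finite_subset[OF assms] by (subst sum.delta) (simp_all add: prod_Var)
  finally show ?thesis by simp
qed

lemma elem_sym_two_cherry:
  "elem_sym 2 4 - Const \<epsilon> * (Var 0 * Var 1 + Var 0 * Var 2) = multiaffine_poly 4 (quad_coefs \<epsilon>)"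
proof -
  have V: "Var 0 * Var 1 + Var 0 * Var 2
      = multiaffine_poly 4 (\<lambda>J. (if J = {0, 1} then 1 else 0) + (if J = {0, 2} then 1 else 0))"
    using prod_Var_eq_multiaffine_poly[of "{0, 1}" 4] prod_Var_eq_multiaffine_poly[of "{0, 2}" 4]
    by (simp flip: multiaffine_poly_add)
  have "multiaffine_poly 4 (quad_coefs \<epsilon>) + Const \<epsilon> * (Var 0 * Var 1 + Var 0 * Var 2) = elem_sym 2 4"
    unfolding V Const_times_multiaffine_poly multiaffine_poly_add elem_sym_eq_multiaffine_poly[OF order_refl]
    by (rule multiaffine_poly_cong) (simp add: quad_coefs_def elem_coefs_def)
  then show ?thesis by (simp add: diff_eq_eq)
qed

theorem theorem2p9:
  shows
    "(\<forall>n d. 1 \<le> d \<and> d \<le> n \<longrightarrow> spectral_containment n (elem_sym d n)) \<and>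
     (\<forall>n k d. 1 \<le> d \<and> d \<le> k \<and> k \<le> n \<longrightarrow>
        (\<exists>\<epsilon>\<^sub>0>0. \<forall>\<epsilon>::real. \<bar>\<epsilon>\<bar> < \<epsilon>\<^sub>0 \<longrightarrow>
           spectral_containment n (elem_sym d n + Const \<epsilon> * elem_sym d k))) \<and>
     (\<forall>n p. p \<in> poly_ring n \<and> homogeneous 1 p \<and> stable_poly n p \<longrightarrow> spectral_containment n p) \<and>
     (\<forall>n p. n \<ge> 2 \<and> p \<in> poly_ring n \<and> homogeneous (n - 1) p \<and> multiaffine p \<and> stable_poly n p \<and>
        interlaces n (elem_sym (n - 2) n) p \<longrightarrow> spectral_containment n p) \<and>
     (\<exists>\<epsilon>\<^sub>0>0. \<forall>\<epsilon>::real. \<bar>\<epsilon>\<bar> < \<epsilon>\<^sub>0 \<longrightarrow>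
        spectral_containment 4
          (elem_sym 2 4 - Const \<epsilon> * (Var 0 * Var 1 + Var 0 * Var 2))) \<and>
     (\<forall>n p. spectral_containment n p \<longrightarrow> spectral_containment (Suc n) (Var n * p))"
proof (intro conjI)
  show "\<forall>n k d. 1 \<le> d \<and> d \<le> k \<and> k \<le> n \<longrightarrow>
      (\<exists>\<epsilon>\<^sub>0>0. \<forall>\<epsilon>::real. \<bar>\<epsilon>\<bar> < \<epsilon>\<^sub>0 \<longrightarrow>
         spectral_containment n (elem_sym d n + Const \<epsilon> * elem_sym d k))"
    using pert_spectral_containment by (simp add: elem_sym_perturbation)
  show "\<forall>n d. 1 \<le> d \<and> d \<le> n \<longrightarrow> spectral_containment n (elem_sym d n)"
  proof (intro allI impI)
    fix n d :: nat assume "1 \<le> d \<and> d \<le> n"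
    then have "spectral_containment n (multiaffine_poly n (pert_coefs d n 0))"
      using pert_spectral_containment[of d n n] by auto
    then show "spectral_containment n (elem_sym d n)"
      unfolding elem_sym_perturbation[OF order_refl, symmetric] by (simp add: Const_def)
  qed
  show "\<forall>n p. p \<in> poly_ring n \<and> homogeneous 1 p \<and> stable_poly n p \<longrightarrow> spectral_containment n p"
    using linear_spectral_containment by blast
  show "\<forall>n p. n \<ge> 2 \<and> p \<in> poly_ring n \<and> homogeneous (n - 1) p \<and> multiaffine p \<and> stable_poly n p \<and>
      interlaces n (elem_sym (n - 2) n) p \<longrightarrow> spectral_containment n p"
    using corank_one_spectral_containment by blast
  show "\<exists>\<epsilon>\<^sub>0>0. \<forall>\<epsilon>::real. \<bar>\<epsilon>\<bar> < \<epsilon>\<^sub>0 \<longrightarrow>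
      spectral_containment 4 (elem_sym 2 4 - Const \<epsilon> * (Var 0 * Var 1 + Var 0 * Var 2))"
    unfolding elem_sym_two_cherry using quad_spectral_containment by (intro exI[of _ "1/2"]) auto
  show "\<forall>n p. spectral_containment n p \<longrightarrow> spectral_containment (Suc n) (Var n * p)"
    using Var_times_spectral_containment by blast
qed

end
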